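(* The projected Aubry set $\mathcal{A}=\{x\in\mathbb{T}^d: h(x,x)=0\}$ is nonempty.
   Context: Setting: $1\le m\le d$, $\mathbb{T}^d=\mathbb{R}^d/\mathbb{Z}^d$. $f_1,\dots,f_m$ smooth vector fields on $\mathbb{T}^d$ satisfying the Hörmander condition; $F(x)=[f_1(x)|\cdots|f_m(x)]$. (F): $F\in C^{1,1}$, rank $F(x)=m$. Admissible pairs $(\gamma,u)$: $\gamma$ absolutely continuous, $u\in L^2$, $\dot\gamma=F(\gamma)u$ a.e.; $\Gamma^{x\to y}_{0,t}$ those on $[0,t]$ from $x$ to $y$. (L): $L\in C^2(\mathbb{T}^d\times\mathbb{R}^m)$, $D^2_uL\ge0$, $L(x,u)\ge K_1|u|^\sigma-K_2$ ($\sigma>1$). $H(x,p)=\sup_u\{\langle F^*(x)p,u\rangle-L(x,u)\}$. (S): no singular minimizing controls other than zero for $V^T(x)=\inf\{\int_0^TL(\gamma,u):\gamma(0)=x\}$. $\bar c=\lim_{T\to\infty}V^T(x)/T$. $A_t(x,y)=\inf_{\Gamma^{x\to y}_{0,t}}\int_0^tL$. Peierls barrier $h(x,y)=\liminf_{t\to\infty}[A_t(x,y)-\bar c t]$. Assumptions (F), (L), (S) are in force. *)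

theory Defs
  imports "HOL-Analysis.Analysis"
begin

fun Ck :: "nat \<Rightarrow> ('a::euclidean_space \<Rightarrow> real) \<Rightarrow> bool" where
  "Ck 0 g = continuous_on UNIV g"
| "Ck (Suc k) g = ((\<forall>x. g differentiable (at x)) \<and>
      (\<forall>b\<in>Basis. Ck k (\<lambda>x. frechet_derivative g (at x) b)))"

definition smooth_fun :: "('a::euclidean_space \<Rightarrow> real) \<Rightarrow> bool" where
  "smooth_fun g \<longleftrightarrow> (\<forall>k. Ck k g)"

definition smooth_field :: "(real^'d \<Rightarrow> real^'d) \<Rightarrow> bool" where
  "smooth_field X \<longleftrightarrow> (\<forall>j. smooth_fun (\<lambda>x. X x $ j))"

definition int_vec :: "real^'d \<Rightarrow> bool" where
  "int_vec k \<longleftrightarrow> (\<forall>i. k $ i \<in> \<int>)"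

definition periodic_on_torus :: "(real^'d \<Rightarrow> 'b) \<Rightarrow> bool" where
  "periodic_on_torus g \<longleftrightarrow> (\<forall>x k. int_vec k \<longrightarrow> g (x + k) = g x)"

definition torus_eq :: "real^'d \<Rightarrow> real^'d \<Rightarrow> bool" where
  "torus_eq x y \<longleftrightarrow> int_vec (x - y)"

definition lie_bracket :: "(real^'d \<Rightarrow> real^'d) \<Rightarrow> (real^'d \<Rightarrow> real^'d) \<Rightarrow> real^'d \<Rightarrow> real^'d" where
  "lie_bracket X Y x = frechet_derivative Y (at x) (X x) - frechet_derivative X (at x) (Y x)"

inductive_set lie_gen :: "('m \<Rightarrow> real^'d \<Rightarrow> real^'d) \<Rightarrow> (real^'d \<Rightarrow> real^'d) set"
  for f where
  base: "f i \<in> lie_gen f"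
| brk: "X \<in> lie_gen f \<Longrightarrow> Y \<in> lie_gen f \<Longrightarrow> lie_bracket X Y \<in> lie_gen f"

definition hoermander :: "('m \<Rightarrow> real^'d \<Rightarrow> real^'d) \<Rightarrow> bool" where
  "hoermander f \<longleftrightarrow> (\<forall>x. span {X x | X. X \<in> lie_gen f} = UNIV)"

definition Fmat :: "('m::finite \<Rightarrow> real^'d \<Rightarrow> real^'d) \<Rightarrow> real^'d \<Rightarrow> real^'m^'d" where
  "Fmat f x = (\<chi> r. \<chi> c. f c x $ r)"

definition Fapp :: "('m::finite \<Rightarrow> real^'d \<Rightarrow> real^'d) \<Rightarrow> real^'d \<Rightarrow> real^'m \<Rightarrow> real^'d" where
  "Fapp f x u = Fmat f x *v u"

definition C11_field :: "(real^'d \<Rightarrow> real^'d) \<Rightarrow> bool" where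
  "C11_field X \<longleftrightarrow> (\<forall>j. Ck 1 (\<lambda>x. X x $ j)) \<and>
     (\<exists>C. \<forall>x y v. norm (frechet_derivative X (at x) v - frechet_derivative X (at y) v)
                   \<le> C * norm (x - y) * norm v)"

definition abs_cont_on :: "real \<Rightarrow> real \<Rightarrow> (real \<Rightarrow> 'a::real_normed_vector) \<Rightarrow> bool" where
  "abs_cont_on a b g \<longleftrightarrow> (\<forall>\<epsilon>>0. \<exists>\<delta>>0. \<forall>n (s::nat\<Rightarrow>real) e.
      (\<forall>i<n. a \<le> s i \<and> s i \<le> e i \<and> e i \<le> b) \<and>
      (\<forall>i<n. \<forall>j<n. i \<noteq> j \<longrightarrow> e i \<le> s j \<or> e j \<le> s i) \<and>
      (\<Sum>i<n. e i - s i) < \<delta> \<longrightarrow> (\<Sum>i<n. norm (g (e i) - g (s i))) < \<epsilon>)"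

definition L2_on :: "real \<Rightarrow> (real \<Rightarrow> real^'m) \<Rightarrow> bool" where
  "L2_on t u \<longleftrightarrow> u \<in> borel_measurable (lebesgue_on {0..t}) \<and>
                 integrable (lebesgue_on {0..t}) (\<lambda>s. (norm (u s))\<^sup>2)"

text \<open>(gamma,u) admissible on [0,t] (gamma is a lift to R^d of a curve in T^d).\<close>
definition admissible :: "('m::finite \<Rightarrow> real^'d \<Rightarrow> real^'d) \<Rightarrow> real \<Rightarrow> (real \<Rightarrow> real^'d) \<Rightarrow> (real \<Rightarrow> real^'m) \<Rightarrow> bool" where
  "admissible f t \<gamma> u \<longleftrightarrow> abs_cont_on 0 t \<gamma> \<and> L2_on t u \<and>
     (AE s in lebesgue_on {0..t}. (\<gamma> has_vector_derivative Fapp f (\<gamma> s) (u s)) (at s))"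

text \<open>Action; L(gamma,u) is bounded below, so a non-integrable action equals +infinity.\<close>
definition action :: "(real^'d \<Rightarrow> real^'m \<Rightarrow> real) \<Rightarrow> real \<Rightarrow> (real \<Rightarrow> real^'d) \<Rightarrow> (real \<Rightarrow> real^'m) \<Rightarrow> ereal" where
  "action L t \<gamma> u = (if integrable (lebesgue_on {0..t}) (\<lambda>s. L (\<gamma> s) (u s))
       then ereal (integral\<^sup>L (lebesgue_on {0..t}) (\<lambda>s. L (\<gamma> s) (u s))) else \<infinity>)"

definition valueV :: "('m::finite \<Rightarrow> real^'d \<Rightarrow> real^'d) \<Rightarrow> (real^'d \<Rightarrow> real^'m \<Rightarrow> real) \<Rightarrow> real \<Rightarrow> real^'d \<Rightarrow> ereal" where
  "valueV f L T x = (INF (\<gamma>,u)\<in>{(\<gamma>,u). admissible f T \<gamma> u \<and> \<gamma> 0 = x}. action L T \<gamma> u)"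

text \<open>A_t(x,y): infimum over curves in T^d from x to y, i.e. lifts starting at x
  and ending at a point of y + Z^d.\<close>
definition actionA :: "('m::finite \<Rightarrow> real^'d \<Rightarrow> real^'d) \<Rightarrow> (real^'d \<Rightarrow> real^'m \<Rightarrow> real) \<Rightarrow> real \<Rightarrow> real^'d \<Rightarrow> real^'d \<Rightarrow> ereal" where
  "actionA f L t x y = (INF (\<gamma>,u)\<in>{(\<gamma>,u). admissible f t \<gamma> u \<and> \<gamma> 0 = x \<and> torus_eq (\<gamma> t) y}.
        action L t \<gamma> u)"

text \<open>Critical value c = lim_{T\<rightarrow>\<infinity>} V^T(x)/T (independent of x; evaluated at x = 0).\<close>
definition crit_value :: "('m::finite \<Rightarrow> real^'d \<Rightarrow> real^'d) \<Rightarrow> (real^'d \<Rightarrow> real^'m \<Rightarrow> real) \<Rightarrow> real" where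
  "crit_value f L = Lim at_top (\<lambda>T. real_of_ereal (valueV f L T 0) / T)"

definition peierls :: "('m::finite \<Rightarrow> real^'d \<Rightarrow> real^'d) \<Rightarrow> (real^'d \<Rightarrow> real^'m \<Rightarrow> real) \<Rightarrow> real^'d \<Rightarrow> real^'d \<Rightarrow> ereal" where
  "peierls f L x y = Liminf at_top (\<lambda>t. actionA f L t x y - ereal (crit_value f L * t))"

text \<open>End-point map u \<mapsto> gamma_u(T) with gamma_u(0) = x (trajectory unique by Lipschitz F).\<close>
definition endpoint :: "('m::finite \<Rightarrow> real^'d \<Rightarrow> real^'d) \<Rightarrow> real^'d \<Rightarrow> real \<Rightarrow> (real \<Rightarrow> real^'m) \<Rightarrow> real^'d" where
  "endpoint f x T u = (THE \<gamma>. admissible f T \<gamma> u \<and> \<gamma> 0 = x \<and> (\<forall>s. s \<notin> {0..T} \<longrightarrow> \<gamma> s = 0)) T"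

definition singular_control :: "('m::finite \<Rightarrow> real^'d \<Rightarrow> real^'d) \<Rightarrow> real^'d \<Rightarrow> real \<Rightarrow> (real \<Rightarrow> real^'m) \<Rightarrow> bool" where
  "singular_control f x T u \<longleftrightarrow>
     \<not> (\<forall>w. \<exists>v. L2_on T v \<and>
          ((\<lambda>\<epsilon>. endpoint f x T (\<lambda>s. u s + \<epsilon> *\<^sub>R v s)) has_vector_derivative w) (at 0))"

definition minimizing_control :: "('m::finite \<Rightarrow> real^'d \<Rightarrow> real^'d) \<Rightarrow> (real^'d \<Rightarrow> real^'m \<Rightarrow> real) \<Rightarrow> real^'d \<Rightarrow> real \<Rightarrow> (real \<Rightarrow> real^'m) \<Rightarrow> bool" where
  "minimizing_control f L x T u \<longleftrightarrow>
     (\<exists>\<gamma>. admissible f T \<gamma> u \<and> \<gamma> 0 = x \<and> action L T \<gamma> u = valueV f L T x)"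

definition assumption_S :: "('m::finite \<Rightarrow> real^'d \<Rightarrow> real^'d) \<Rightarrow> (real^'d \<Rightarrow> real^'m \<Rightarrow> real) \<Rightarrow> bool" where
  "assumption_S f L \<longleftrightarrow> (\<forall>x T u. T > 0 \<longrightarrow> minimizing_control f L x T u \<longrightarrow>
      singular_control f x T u \<longrightarrow> (AE s in lebesgue_on {0..T}. u s = 0))"

definition assumption_F :: "('m::finite \<Rightarrow> real^'d \<Rightarrow> real^'d) \<Rightarrow> bool" where
  "assumption_F f \<longleftrightarrow> (\<forall>i. C11_field (f i)) \<and> (\<forall>x. rank (Fmat f x) = CARD('m))"

definition assumption_L :: "(real^'d \<Rightarrow> real^'m \<Rightarrow> real) \<Rightarrow> bool" where
  "assumption_L L \<longleftrightarrow> periodic_on_torus L \<and> Ck 2 (\<lambda>(x,u). L x u) \<and>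
     (\<forall>x u v. frechet_derivative (\<lambda>w. frechet_derivative (L x) (at w) v) (at u) v \<ge> 0) \<and>
     (\<exists>K1 K2 \<sigma>. K1 > 0 \<and> \<sigma> > 1 \<and> (\<forall>x u. L x u \<ge> K1 * norm u powr \<sigma> - K2))"

definition aubry_set :: "('m::finite \<Rightarrow> real^'d \<Rightarrow> real^'d) \<Rightarrow> (real^'d \<Rightarrow> real^'m \<Rightarrow> real) \<Rightarrow> (real^'d) set" where
  "aubry_set f L = {x. peierls f L x x = 0}"

end

theory Submission
  imports Defs "HOL-Computational_Algebra.Formal_Power_Series"
begin

text \<open>
  Controllability. For a word of flows of the fields \<open>\<plusminus>f\<^sub>i\<close>, each run for time \<open>t\<close>, Taylor's theorem in
  \<open>t\<close> alone expands \<open>g (P\<^sub>t x)\<close>, for smooth \<open>g\<close>, as a power series in \<open>t\<close> whose coefficients are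
  differential operators applied to \<open>g\<close>; composition of words is multiplication of these series over
  the noncommutative ring of operators. Commutator words therefore start with \<open>1 + t\<^sup>k Z\<close> for an
  iterated bracket \<open>Z\<close> of order \<open>k\<close>, and applying them to the coordinates gives
  \<open>P\<^sub>t x = x + t\<^sup>k Z(x) + O(t\<^sup>k\<^sup>+\<^sup>1)\<close>. Under Hoermander's condition, combining such words along a basis of
  brackets and using Brouwer's theorem steers \<open>x\<close> to every nearby point in small time, with action
  at most a constant times that time.

  Recurrence. Let \<open>c\<close> be the infimum of the mean actions of closed curves. Closing up curves in bounded
  time shows that \<open>c\<close> is the critical value and that the action of a curve of length \<open>t\<close> is at least
  \<open>c t - C\<close>; cutting many rounds of a cheap loop into pieces gives curves of any length \<open>t\<close> with action
  at most \<open>c t + 1\<close>. Sampling such a curve at long intervals, the pigeonhole principle applied to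
  position on the torus and accumulated excess action yields arbitrarily long, almost closed pieces
  of arbitrarily small excess. A limit point \<open>x\<close> of their base points satisfies \<open>h(x,x) \<le> 0\<close>, while
  closed curves always have action at least \<open>c t\<close>.
\<close>

subsection \<open>Smooth periodic vector fields\<close>

text \<open>Flows are never differentiated in their initial point: the derivative in t of
  \<open>ev g (P t x)\<close> is \<open>app (along X) g\<close> evaluated on the same trajectory.
  Remainders are uniform in x because \<open>along X\<close> turns every test function into a
  periodic, hence bounded one. Brackets are never integrated either: only the flows of
  \<open>f i\<close> and of their negatives are built, on one common time interval, and brackets
  appear as coefficients of series.

  Flow times enter as k-th roots of coordinates, so the steering map is merely known to be
  continuous, with a first-order expansion at one point; this is why Brouwer's theorem takes the
  place of an inverse function theorem.

  The system has no drift: reversing time turns a control w into -w. Reaching at bounded price is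
  therefore symmetric, which makes reachable sets open and closed and lets curves be closed up.

  The pigeonhole argument needs the excess action of all initial pieces to stay in an interval
  independent of the length. Its lower end comes from closing up; its upper end is the excess of the
  whole curve, at most 1, minus the lower bound for the piece that remains.\<close>

lemma Ck_SucD: "Ck (Suc k) g \<Longrightarrow> Ck k g"
proof (induction k arbitrary: g)
  case 0
  then show ?case
    by (auto intro!: continuous_at_imp_continuous_on differentiable_imp_continuous_within)
qed auto

lemma Ck_const: "Ck k (\<lambda>x. c)"
  by (induction k arbitrary: c) auto

lemma frechet_derivative_plus_real:
  fixes g h :: "'a::euclidean_space \<Rightarrow> real"
  assumes "g differentiable at x" "h differentiable at x"
  shows "frechet_derivative (\<lambda>x. g x + h x) (at x) v
    = frechet_derivative g (at x) v + frechet_derivative h (at x) v"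
  using frechet_derivative_at[OF has_derivative_add[OF assms[unfolded frechet_derivative_works]]]
  by metis

lemma frechet_derivative_times_real:
  fixes g h :: "'a::euclidean_space \<Rightarrow> real"
  assumes "g differentiable at x" "h differentiable at x"
  shows "frechet_derivative (\<lambda>x. g x * h x) (at x) v
    = g x * frechet_derivative h (at x) v + frechet_derivative g (at x) v * h x"
  using frechet_derivative_at[OF has_derivative_mult[OF assms[unfolded frechet_derivative_works]]]
  by metis

lemma Ck_add: "Ck k g \<Longrightarrow> Ck k h \<Longrightarrow> Ck k (\<lambda>x. g x + h x)"
proof (induction k arbitrary: g h)
  case 0
  then show ?case by (auto intro: continuous_on_add continuous_on_mult)
next
  case (Suc k)
  then show ?case by (auto simp: frechet_derivative_plus_real)
qed

lemma Ck_mult: "Ck k g \<Longrightarrow> Ck k h \<Longrightarrow> Ck k (\<lambda>x. g x * h x)"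
proof (induction k arbitrary: g h)
  case 0
  then show ?case by (auto intro: continuous_on_add continuous_on_mult)
next
  case (Suc k)
  have "Ck k g" "Ck k h" using Suc.prems by (blast intro: Ck_SucD)+
  then have "Ck k (\<lambda>x. g x * frechet_derivative h (at x) b + frechet_derivative g (at x) b * h x)"
    if "b \<in> Basis" for b
    using Suc.prems that by (intro Ck_add Suc.IH) auto
  then show ?case using Suc.prems by (auto simp: frechet_derivative_times_real)
qed

lemma Ck_sum: "(\<And>i. i \<in> I \<Longrightarrow> Ck k (g i)) \<Longrightarrow> Ck k (\<lambda>x. \<Sum>i\<in>I. g i x)"
  by (induction I rule: infinite_finite_induct) (auto simp: Ck_const intro: Ck_add)

lemma smooth_fun_differentiable: "smooth_fun g \<Longrightarrow> g differentiable at x"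
  unfolding smooth_fun_def by (metis Ck.simps(2))

lemma smooth_fun_continuous: "smooth_fun g \<Longrightarrow> continuous_on S g"
  unfolding smooth_fun_def by (metis Ck.simps(1) continuous_on_subset subset_UNIV)

lemma smooth_fun_const: "smooth_fun (\<lambda>x. c)"
  by (simp add: smooth_fun_def Ck_const)

lemma smooth_fun_add: "smooth_fun g \<Longrightarrow> smooth_fun h \<Longrightarrow> smooth_fun (\<lambda>x. g x + h x)"
  by (simp add: smooth_fun_def Ck_add)

lemma smooth_fun_mult: "smooth_fun g \<Longrightarrow> smooth_fun h \<Longrightarrow> smooth_fun (\<lambda>x. g x * h x)"
  by (simp add: smooth_fun_def Ck_mult)

lemma smooth_fun_sum: "(\<And>i. i \<in> I \<Longrightarrow> smooth_fun (g i)) \<Longrightarrow> smooth_fun (\<lambda>x. \<Sum>i\<in>I. g i x)"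
  by (simp add: smooth_fun_def Ck_sum)

lemma smooth_fun_partial:
  "smooth_fun g \<Longrightarrow> b \<in> Basis \<Longrightarrow> smooth_fun (\<lambda>x. frechet_derivative g (at x) b)"
  unfolding smooth_fun_def by (metis Ck.simps(2))

lemma frechet_derivative_expand:
  fixes g :: "'a::euclidean_space \<Rightarrow> real"
  assumes "g differentiable at x"
  shows "frechet_derivative g (at x) v = (\<Sum>b\<in>Basis. (v \<bullet> b) * frechet_derivative g (at x) b)"
proof -
  have "linear (frechet_derivative g (at x))"
    by (rule linear_frechet_derivative[OF assms])
  then have "frechet_derivative g (at x) (\<Sum>b\<in>Basis. (v \<bullet> b) *\<^sub>R b)
      = (\<Sum>b\<in>Basis. (v \<bullet> b) * frechet_derivative g (at x) b)"
    by (simp add: linear_sum linear_cmul)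
  then show ?thesis by (simp add: euclidean_representation)
qed

lemma smooth_fun_deriv_along:
  assumes "smooth_fun g" "\<And>b. b \<in> Basis \<Longrightarrow> smooth_fun (\<lambda>x. X x \<bullet> b)"
  shows "smooth_fun (\<lambda>x. frechet_derivative g (at x) (X x))"
  using assms
  by (subst frechet_derivative_expand[OF smooth_fun_differentiable])
     (auto intro!: smooth_fun_sum smooth_fun_mult smooth_fun_partial)

lemma smooth_field_inner:
  fixes X :: "real^'d \<Rightarrow> real^'d"
  assumes "smooth_field X" "b \<in> Basis" shows "smooth_fun (\<lambda>x. X x \<bullet> b)"
  using assms by (auto simp: smooth_field_def Basis_vec_def inner_axis)

lemma smooth_field_differentiable:
  fixes X :: "real^'d \<Rightarrow> real^'d"
  assumes "smooth_field X" shows "X differentiable at x"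
  using assms by (subst differentiable_componentwise_within) (blast intro: smooth_field_inner smooth_fun_differentiable)

lemma frechet_derivative_nth:
  fixes X :: "real^'d \<Rightarrow> real^'d"
  assumes "X differentiable at x"
  shows "frechet_derivative (\<lambda>y. X y $ j) (at x) v = frechet_derivative X (at x) v $ j"
proof -
  have "(X has_derivative frechet_derivative X (at x)) (at x)"
    using assms frechet_derivative_works by blast
  then have "((\<lambda>y. X y $ j) has_derivative (\<lambda>v. frechet_derivative X (at x) v $ j)) (at x)"
    by (rule bounded_linear.has_derivative[OF bounded_linear_vec_nth])
  from frechet_derivative_at[OF this] show ?thesis by metis
qed

lemma lie_bracket_nth:
  fixes X Y :: "real^'d \<Rightarrow> real^'d"
  assumes "smooth_field X" "smooth_field Y"
  shows "lie_bracket X Y x $ j = frechet_derivative (\<lambda>y. Y y $ j) (at x) (X x)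
    - frechet_derivative (\<lambda>y. X y $ j) (at x) (Y x)"
  by (simp add: lie_bracket_def frechet_derivative_nth smooth_field_differentiable assms)

lemma smooth_field_lie_bracket:
  fixes X Y :: "real^'d \<Rightarrow> real^'d"
  assumes "smooth_field X" "smooth_field Y"
  shows "smooth_field (lie_bracket X Y)"
  unfolding smooth_field_def lie_bracket_nth[OF assms]
proof
  fix j
  have 1: "smooth_fun (\<lambda>x. frechet_derivative (\<lambda>y. Y y $ j) (at x) (X x))"
    "smooth_fun (\<lambda>x. frechet_derivative (\<lambda>y. X y $ j) (at x) (Y x))"
    using assms by (auto intro!: smooth_fun_deriv_along smooth_field_inner simp: smooth_field_def)
  have "smooth_fun (\<lambda>x. frechet_derivative (\<lambda>y. Y y $ j) (at x) (X x)
      + (-1) * frechet_derivative (\<lambda>y. X y $ j) (at x) (Y x))"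
    by (intro smooth_fun_add smooth_fun_mult smooth_fun_const 1)
  then show "smooth_fun (\<lambda>x. frechet_derivative (\<lambda>y. Y y $ j) (at x) (X x)
      - frechet_derivative (\<lambda>y. X y $ j) (at x) (Y x))" by simp
qed

lemma frechet_derivative_periodic:
  fixes g :: "real^'d \<Rightarrow> 'b::real_normed_vector"
  assumes "periodic_on_torus g" "int_vec k"
  shows "frechet_derivative g (at (x + k)) = frechet_derivative g (at x)"
proof -
  have 1: "(g has_derivative D) (at (x + k)) \<longleftrightarrow> (g has_derivative D) (at x)" for D
  proof
    assume "(g has_derivative D) (at (x + k))"
    then have "((\<lambda>y. g (y + k)) has_derivative (\<lambda>v. D v)) (at x)"
      by (intro has_derivative_compose[where f = "\<lambda>y. y + k" and g = g]) (auto intro!: derivative_eq_intros)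
    then show "(g has_derivative D) (at x)"
      using assms by (simp add: periodic_on_torus_def)
  next
    assume "(g has_derivative D) (at x)"
    then have "((\<lambda>y. g (y - k)) has_derivative (\<lambda>v. D v)) (at (x + k))"
      by (intro has_derivative_compose[where f = "\<lambda>y. y - k" and g = g]) (auto intro!: derivative_eq_intros)
    moreover have "g (y - k) = g y" for y
      using assms unfolding periodic_on_torus_def by (metis diff_add_cancel)
    ultimately show "(g has_derivative D) (at (x + k))" by simp
  qed
  then show ?thesis by (simp add: frechet_derivative_def)
qed

lemma periodic_lie_bracket:
  assumes "periodic_on_torus X" "periodic_on_torus Y"
  shows "periodic_on_torus (lie_bracket X Y)"
  unfolding periodic_on_torus_def lie_bracket_def
  using assms[unfolded periodic_on_torus_def] frechet_derivative_periodic[OF assms(1)]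
    frechet_derivative_periodic[OF assms(2)] by metis

definition tame_field :: "(real^'d \<Rightarrow> real^'d) \<Rightarrow> bool" where
  "tame_field X \<longleftrightarrow> smooth_field X \<and> periodic_on_torus X"

lemma tame_field_lie_gen:
  assumes "\<And>i. tame_field (f i)" "X \<in> lie_gen f"
  shows "tame_field X"
  using assms(2)
  by induction (use assms(1) in \<open>auto simp: tame_field_def smooth_field_lie_bracket periodic_lie_bracket\<close>)

lemma unit_cell_representative:
  fixes x :: "real^'d"
  obtains k where "int_vec k" "x + k \<in> cbox 0 1"
proof -
  let ?k = "(\<chi> i. - of_int \<lfloor>x $ i\<rfloor>) :: real^'d"
  have "int_vec ?k" by (simp add: int_vec_def)
  moreover have "x + ?k \<in> cbox 0 1"
    by (auto simp: mem_box_cart) linarith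
  ultimately show ?thesis using that by blast
qed

lemma periodic_continuous_bounded:
  fixes g :: "real^'d \<Rightarrow> 'b::real_normed_vector"
  assumes "periodic_on_torus g" "continuous_on UNIV g"
  shows "bounded (range g)"
proof -
  have "compact (g ` cbox 0 1)"
    using assms(2) by (intro compact_continuous_image) (auto intro: continuous_on_subset)
  moreover have "g x \<in> g ` cbox 0 1" for x
  proof -
    obtain k where "int_vec k" "x + k \<in> cbox 0 1" by (rule unit_cell_representative)
    then show ?thesis using assms(1) unfolding periodic_on_torus_def by (metis imageI)
  qed
  then have "range g \<subseteq> g ` cbox 0 1" by blast
  with calculation show ?thesis using bounded_subset compact_imp_bounded by blast
qed

text \<open>Schwarz's theorem. The second difference of g over the square with sides
  \<open>h *\<^sub>R b\<close> and \<open>h *\<^sub>R c\<close> is symmetric in b and c; two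
  applications of the mean value theorem equate it with \<open>h * h\<close> times either mixed
  derivative, taken at a point within \<open>2 * h\<close> of x. Continuity of both then gives
  equality at x.\<close>

lemma frechet_derivative_commute:
  fixes g :: "'a::euclidean_space \<Rightarrow> real"
  assumes g: "smooth_fun g" and b: "b \<in> Basis" and c: "c \<in> Basis"
  shows "frechet_derivative (\<lambda>y. frechet_derivative g (at y) b) (at x) c
    = frechet_derivative (\<lambda>y. frechet_derivative g (at y) c) (at x) b"
proof -
  define gb where "gb = (\<lambda>y. frechet_derivative g (at y) b)"
  define gc where "gc = (\<lambda>y. frechet_derivative g (at y) c)"
  define gbc where "gbc = (\<lambda>y. frechet_derivative gb (at y) c)"
  define gcb where "gcb = (\<lambda>y. frechet_derivative gc (at y) b)"
  have sm: "smooth_fun gb" "smooth_fun gc" "smooth_fun gbc" "smooth_fun gcb"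
    unfolding gb_def gc_def gbc_def gcb_def using g b c by (auto intro!: smooth_fun_partial)
  have line: "((\<lambda>s. q (y + s *\<^sub>R w)) has_real_derivative frechet_derivative q (at (y + s *\<^sub>R w)) w) (at s)"
    if "smooth_fun q" for q :: "'a \<Rightarrow> real" and y w s
  proof -
    have "(q has_derivative frechet_derivative q (at (y + s *\<^sub>R w))) (at (y + s *\<^sub>R w))"
      using smooth_fun_differentiable[OF that] frechet_derivative_works by blast
    then have "((\<lambda>s. q (y + s *\<^sub>R w)) has_derivative
        (\<lambda>r. frechet_derivative q (at (y + s *\<^sub>R w)) (r *\<^sub>R w))) (at s)"
      by (intro has_derivative_compose[where f = "\<lambda>s. y + s *\<^sub>R w" and g = q]) (auto intro!: derivative_eq_intros)
    moreover have "frechet_derivative q (at (y + s *\<^sub>R w)) (r *\<^sub>R w)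
        = frechet_derivative q (at (y + s *\<^sub>R w)) w * r" for r
      using linear_frechet_derivative[OF smooth_fun_differentiable[OF that]]
      by (simp add: linear_cmul)
    ultimately show ?thesis by (simp add: has_field_derivative_def)
  qed
  have key: "\<exists>s t. 0 < s \<and> s < h \<and> 0 < t \<and> t < h \<and>
      g (x + h *\<^sub>R b + h *\<^sub>R c) - g (x + h *\<^sub>R b) - g (x + h *\<^sub>R c) + g x
        = h * (h * frechet_derivative (\<lambda>y. frechet_derivative g (at y) b) (at (x + s *\<^sub>R b + t *\<^sub>R c)) c)"
    if h: "h > 0" and b: "b \<in> Basis" for h b and c :: 'a
  proof -
    define gb where "gb = (\<lambda>y. frechet_derivative g (at y) b)"
    have smb: "smooth_fun gb" unfolding gb_def using g b by (rule smooth_fun_partial)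
    let ?u = "\<lambda>s. g ((x + h *\<^sub>R c) + s *\<^sub>R b) - g (x + s *\<^sub>R b)"
    have "\<exists>z. 0 < z \<and> z < h \<and> ?u h - ?u 0 = (h - 0) *
        (gb ((x + h *\<^sub>R c) + z *\<^sub>R b) - gb (x + z *\<^sub>R b))"
      unfolding gb_def by (rule MVT2) (use h in \<open>auto intro!: DERIV_diff line g\<close>)
    then obtain s where s: "0 < s" "s < h" "?u h - ?u 0 = h *
        (gb ((x + h *\<^sub>R c) + s *\<^sub>R b) - gb (x + s *\<^sub>R b))" by auto
    let ?w = "\<lambda>t. gb ((x + s *\<^sub>R b) + t *\<^sub>R c)"
    have "\<exists>z. 0 < z \<and> z < h \<and> ?w h - ?w 0 = (h - 0) * frechet_derivative gb (at ((x + s *\<^sub>R b) + z *\<^sub>R c)) c"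
      by (rule MVT2) (use h smb in \<open>auto intro!: line\<close>)
    then obtain t where t: "0 < t" "t < h"
      "?w h - ?w 0 = h * frechet_derivative gb (at ((x + s *\<^sub>R b) + t *\<^sub>R c)) c" by auto
    from s t show ?thesis
      by (intro exI[of _ s] exI[of _ t]) (simp add: gb_def algebra_simps)
  qed
  have small: "norm ((x + s *\<^sub>R p + t *\<^sub>R q) - x) \<le> 2 * h"
    if "0 < s" "s < h" "0 < t" "t < h" "p \<in> Basis" "q \<in> Basis" for s t h :: real and p q
  proof -
    have "norm (s *\<^sub>R p + t *\<^sub>R q) \<le> norm (s *\<^sub>R p) + norm (t *\<^sub>R q)" by (rule norm_triangle_ineq)
    also have "\<dots> \<le> 2 * h" using that by simp
    finally show ?thesis by (simp add: algebra_simps)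
  qed
  have "\<bar>gbc x - gcb x\<bar> \<le> 2 * e" if e: "e > 0" for e
  proof -
    have "isCont gbc x" "isCont gcb x"
      using smooth_fun_continuous[OF sm(3), of UNIV] smooth_fun_continuous[OF sm(4), of UNIV]
      by (auto simp: continuous_on_eq_continuous_at)
    then obtain d1 d2 where d: "d1 > 0" "\<And>y. dist y x < d1 \<Longrightarrow> dist (gbc y) (gbc x) < e"
      "d2 > 0" "\<And>y. dist y x < d2 \<Longrightarrow> dist (gcb y) (gcb x) < e"
      unfolding continuous_at_eps_delta using e by metis
    define h where "h = min d1 d2 / 4"
    have h: "h > 0" using d by (simp add: h_def)
    obtain s t where st: "0 < s" "s < h" "0 < t" "t < h" and
      1: "g (x + h *\<^sub>R b + h *\<^sub>R c) - g (x + h *\<^sub>R b) - g (x + h *\<^sub>R c) + g x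
        = h * (h * gbc (x + s *\<^sub>R b + t *\<^sub>R c))"
      using key[OF h b, of c] unfolding gbc_def gb_def by blast
    obtain s' t' where st': "0 < s'" "s' < h" "0 < t'" "t' < h" and
      2: "g (x + h *\<^sub>R c + h *\<^sub>R b) - g (x + h *\<^sub>R c) - g (x + h *\<^sub>R b) + g x
        = h * (h * gcb (x + s' *\<^sub>R c + t' *\<^sub>R b))"
      using key[OF h c, of b] unfolding gcb_def gc_def by blast
    have "h * (h * gbc (x + s *\<^sub>R b + t *\<^sub>R c)) = h * (h * gcb (x + s' *\<^sub>R c + t' *\<^sub>R b))"
      unfolding 1[symmetric] 2[symmetric] by (simp add: algebra_simps)
    then have 3: "gbc (x + s *\<^sub>R b + t *\<^sub>R c) = gcb (x + s' *\<^sub>R c + t' *\<^sub>R b)" using h by simp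
    have "dist (gbc (x + s *\<^sub>R b + t *\<^sub>R c)) (gbc x) < e"
      by (rule d(2)) (use small[OF st b c] h in \<open>auto simp: dist_norm h_def\<close>)
    moreover have "dist (gcb (x + s' *\<^sub>R c + t' *\<^sub>R b)) (gcb x) < e"
      by (rule d(4)) (use small[OF st' c b] h in \<open>auto simp: dist_norm h_def\<close>)
    ultimately show ?thesis using 3 by (auto simp: dist_real_def)
  qed
  from this[of "\<bar>gbc x - gcb x\<bar> / 4"] have "gbc x = gcb x" by (cases "gbc x = gcb x") auto
  then show ?thesis by (simp add: gbc_def gcb_def gb_def gc_def)
qed

subsection \<open>The algebra of differential operators\<close>

text \<open>Only the derivatives are required to be periodic, so that the coordinate functions are included.\<close>
typedef (overloaded) 'd sfun = "{g :: real^'d \<Rightarrow> real. smooth_fun g \<and>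
    (\<forall>v. periodic_on_torus (\<lambda>x. frechet_derivative g (at x) v))}"
  morphisms ev Sfun
  by (rule exI[of _ "\<lambda>x. 0"]) (simp add: smooth_fun_const periodic_on_torus_def)

setup_lifting type_definition_sfun

instantiation sfun :: (finite) real_vector
begin

lift_definition zero_sfun :: "'a sfun" is "\<lambda>x. 0"
  by (simp add: smooth_fun_const periodic_on_torus_def)

lift_definition plus_sfun :: "'a sfun \<Rightarrow> 'a sfun \<Rightarrow> 'a sfun" is "\<lambda>g h x. g x + h x"
  by (auto simp: smooth_fun_add periodic_on_torus_def frechet_derivative_plus_real smooth_fun_differentiable)

lift_definition scaleR_sfun :: "real \<Rightarrow> 'a sfun \<Rightarrow> 'a sfun" is "\<lambda>c g x. c * g x"
  by (auto intro!: smooth_fun_mult smooth_fun_const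
      simp: periodic_on_torus_def frechet_derivative_times_real smooth_fun_differentiable)

definition "uminus_sfun (g :: 'a sfun) = (- 1) *\<^sub>R g"
definition "minus_sfun (g :: 'a sfun) h = g + (- 1) *\<^sub>R h"

instance
  by standard
    ((simp only: uminus_sfun_def minus_sfun_def)?, transfer, simp add: fun_eq_iff algebra_simps)+

end

lemma ev_simps [simp]:
  "ev 0 x = 0" "ev (g + h) x = ev g x + ev h x" "ev (c *\<^sub>R g) x = c * ev g x"
  "ev (- g) x = - ev g x" "ev (g - h) x = ev g x - ev h x"
  unfolding uminus_sfun_def minus_sfun_def by (transfer; simp)+

lemma sfun_eqI: "(\<And>x. ev g x = ev h x) \<Longrightarrow> g = h"
  by (simp add: ev_inject[symmetric] fun_eq_iff)

lemma smooth_ev: "smooth_fun (ev g)"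
  and periodic_deriv_ev: "periodic_on_torus (\<lambda>x. frechet_derivative (ev g) (at x) v)"
  using ev[of g] by auto

text \<open>A type of its own makes the linear operators a noncommutative ring with 1, so that
  \<open>fps\<close> can be used with operators as coefficients.\<close>

typedef (overloaded) 'd endo = "{A :: ('d::finite) sfun \<Rightarrow> 'd sfun. linear A}"
  morphisms app Endo
  by (rule exI[of _ id]) (simp add: linear_id)

setup_lifting type_definition_endo

instantiation endo :: (finite) real_algebra_1
begin

lift_definition zero_endo :: "'a endo" is "\<lambda>g. 0" by (rule linear_zero)
lift_definition one_endo :: "'a endo" is "\<lambda>g. g" by (rule linear_ident)
lift_definition plus_endo :: "'a endo \<Rightarrow> 'a endo \<Rightarrow> 'a endo" is "\<lambda>A B g. A g + B g"
  by (rule linear_compose_add)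
lift_definition minus_endo :: "'a endo \<Rightarrow> 'a endo \<Rightarrow> 'a endo" is "\<lambda>A B g. A g - B g"
  by (rule linear_compose_sub)
lift_definition uminus_endo :: "'a endo \<Rightarrow> 'a endo" is "\<lambda>A g. - A g"
  by (rule linear_compose_neg)
lift_definition scaleR_endo :: "real \<Rightarrow> 'a endo \<Rightarrow> 'a endo" is "\<lambda>c A g. c *\<^sub>R A g"
  by (rule linear_compose_scale_right)
lift_definition times_endo :: "'a endo \<Rightarrow> 'a endo \<Rightarrow> 'a endo" is "\<lambda>A B g. A (B g)"
  using linear_compose unfolding comp_def by blast

instance
proof
  have "app (0 :: 'a endo) (Sfun (\<lambda>x. 1)) \<noteq> app 1 (Sfun (\<lambda>x. 1))"
  proof
    assume "app (0 :: 'a endo) (Sfun (\<lambda>x. 1)) = app 1 (Sfun (\<lambda>x. 1))"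
    then have "ev (Sfun (\<lambda>x. 1) :: 'a sfun) 0 = 0"
      by (metis ev_simps(1) one_endo.rep_eq zero_endo.rep_eq)
    then show False
      by (subst (asm) Sfun_inverse) (auto simp: smooth_fun_const periodic_on_torus_def)
  qed
  then show "(0 :: 'a endo) \<noteq> 1" by metis
qed (transfer; simp add: fun_eq_iff linear_add linear_diff linear_cmul scaleR_add_right scaleR_add_left)+

end

lemma endo_eqI: "(\<And>g x. ev (app A g) x = ev (app B g) x) \<Longrightarrow> A = B"
  by (metis app_inject ext sfun_eqI)

lemma app_simps [simp]:
  "app 0 g = 0" "app 1 g = g" "app (A + B) g = app A g + app B g" "app (A - B) g = app A g - app B g"
  "app (- A) g = - app A g" "app (c *\<^sub>R A) g = c *\<^sub>R app A g" "app (A * B) g = app A (app B g)"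
  by (transfer; simp)+

lemma app_sum: "app (\<Sum>i\<in>I. A i) g = (\<Sum>i\<in>I. app (A i) g)"
  by (induction I rule: infinite_finite_induct) auto

lemma ev_sum: "ev (\<Sum>i\<in>I. g i) x = (\<Sum>i\<in>I. ev (g i) x)"
  by (induction I rule: infinite_finite_induct) auto

text \<open>The field as a derivation. \<open>Sfun\<close> and \<open>Endo\<close> are meaningful
  only on their carriers, so facts about this operator require \<open>tame_field X\<close>.\<close>

definition along :: "(real^'d \<Rightarrow> real^'d) \<Rightarrow> 'd::finite endo" where
  "along X = Endo (\<lambda>g. Sfun (\<lambda>x. frechet_derivative (ev g) (at x) (X x)))"

lemma along_sfun:
  assumes "tame_field X"
  shows "smooth_fun (\<lambda>x. frechet_derivative (ev g) (at x) (X x))"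
    "periodic_on_torus (\<lambda>x. frechet_derivative (ev g) (at x) (X x))"
    "periodic_on_torus (\<lambda>x. frechet_derivative (\<lambda>x. frechet_derivative (ev g) (at x) (X x)) (at x) v)"
proof -
  show "smooth_fun (\<lambda>x. frechet_derivative (ev g) (at x) (X x))"
    using assms by (intro smooth_fun_deriv_along smooth_ev) (auto simp: tame_field_def smooth_field_inner)
  show 1: "periodic_on_torus (\<lambda>x. frechet_derivative (ev g) (at x) (X x))"
    using assms periodic_deriv_ev[of g] by (auto simp: tame_field_def periodic_on_torus_def)
  show "periodic_on_torus (\<lambda>x. frechet_derivative (\<lambda>x. frechet_derivative (ev g) (at x) (X x)) (at x) v)"
    using frechet_derivative_periodic[OF 1] by (simp add: periodic_on_torus_def)
qed

lemma ev_along: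
  assumes "tame_field X"
  shows "ev (app (along X) g) x = frechet_derivative (ev g) (at x) (X x)"
proof -
  have 1: "ev (Sfun (\<lambda>x. frechet_derivative (ev g) (at x) (X x))) x = frechet_derivative (ev g) (at x) (X x)"
    for g x
    using along_sfun[OF assms] by (subst Sfun_inverse) auto
  have "linear (\<lambda>g. Sfun (\<lambda>x. frechet_derivative (ev g) (at x) (X x)))"
  proof -
    have eq: "frechet_derivative (ev (g + h)) (at x) (X x) =
        frechet_derivative (ev g) (at x) (X x) + frechet_derivative (ev h) (at x) (X x)"
      "frechet_derivative (ev (c *\<^sub>R g)) (at x) (X x) = c * frechet_derivative (ev g) (at x) (X x)"
      for g h x c
    proof -
      have "ev (g + h) = (\<lambda>x. ev g x + ev h x)" "ev (c *\<^sub>R g) = (\<lambda>x. c * ev g x)" by auto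
      then show "frechet_derivative (ev (g + h)) (at x) (X x) =
          frechet_derivative (ev g) (at x) (X x) + frechet_derivative (ev h) (at x) (X x)"
        "frechet_derivative (ev (c *\<^sub>R g)) (at x) (X x) = c * frechet_derivative (ev g) (at x) (X x)"
        by (simp_all add: frechet_derivative_plus_real frechet_derivative_times_real
            smooth_fun_differentiable smooth_ev)
    qed
    show ?thesis
    proof (intro linearI sfun_eqI)
      fix g h :: "'a sfun" and x c
      show "ev (Sfun (\<lambda>x. frechet_derivative (ev (g + h)) (at x) (X x))) x
        = ev (Sfun (\<lambda>x. frechet_derivative (ev g) (at x) (X x)) + Sfun (\<lambda>x. frechet_derivative (ev h) (at x) (X x))) x"
        unfolding 1 ev_simps by (rule eq[unfolded ev_simps])
      show "ev (Sfun (\<lambda>x. frechet_derivative (ev (c *\<^sub>R g)) (at x) (X x))) x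
        = ev (c *\<^sub>R Sfun (\<lambda>x. frechet_derivative (ev g) (at x) (X x))) x"
        unfolding 1 ev_simps by (rule eq[unfolded ev_simps])
    qed
  qed
  then show ?thesis by (simp add: along_def Endo_inverse 1)
qed

lemma ev_fun_along:
  "tame_field X \<Longrightarrow> ev (app (along X) g) = (\<lambda>x. frechet_derivative (ev g) (at x) (X x))"
  using ev_along by auto

text \<open>One derivative along a periodic field is itself periodic even if g is not, and a
  continuous function on the torus is bounded. This is the source of all remainder bounds that are
  uniform in x.\<close>

lemma bounded_along:
  assumes "tame_field X" shows "bounded (range (ev (app (along X) g)))"
  unfolding ev_fun_along[OF assms]
  using along_sfun[OF assms, of g] by (intro periodic_continuous_bounded smooth_fun_continuous)

definition coord :: "'d \<Rightarrow> 'd::finite sfun" where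
  "coord j = Sfun (\<lambda>x. x $ j)"

lemma has_derivative_nth: "((\<lambda>x::real^'d. x $ j) has_derivative (\<lambda>v. v $ j)) (at x)"
  by (intro bounded_linear_imp_has_derivative bounded_linear_vec_nth)

lemma frechet_derivative_coord: "frechet_derivative (\<lambda>x::real^'d. x $ j) (at x) v = v $ j"
  using frechet_derivative_at[OF has_derivative_nth] by metis

lemma smooth_fun_nth: "smooth_fun (\<lambda>x::real^'d. x $ j)"
  unfolding smooth_fun_def
proof
  fix k show "Ck k (\<lambda>x::real^'d. x $ j)"
    by (cases k) (auto simp: frechet_derivative_coord Ck_const differentiable_def intro!: has_derivative_nth
        continuous_intros)
qed

lemma ev_coord [simp]: "ev (coord j) x = x $ j"
  unfolding coord_def
  by (subst Sfun_inverse) (auto simp: smooth_fun_nth frechet_derivative_coord periodic_on_torus_def)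

lemma along_coord:
  assumes "tame_field X" shows "ev (app (along X) (coord j)) x = X x $ j"
proof -
  have "ev (coord j) = (\<lambda>x. x $ j)" by auto
  then show ?thesis by (simp add: ev_along[OF assms] frechet_derivative_coord)
qed

text \<open>In both products the second-order part is the Hessian of g applied to X and Y; it is
  symmetric and cancels in the difference. The terms in which the coefficients of the fields are
  differentiated remain, and these form the bracket.\<close>

lemma along_bracket:
  fixes X Y :: "real^'d \<Rightarrow> real^'d"
  assumes X: "tame_field X" and Y: "tame_field Y"
  shows "along (lie_bracket X Y) = along X * along Y - along Y * along X"
proof (rule endo_eqI)
  fix g :: "'d sfun" and x :: "real^'d"
  have XY: "tame_field (lie_bracket X Y)"
    using X Y by (simp add: tame_field_def smooth_field_lie_bracket periodic_lie_bracket)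
  let ?g = "\<lambda>b x. frechet_derivative (ev g) (at x) b"
  have expand: "frechet_derivative (\<lambda>x. frechet_derivative (ev g) (at x) (Y x)) (at x) v
    = (\<Sum>b\<in>Basis. (Y x \<bullet> b) * frechet_derivative (?g b) (at x) v
        + frechet_derivative (\<lambda>x. Y x \<bullet> b) (at x) v * ?g b x)"
    if "smooth_field Y" for Y :: "real^'d \<Rightarrow> real^'d" and v
  proof -
    have sm: "smooth_fun (\<lambda>x. Y x \<bullet> b)" "smooth_fun (?g b)" if "b \<in> Basis" for b
      using that \<open>smooth_field Y\<close> by (auto intro!: smooth_field_inner smooth_fun_partial smooth_ev)
    have "((\<lambda>x. \<Sum>b\<in>Basis. (Y x \<bullet> b) * ?g b x) has_derivative
       (\<lambda>v. \<Sum>b\<in>Basis. (Y x \<bullet> b) * frechet_derivative (?g b) (at x) v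
        + frechet_derivative (\<lambda>x. Y x \<bullet> b) (at x) v * ?g b x)) (at x)"
      using sm[THEN smooth_fun_differentiable]
      by (intro has_derivative_sum has_derivative_mult) (auto simp: frechet_derivative_works[symmetric])
    moreover have "(\<lambda>x. frechet_derivative (ev g) (at x) (Y x)) = (\<lambda>x. \<Sum>b\<in>Basis. (Y x \<bullet> b) * ?g b x)"
      by (auto intro!: frechet_derivative_expand smooth_fun_differentiable smooth_ev)
    ultimately show ?thesis
      using frechet_derivative_at by (metis (no_types, lifting))
  qed
  have second: "frechet_derivative (?g b) (at x) v = (\<Sum>c\<in>Basis. (v \<bullet> c) * frechet_derivative (?g b) (at x) c)"
    if "b \<in> Basis" for b v
    using that by (intro frechet_derivative_expand smooth_fun_differentiable smooth_fun_partial smooth_ev)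
  \<comment> \<open>Both sides are expanded into double sums over the basis, and
    \<open>frechet_derivative_commute\<close> exchanges the two indices.\<close>
  have symm: "(\<Sum>b\<in>Basis. (Y x \<bullet> b) * frechet_derivative (?g b) (at x) (X x))
    = (\<Sum>b\<in>Basis. (X x \<bullet> b) * frechet_derivative (?g b) (at x) (Y x))"
  proof -
    have "(\<Sum>b\<in>Basis. (Y x \<bullet> b) * frechet_derivative (?g b) (at x) (X x))
      = (\<Sum>b\<in>Basis. \<Sum>c\<in>Basis. (Y x \<bullet> b) * ((X x \<bullet> c) * frechet_derivative (?g b) (at x) c))"
      by (intro sum.cong refl) (subst second, auto simp: sum_distrib_left)
    also have "\<dots> = (\<Sum>c\<in>Basis. \<Sum>b\<in>Basis. (Y x \<bullet> b) * ((X x \<bullet> c) * frechet_derivative (?g b) (at x) c))"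
      by (rule sum.swap)
    also have "\<dots> = (\<Sum>c\<in>Basis. \<Sum>b\<in>Basis. (X x \<bullet> c) * ((Y x \<bullet> b) * frechet_derivative (?g c) (at x) b))"
      by (intro sum.cong refl) (simp add: frechet_derivative_commute[OF smooth_ev])
    also have "\<dots> = (\<Sum>b\<in>Basis. (X x \<bullet> b) * frechet_derivative (?g b) (at x) (Y x))"
      by (intro sum.cong refl) (subst (2) second, auto simp: sum_distrib_left)
    finally show ?thesis .
  qed
  have inner: "frechet_derivative (\<lambda>x. Z x \<bullet> b) (at x) v = frechet_derivative Z (at x) v \<bullet> b"
    if "smooth_field Z" "b \<in> Basis" for Z :: "real^'d \<Rightarrow> real^'d" and b v
    using that by (auto simp: Basis_vec_def inner_axis frechet_derivative_nth smooth_field_differentiable)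
  have sXY: "smooth_field X" "smooth_field Y" using X Y by (auto simp: tame_field_def)
  have "ev (app (along X * along Y - along Y * along X) g) x
    = frechet_derivative (\<lambda>x. frechet_derivative (ev g) (at x) (Y x)) (at x) (X x)
      - frechet_derivative (\<lambda>x. frechet_derivative (ev g) (at x) (X x)) (at x) (Y x)"
    by (simp add: ev_along[OF X] ev_along[OF Y]
        ev_fun_along[OF X] ev_fun_along[OF Y])
  also have "\<dots> = (\<Sum>b\<in>Basis. (lie_bracket X Y x \<bullet> b) * ?g b x)"
    unfolding expand[OF sXY(1)] expand[OF sXY(2)] sum.distrib using symm
    by (simp add: lie_bracket_def inner sXY algebra_simps sum_subtractf[symmetric])
  also have "\<dots> = ev (app (along (lie_bracket X Y)) g) x"
    unfolding ev_along[OF XY] by (rule frechet_derivative_expand[symmetric])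
      (auto intro: smooth_fun_differentiable smooth_ev)
  finally show "ev (app (along (lie_bracket X Y)) g) x = ev (app (along X * along Y - along Y * along X) g) x"
    by simp
qed

subsection \<open>Expansions along compositions of flows\<close>

text \<open>An asymptotic expansion of the pullback by \<open>P t\<close>, with C depending on g and
  N but on neither t nor x. The order N = 0 is left out: it would ask for g itself to be bounded
  along P, which fails for the coordinate functions.\<close>

definition expands :: "real \<Rightarrow> (real \<Rightarrow> real^'d \<Rightarrow> real^'d) \<Rightarrow> 'd::finite endo fps \<Rightarrow> bool" where
  "expands h P c \<longleftrightarrow> (\<forall>g. \<forall>N\<ge>1. \<exists>C. \<forall>t\<in>{0..h}. \<forall>x.
     \<bar>ev g (P t x) - (\<Sum>n<N. t ^ n * ev (app (fps_nth c n) g) x)\<bar> \<le> C * t ^ N)"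

text \<open>Maps act on functions by pullback, so the map applied first contributes the left factor.\<close>
lemma expands_compose:
  fixes P Q :: "real \<Rightarrow> real^'d \<Rightarrow> real^'d"
  assumes P: "expands h P c" and Q: "expands h Q e"
  shows "expands h (\<lambda>t x. Q t (P t x)) (c * e)"
  unfolding expands_def
proof (intro allI impI)
  fix g :: "'d sfun" and N :: nat assume N: "N \<ge> 1"
  obtain C where C: "\<And>t x. t \<in> {0..h} \<Longrightarrow>
      \<bar>ev g (Q t x) - (\<Sum>n<N. t ^ n * ev (app (fps_nth e n) g) x)\<bar> \<le> C * t ^ N"
    using Q[unfolded expands_def, THEN spec, THEN spec, THEN mp, OF N] by blast
  \<comment> \<open>The j-th term of the expansion of Q already carries \<open>t ^ j\<close>, so its
    coefficient needs to be expanded along P only to order \<open>N - j\<close>, which is at least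
    1.\<close>
  have "\<forall>j. \<exists>B. j < N \<longrightarrow> (\<forall>t\<in>{0..h}. \<forall>x. \<bar>ev (app (fps_nth e j) g) (P t x)
      - (\<Sum>i<N-j. t ^ i * ev (app (fps_nth c i) (app (fps_nth e j) g)) x)\<bar> \<le> B * t ^ (N - j))"
  proof
    fix j
    show "\<exists>B. j < N \<longrightarrow> (\<forall>t\<in>{0..h}. \<forall>x. \<bar>ev (app (fps_nth e j) g) (P t x)
      - (\<Sum>i<N-j. t ^ i * ev (app (fps_nth c i) (app (fps_nth e j) g)) x)\<bar> \<le> B * t ^ (N - j))"
    proof (cases "j < N")
      case True
      then have "1 \<le> N - j" by simp
      from P[unfolded expands_def, THEN spec, THEN spec, THEN mp, OF this] show ?thesis by blast
    qed simp
  qed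
  from choice[OF this] obtain B where "\<forall>j. j < N \<longrightarrow> (\<forall>t\<in>{0..h}. \<forall>x. \<bar>ev (app (fps_nth e j) g) (P t x)
      - (\<Sum>i<N-j. t ^ i * ev (app (fps_nth c i) (app (fps_nth e j) g)) x)\<bar> \<le> B j * t ^ (N - j))" by (elim exE)
  then have B: "\<And>j t x. j < N \<Longrightarrow> t \<in> {0..h} \<Longrightarrow> \<bar>ev (app (fps_nth e j) g) (P t x)
      - (\<Sum>i<N-j. t ^ i * ev (app (fps_nth c i) (app (fps_nth e j) g)) x)\<bar> \<le> B j * t ^ (N - j)"
    by blast
  show "\<exists>C. \<forall>t\<in>{0..h}. \<forall>x. \<bar>ev g (Q t (P t x))
      - (\<Sum>n<N. t ^ n * ev (app (fps_nth (c * e) n) g) x)\<bar> \<le> C * t ^ N"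
  proof (intro exI ballI allI)
    fix t x assume t: "t \<in> {0..h}"
    define f where "f = (\<lambda>i j. t ^ (i + j) * ev (app (fps_nth c i) (app (fps_nth e j) g)) x)"
    have "(\<Sum>n<N. t ^ n * ev (app (fps_nth (c * e) n) g) x) = (\<Sum>n<N. \<Sum>i\<le>n. f i (n - i))"
      by (simp add: f_def fps_mult_nth app_sum ev_sum sum_distrib_left atLeast0AtMost)
    also have "\<dots> = (\<Sum>n<N. \<Sum>j\<le>n. f (n - j) j)"
    proof (rule sum.cong[OF refl])
      fix n
      show "(\<Sum>i\<le>n. f i (n - i)) = (\<Sum>j\<le>n. f (n - j) j)"
        by (rule sum.reindex_bij_witness[of _ "\<lambda>i. n - i" "\<lambda>i. n - i"]) auto
    qed
    also have "\<dots> = (\<Sum>(j,i)\<in>{(j,i). j + i < N}. f i j)"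
      by (subst sum.triangle_reindex) simp
    also have "{(j,i). j + i < N} = (SIGMA j:{..<N}. {..<N-j})" by auto
    also have "(\<Sum>(j,i)\<in>\<dots>. f i j) = (\<Sum>j<N. \<Sum>i<N-j. f i j)"
      by (simp add: sum.Sigma)
    finally have "ev g (Q t (P t x)) - (\<Sum>n<N. t ^ n * ev (app (fps_nth (c * e) n) g) x)
      = (ev g (Q t (P t x)) - (\<Sum>j<N. t ^ j * ev (app (fps_nth e j) g) (P t x)))
        + (\<Sum>j<N. t ^ j * (ev (app (fps_nth e j) g) (P t x)
      - (\<Sum>i<N-j. t ^ i * ev (app (fps_nth c i) (app (fps_nth e j) g)) x)))"
      by (simp add: f_def sum_subtractf right_diff_distrib sum_distrib_left power_add mult_ac)
    also have "\<bar>\<dots>\<bar> \<le> C * t ^ N + (\<Sum>j<N. B j * t ^ N)"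
    proof (intro order_trans[OF abs_triangle_ineq] add_mono C[OF t] order_trans[OF sum_abs] sum_mono)
      fix j assume "j \<in> {..<N}"
      then have j: "j < N" by simp
      have "t ^ j * \<bar>ev (app (fps_nth e j) g) (P t x)
        - (\<Sum>i<N-j. t ^ i * ev (app (fps_nth c i) (app (fps_nth e j) g)) x)\<bar> \<le> t ^ j * (B j * t ^ (N - j))"
        using t by (intro mult_left_mono B j) auto
      also have "\<dots> = B j * t ^ N" using j by (simp add: power_add[symmetric])
      finally show "\<bar>t ^ j * (ev (app (fps_nth e j) g) (P t x)
        - (\<Sum>i<N-j. t ^ i * ev (app (fps_nth c i) (app (fps_nth e j) g)) x))\<bar> \<le> B j * t ^ N"
        using t by (simp add: abs_mult)
    qed
    also have "\<dots> = (C + (\<Sum>j<N. B j)) * t ^ N" by (simp add: sum_distrib_right distrib_right)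
    finally show "\<bar>ev g (Q t (P t x)) - (\<Sum>n<N. t ^ n * ev (app (fps_nth (c * e) n) g) x)\<bar>
      \<le> (C + (\<Sum>j<N. B j)) * t ^ N" .
  qed
qed

section \<open>Exponential series of operators and their leading terms\<close>

definition exp_series :: "'a::real_algebra_1 \<Rightarrow> 'a fps" where
  "exp_series A = Abs_fps (\<lambda>n. A ^ n /\<^sub>R fact n)"

text \<open>Powers of a single A commute, so coefficient n is a multiple of the binomial expansion
  of \<open>(1 + (-1)) ^ n\<close>. Later only the series are multiplied; no statement that the flow
  of the negative field undoes the flow itself is required.\<close>

lemma exp_series_inverse: "exp_series A * exp_series (- A) = 1"
proof (rule fps_ext)
  fix n
  have "fps_nth (exp_series A * exp_series (- A)) n
    = (\<Sum>i\<le>n. ((-1) ^ (n - i) / (fact i * fact (n - i))) *\<^sub>R A ^ n)"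
    unfolding exp_series_def fps_mult_nth atLeast0AtMost
  proof (intro sum.cong refl)
    fix i assume "i \<in> {..n}"
    then have "A ^ i * A ^ (n - i) = A ^ n" by (simp add: power_add[symmetric])
    moreover have "(- A) ^ (n - i) = ((-1) ^ (n - i)) *\<^sub>R A ^ (n - i)"
      by (metis power_minus scaleR_conv_of_real of_real_1 of_real_minus of_real_power)
    ultimately show "fps_nth (Abs_fps (\<lambda>n. A ^ n /\<^sub>R fact n)) i * fps_nth (Abs_fps (\<lambda>n. (- A) ^ n /\<^sub>R fact n)) (n - i)
      = ((-1) ^ (n - i) / (fact i * fact (n - i))) *\<^sub>R A ^ n"
      by (simp add: field_simps)
  qed
  also have "\<dots> = (\<Sum>i\<le>n. (-1) ^ (n - i) / (fact i * fact (n - i))) *\<^sub>R A ^ n"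
    by (simp add: scaleR_left.sum)
  also have "(\<Sum>i\<le>n. (-1) ^ (n - i) / (fact i * fact (n - i)) :: real) = (\<Sum>i\<le>n. of_nat (n choose i) * 1 ^ i * (-1) ^ (n - i)) / fact n"
    unfolding sum_divide_distrib by (intro sum.cong refl) (simp add: binomial_fact)
  also have "(\<Sum>i\<le>n. of_nat (n choose i) * 1 ^ i * (-1) ^ (n - i)) = (0::real) ^ n"
    by (subst binomial_ring[symmetric]) simp
  finally show "fps_nth (exp_series A * exp_series (- A)) n = fps_nth 1 n"
    by (cases n) auto
qed

text \<open>Taylor's formula by induction on the order: the time derivative of the remainder for g
  is the remainder of one order less for \<open>app (along X) g\<close>. The start is the mean value
  estimate with the bound of \<open>bounded_along\<close>.\<close>

lemma expands_flow:
  fixes P :: "real \<Rightarrow> real^'d \<Rightarrow> real^'d"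
  assumes X: "tame_field X" and P0: "\<And>x. P 0 x = x"
    and P: "\<And>x s. s \<in> {0..h} \<Longrightarrow> ((\<lambda>t. P t x) has_vector_derivative X (P s x)) (at s within {0..h})"
  shows "expands h P (exp_series (along X))"
proof -
  have deriv: "((\<lambda>t. ev g (P t x)) has_real_derivative ev (app (along X) g) (P s x)) (at s within {0..h})"
    if "s \<in> {0..h}" for g x s
  proof -
    have "(ev g has_derivative frechet_derivative (ev g) (at (P s x))) (at (P s x))"
      using smooth_fun_differentiable[OF smooth_ev] frechet_derivative_works by blast
    then have "((ev g \<circ> (\<lambda>t. P t x)) has_vector_derivative frechet_derivative (ev g) (at (P s x)) (X (P s x)))
      (at s within {0..h})"
      using vector_derivative_diff_chain_within[OF P[OF that]] has_derivative_at_withinI by blast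
    then show ?thesis
      by (simp add: comp_def ev_along[OF X] has_real_derivative_iff_has_vector_derivative)
  qed
  have main: "\<exists>C. \<forall>t\<in>{0..h}. \<forall>x. \<bar>ev g (P t x) - (\<Sum>n<Suc N. t ^ n / fact n * ev (app (along X ^ n) g) x)\<bar> \<le> C * t ^ Suc N"
    for g N
  proof (induction N arbitrary: g)
    case 0
    obtain C where C: "\<And>x. \<bar>ev (app (along X) g) x\<bar> \<le> C"
      using bounded_along[OF X, of g] unfolding bounded_iff by auto
    show ?case
    proof (intro exI[of _ C] ballI allI)
      fix t x assume t: "t \<in> {0..h}"
      have "norm (ev g (P t x) - ev g (P 0 x)) \<le> C * norm (t - 0)"
        by (rule field_differentiable_bound[of "{0..h}" "\<lambda>t. ev g (P t x)" "\<lambda>s. ev (app (along X) g) (P s x)"])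
          (use t deriv C in auto)
      then show "\<bar>ev g (P t x) - (\<Sum>n<Suc 0. t ^ n / fact n * ev (app (along X ^ n) g) x)\<bar> \<le> C * t ^ Suc 0"
        using t P0 by simp
    qed
  next
    case (Suc N)
    obtain C where C: "\<And>t x. t \<in> {0..h} \<Longrightarrow> \<bar>ev (app (along X) g) (P t x)
        - (\<Sum>n<Suc N. t ^ n / fact n * ev (app (along X ^ n) (app (along X) g)) x)\<bar> \<le> C * t ^ Suc N"
      using Suc.IH[of "app (along X) g"] by blast
    show ?case
    proof (intro exI[of _ C] ballI allI)
      fix t x assume t: "t \<in> {0..h}"
      define a where "a = (\<lambda>n. ev (app (along X ^ n) g) x)"
      have a: "ev (app (along X ^ n) (app (along X) g)) x = a (Suc n)" for n
        by (simp add: a_def power_commutes flip: app_simps(7))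
      \<comment> \<open>\<open>?u\<close> vanishes at time 0, and its derivative \<open>?u'\<close>
        is controlled by the induction hypothesis; the mean value estimate on \<open>{0..t}\<close>
        gains the missing factor t.\<close>
      let ?u = "\<lambda>t. ev g (P t x) - (\<Sum>n<Suc (Suc N). t ^ n / fact n * a n)"
      let ?u' = "\<lambda>s. ev (app (along X) g) (P s x) - (\<Sum>n<Suc N. s ^ n / fact n * a (Suc n))"
      have poly: "((\<lambda>t. \<Sum>n<Suc M. t ^ n / fact n * a n) has_real_derivative (\<Sum>n<M. s ^ n / fact n * a (Suc n))) F"
        if "F = at s within S" for s M F S
        unfolding that
      proof (induction M)
        case (Suc M)
        have "((\<lambda>t. t ^ Suc M / fact (Suc M) * a (Suc M)) has_real_derivative s ^ M / fact M * a (Suc M)) (at s within S)"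
        proof -
          have "real (Suc M) * s ^ (Suc M - Suc 0) * (a (Suc M) / fact (Suc M)) = s ^ M / fact M * a (Suc M)"
            by (simp add: divide_simps del: of_nat_Suc)
          moreover have "((\<lambda>t. t ^ Suc M * (a (Suc M) / fact (Suc M))) has_real_derivative
              real (Suc M) * s ^ (Suc M - Suc 0) * (a (Suc M) / fact (Suc M))) (at s within S)"
            by (intro DERIV_cmult_right DERIV_pow)
          ultimately show ?thesis by simp
        qed
        from DERIV_add[OF Suc this] show ?case by simp
      qed simp
      have 0: "?u 0 = 0"
        by (simp add: sum.lessThan_Suc_shift P0 a_def power_0_left del: sum.lessThan_Suc)
      \<comment> \<open>The induction hypothesis says nothing about the sign of C; it is recovered
        from the bound at t, since \<open>C * t ^ Suc N\<close> dominates an absolute value.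
        Monotonicity in s needs it.\<close>
      have "C * t ^ Suc N \<ge> 0" using C[OF t] by (meson abs_ge_zero order_trans)
      have "norm (?u t - ?u 0) \<le> (C * t ^ Suc N) * norm (t - 0)"
      proof (rule field_differentiable_bound[of "{0..t}" ?u ?u'])
        fix s assume s: "s \<in> {0..t}"
        then have sh: "s \<in> {0..h}" using t by auto
        show "(?u has_real_derivative ?u' s) (at s within {0..t})"
          by (intro DERIV_diff poly[OF refl] DERIV_subset[OF deriv[OF sh]]) (use t in auto)
        have "\<bar>?u' s\<bar> \<le> C * s ^ Suc N" using C[OF sh, of x] unfolding a .
        also have "\<dots> \<le> C * t ^ Suc N"
        proof (cases "t = 0")
          case False
          then have "t ^ Suc N > 0" using t by simp
          then have "C \<ge> 0" using \<open>C * t ^ Suc N \<ge> 0\<close> by (simp add: zero_le_mult_iff del: power_Suc)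
          then show ?thesis using s by (intro mult_left_mono power_mono) auto
        qed (use s in auto)
        finally show "norm (?u' s) \<le> C * t ^ Suc N" by simp
      qed (use t in auto)
      then show "\<bar>ev g (P t x) - (\<Sum>n<Suc (Suc N). t ^ n / fact n * ev (app (along X ^ n) g) x)\<bar> \<le> C * t ^ Suc (Suc N)"
        unfolding 0 using t by (simp add: a_def mult_ac)
    qed
  qed
  show ?thesis
    unfolding expands_def
  proof (intro allI impI)
    fix g :: "'d sfun" and N :: nat assume "N \<ge> 1"
    then obtain M where "N = Suc M" by (cases N) auto
    then show "\<exists>C. \<forall>t\<in>{0..h}. \<forall>x. \<bar>ev g (P t x)
      - (\<Sum>n<N. t ^ n * ev (app (fps_nth (exp_series (along X)) n) g) x)\<bar> \<le> C * t ^ N"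
      using main[of g M] by (simp add: exp_series_def divide_inverse mult_ac del: sum.lessThan_Suc)
  qed
qed

text \<open>For k at least 1 this says that c is 1 plus A times the k-th power of the variable plus
  terms of higher order.\<close>

definition leads :: "nat \<Rightarrow> 'a::ring_1 fps \<Rightarrow> 'a \<Rightarrow> bool" where
  "leads k c A \<longleftrightarrow> fps_nth c 0 = 1 \<and> (\<forall>n. 0 < n \<and> n < k \<longrightarrow> fps_nth c n = 0) \<and> fps_nth c k = A"

lemma leads_exp_series: "leads 1 (exp_series A) A"
  by (auto simp: leads_def exp_series_def)

lemma fps_mult_low_order:
  fixes p q :: "'a::ring_1 fps"
  assumes "\<And>n. n < k \<Longrightarrow> fps_nth p n = 0" "\<And>n. n < l \<Longrightarrow> fps_nth q n = 0" "n \<le> k + l"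
  shows "fps_nth (p * q) n = (if n = k + l then fps_nth p k * fps_nth q l else 0)"
proof -
  have "fps_nth p i * fps_nth q (n - i) = (if i = k \<and> n = k + l then fps_nth p k * fps_nth q l else 0)"
    if "i \<le> n" for i
  proof (cases "i < k \<or> n - i < l")
    case False
    then have "i = k" "n = k + l" using that assms(3) by auto
    then show ?thesis by simp
  qed (use assms in auto)
  then have "fps_nth (p * q) n = (\<Sum>i=0..n. if i = k \<and> n = k + l then fps_nth p k * fps_nth q l else 0)"
    unfolding fps_mult_nth by (intro sum.cong) auto
  also have "\<dots> = (if n = k + l then fps_nth p k * fps_nth q l else 0)" by auto
  finally show ?thesis .
qed

lemma leads_commutator:
  fixes c e c' e' :: "'a::ring_1 fps"
  assumes c: "leads k c A" "k \<ge> 1" and e: "leads l e B" "l \<ge> 1"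
    and inv: "c * c' = 1" "e * e' = 1" and c': "fps_nth c' 0 = 1" and e': "fps_nth e' 0 = 1"
  shows "leads (k + l) (c * e * c' * e') (A * B - B * A)"
proof -
  \<comment> \<open>\<open>c e c' e' = 1 + (c e - e c) c' e'\<close>, and \<open>c e - e c = (c - 1) (e - 1) - (e - 1) (c - 1)\<close>\<close>
  define d where "d = (c - 1) * (e - 1) - (e - 1) * (c - 1)"
  have low: "n < k \<Longrightarrow> fps_nth (c - 1) n = 0" "n < l \<Longrightarrow> fps_nth (e - 1) n = 0" for n
    using c e by (cases n; auto simp: leads_def)+
  have d: "fps_nth d n = (if n = k + l then A * B - B * A else 0)" if "n \<le> k + l" for n
    using fps_mult_low_order[of k "c - 1" l "e - 1" n, OF low]
      fps_mult_low_order[of l "e - 1" k "c - 1" n, OF low(2,1)] that c e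
    by (auto simp: d_def leads_def add.commute)
  \<comment> \<open>The factor \<open>c' * e'\<close> has constant coefficient 1, so it changes
    neither the order of d nor its leading coefficient.\<close>
  have "fps_nth (d * (c' * e')) n = (if n = (k + l) + 0 then fps_nth d (k + l) * fps_nth (c' * e') 0 else 0)"
    if "n \<le> k + l" for n
    using that by (intro fps_mult_low_order) (auto simp: d)
  then have dc: "fps_nth (d * (c' * e')) n = (if n = k + l then A * B - B * A else 0)" if "n \<le> k + l" for n
    using that by (auto simp: d c' e')
  \<comment> \<open>This turns \<open>c * e * c' * e' - 1\<close> into
    \<open>(c * e - e * c) * (c' * e')\<close>, where subtracting 1 from both factors of the
    commutator makes no difference.\<close>
  have "e * c * c' * e' = 1" by (metis inv mult.assoc mult_1_left mult_1_right)
  then have "c * e * c' * e' = 1 + d * (c' * e')"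
    by (simp add: d_def algebra_simps)
  then have "fps_nth (c * e * c' * e') n = fps_nth 1 n + fps_nth (d * (c' * e')) n" for n
    by (metis fps_add_nth)
  then show ?thesis using c(2) e(2) c' e' by (auto simp: leads_def dc simp del: fps_mult_nth_0)
qed

subsection \<open>Flows of periodic fields\<close>

lemma tame_field_Lipschitz:
  fixes X :: "real^'d \<Rightarrow> real^'d"
  assumes "tame_field X"
  obtains \<Lambda> where "\<Lambda> > 0" "\<And>x y. norm (X x - X y) \<le> \<Lambda> * norm (x - y)"
proof -
  have comp: "\<exists>C. \<forall>x y. \<bar>X x $ j - X y $ j\<bar> \<le> C * norm (x - y)" for j
  proof -
    let ?g = "\<lambda>x. X x $ j"
    have sm: "smooth_fun ?g" and per: "periodic_on_torus ?g"
      using assms by (auto simp: tame_field_def smooth_field_def periodic_on_torus_def)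
    have "bounded (range (\<lambda>x. frechet_derivative ?g (at x) b))" if "b \<in> Basis" for b
      using that sm frechet_derivative_periodic[OF per]
      by (intro periodic_continuous_bounded smooth_fun_continuous smooth_fun_partial)
        (auto simp: periodic_on_torus_def)
    then have "\<exists>B. \<forall>x. \<bar>frechet_derivative ?g (at x) b\<bar> \<le> B" if "b \<in> Basis" for b
      using that unfolding bounded_iff by force
    then obtain B where B: "\<And>b x. b \<in> Basis \<Longrightarrow> \<bar>frechet_derivative ?g (at x) b\<bar> \<le> B b"
      by metis
    have on: "onorm (frechet_derivative ?g (at x)) \<le> (\<Sum>b\<in>Basis. B b)" for x
    proof (rule onorm_bound)
      show "0 \<le> (\<Sum>b\<in>Basis. B b)" by (meson B abs_ge_zero order_trans sum_nonneg)
      fix v :: "real^'d"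
      have "\<bar>frechet_derivative ?g (at x) v\<bar> = \<bar>\<Sum>b\<in>Basis. (v \<bullet> b) * frechet_derivative ?g (at x) b\<bar>"
        by (subst frechet_derivative_expand) (auto intro: smooth_fun_differentiable sm)
      also have "\<dots> \<le> (\<Sum>b\<in>Basis. norm v * B b)"
        by (intro order_trans[OF sum_abs] sum_mono) (auto simp: abs_mult intro!: mult_mono B Basis_le_norm)
      finally show "norm (frechet_derivative ?g (at x) v) \<le> (\<Sum>b\<in>Basis. B b) * norm v"
        by (simp add: sum_distrib_left mult.commute)
    qed
    have "norm (?g x - ?g y) \<le> (\<Sum>b\<in>Basis. B b) * norm (x - y)" for x y
      using on by (intro differentiable_bound[of UNIV ?g "\<lambda>x. frechet_derivative ?g (at x)"])
        (auto simp: frechet_derivative_works[symmetric] smooth_fun_differentiable[OF sm])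
    then show ?thesis by auto
  qed
  then obtain C where C: "\<And>j x y. \<bar>X x $ j - X y $ j\<bar> \<le> C j * norm (x - y)" by metis
  show ?thesis
  proof
    show "1 + (\<Sum>j\<in>UNIV. \<bar>C j\<bar>) > 0" by (simp add: add_pos_nonneg sum_nonneg)
    fix x y :: "real^'d"
    have "norm (X x - X y) \<le> (\<Sum>j\<in>UNIV. \<bar>(X x - X y) $ j\<bar>)" by (rule norm_le_l1_cart)
    also have "\<dots> \<le> (\<Sum>j\<in>UNIV. \<bar>C j\<bar> * norm (x - y))"
      using C by (intro sum_mono) (smt (verit) mult_right_mono norm_ge_zero vector_minus_component)
    also have "\<dots> \<le> (1 + (\<Sum>j\<in>UNIV. \<bar>C j\<bar>)) * norm (x - y)"
      by (simp add: sum_distrib_right distrib_right)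
    finally show "norm (X x - X y) \<le> (1 + (\<Sum>j\<in>UNIV. \<bar>C j\<bar>)) * norm (x - y)" .
  qed
qed

lemma tame_field_continuous: "tame_field X \<Longrightarrow> continuous_on S X"
  unfolding tame_field_def
  by (meson smooth_field_differentiable differentiable_imp_continuous_within continuous_at_imp_continuous_on)

lemma tame_field_bounded: "tame_field X \<Longrightarrow> bounded (range X)"
  using periodic_continuous_bounded tame_field_continuous tame_field_def by blast

text \<open>Picard iteration. A bounded field with a global Lipschitz constant allows the same time
  h for every initial point, so one contraction argument yields the whole flow and its joint
  continuity.\<close>

lemma Lipschitz_flow_exists:
  fixes X :: "'a::euclidean_space \<Rightarrow> 'a"
  assumes Lip: "\<And>x y. norm (X x - X y) \<le> \<Lambda> * norm (x - y)" and \<Lambda>: "\<Lambda> \<ge> 0"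
    and bdd: "bounded (range X)" and h: "0 < h" "h * \<Lambda> \<le> 1/2"
  shows "\<exists>P. (\<forall>x. P 0 x = x) \<and> continuous_on UNIV (\<lambda>(t,x). P t x) \<and>
    (\<forall>x. \<forall>s\<in>{0..h}. ((\<lambda>t. P t x) has_vector_derivative X (P s x)) (at s within {0..h}))"
proof -
  obtain M where M: "M > 0" "\<And>x. norm (X x) \<le> M" using bdd unfolding bounded_pos by auto
  have X: "continuous_on S X" for S
  proof -
    have "\<Lambda>-lipschitz_on UNIV X"
      using Lip \<Lambda> by (intro lipschitz_onI) (auto simp: dist_norm)
    then show ?thesis using lipschitz_on_continuous_on continuous_on_subset by blast
  qed
  \<comment> \<open>The complete space at hand consists of bounded continuous functions on the whole
    line; clamping time to \<open>{0..h}\<close> extends the Picard integral to it.\<close>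
  define cl where "cl = (\<lambda>t. max 0 (min h t))"
  have cl: "cl t \<in> {0..h}" "t \<in> {0..h} \<Longrightarrow> cl t = t" "\<bar>cl t - cl s\<bar> \<le> \<bar>t - s\<bar>" for t s
    using h by (auto simp: cl_def)
  define I where "I = (\<lambda>\<phi> :: real \<Rightarrow>\<^sub>C 'a. \<lambda>t. integral {0..cl t} (\<lambda>s. X (\<phi> s)))"
  have Xc: "continuous_on S (\<lambda>s. X (apply_bcontfun \<phi> s))" for \<phi> and S :: "real set"
    by (rule continuous_on_compose2[OF X[of UNIV]]) auto
  have Ilip: "norm (I \<phi> t - I \<phi> s) \<le> M * \<bar>t - s\<bar>" for \<phi> t s
  proof -
    have "onorm (\<lambda>v. v *\<^sub>R X (\<phi> y)) \<le> M" for y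
    proof (rule onorm_bound)
      show "norm (v *\<^sub>R X (\<phi> y)) \<le> M * norm v" for v
        using mult_left_mono[OF M(2)[of "\<phi> y"], of "\<bar>v\<bar>"] by (simp add: mult.commute)
    qed (use M in simp)
    then have "norm (integral {0..cl t} (\<lambda>s. X (\<phi> s)) - integral {0..cl s} (\<lambda>s. X (\<phi> s))) \<le> M * norm (cl t - cl s)"
      using cl h M
      by (intro differentiable_bound[of "{0..h}" "\<lambda>t. integral {0..t} (\<lambda>s. X (\<phi> s))"
            "\<lambda>u v. v *\<^sub>R X (\<phi> u)"])
        (auto intro!: integral_has_vector_derivative Xc simp: has_vector_derivative_def[symmetric])
    also have "\<dots> \<le> M * \<bar>t - s\<bar>" using cl(3) M by (intro mult_left_mono) auto
    finally show ?thesis by (simp add: I_def)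
  qed
  have Icont: "continuous_on UNIV (\<lambda>t. x + I \<phi> t)" for \<phi> x
  proof -
    have "M-lipschitz_on UNIV (I \<phi>)"
      using Ilip M by (intro lipschitz_onI) (auto simp: dist_norm)
    then show ?thesis by (intro continuous_on_add continuous_on_const lipschitz_on_continuous_on)
  qed
  have I0: "I \<phi> 0 = 0" for \<phi> using cl(2)[of 0] h by (simp add: I_def)
  have mem: "(\<lambda>t. x + I \<phi> t) \<in> bcontfun" for \<phi> x
  proof (rule bcontfun_normI[OF Icont])
    fix t
    have "norm (I \<phi> t) = norm (I \<phi> (cl t) - I \<phi> 0)"
      unfolding I0 using cl(2)[OF cl(1)[of t]] by (simp add: I_def)
    also have "\<dots> \<le> M * \<bar>cl t - 0\<bar>" by (rule Ilip)
    also have "\<dots> \<le> M * h" using cl(1)[of t] M by (intro mult_left_mono) auto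
    finally show "norm (x + I \<phi> t) \<le> norm x + M * h" by (intro norm_triangle_le) auto
  qed
  define T where "T = (\<lambda>x \<phi>. Bcontfun (\<lambda>t. x + I \<phi> t))"
  have T: "apply_bcontfun (T x \<phi>) t = x + I \<phi> t" for x \<phi> t
    by (simp add: T_def Bcontfun_inverse mem)
  \<comment> \<open>With x = y this is a contraction with factor 1/2. Kept for different initial
    points, it also bounds the distance of two fixed points by
    \<open>2 * norm (x - y)\<close>.\<close>
  have contr: "dist (T x \<phi>) (T y \<psi>) \<le> norm (x - y) + 1/2 * dist \<phi> \<psi>" for x y \<phi> \<psi>
  proof (rule dist_bound)
    fix t
    have "norm (I \<phi> t - I \<psi> t) = norm (integral {0..cl t} (\<lambda>s. X (\<phi> s) - X (\<psi> s)))"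
      unfolding I_def by (subst integral_diff) (auto intro!: integrable_continuous_real Xc)
    also have "\<dots> \<le> (\<Lambda> * dist \<phi> \<psi>) * (cl t - 0)"
    proof (rule integral_bound)
      fix s
      have "norm (X (\<phi> s) - X (\<psi> s)) \<le> \<Lambda> * norm (\<phi> s - \<psi> s)" by (rule Lip)
      also have "\<dots> \<le> \<Lambda> * dist \<phi> \<psi>"
        using dist_bounded[of \<phi> s \<psi>] \<Lambda> by (intro mult_mono) (auto simp: dist_norm)
      finally show "norm (X (\<phi> s) - X (\<psi> s)) \<le> \<Lambda> * dist \<phi> \<psi>" .
    qed (use cl in \<open>auto intro!: continuous_on_diff Xc\<close>)
    also have "\<dots> \<le> 1/2 * dist \<phi> \<psi>"
    proof -
      have "\<Lambda> * cl t \<le> \<Lambda> * h" using cl(1)[of t] \<Lambda> by (simp add: mult_left_mono)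
      also have "\<dots> \<le> 1/2" using h by (simp add: mult.commute)
      finally have "\<Lambda> * cl t \<le> 1/2" .
      from mult_right_mono[OF this, of "dist \<phi> \<psi>"] show ?thesis by (simp add: mult_ac)
    qed
    finally have *: "norm (I \<phi> t - I \<psi> t) \<le> 1/2 * dist \<phi> \<psi>" .
    have "dist (T x \<phi> t) (T y \<psi> t) = norm ((x - y) + (I \<phi> t - I \<psi> t))"
      by (simp add: T dist_norm algebra_simps)
    also have "\<dots> \<le> norm (x - y) + 1/2 * dist \<phi> \<psi>" using * by (intro norm_triangle_le) simp
    finally show "dist (T x \<phi> t) (T y \<psi> t) \<le> norm (x - y) + 1/2 * dist \<phi> \<psi>" .
  qed
  have "\<exists>!\<phi>. T x \<phi> = \<phi>" for x
    by (rule banach_fix_type[of "1/2"]) (use contr[of x _ x] in auto)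
  then obtain \<Phi> where \<Phi>: "\<And>x. T x (\<Phi> x) = \<Phi> x" by metis
  have eq: "\<Phi> x t = x + I (\<Phi> x) t" for x t
    using T[of x "\<Phi> x" t] by (simp add: \<Phi>)
  have dep: "dist (\<Phi> x) (\<Phi> y) \<le> 2 * norm (x - y)" for x y
    using contr[of x "\<Phi> x" y "\<Phi> y"] by (simp add: \<Phi>)
  show ?thesis
  proof (intro exI[of _ "\<lambda>t x. \<Phi> x t"] conjI allI ballI)
    show "\<Phi> x 0 = x" for x by (simp add: eq[of x 0] I0)
    show "continuous_on UNIV (\<lambda>(t, x). \<Phi> x t)"
    proof -
      have "dist (\<Phi> x t) (\<Phi> y s) \<le> (2 + M) * dist (t, x) (s, y)" for x y t s
      proof -
        have "dist (\<Phi> x t) (\<Phi> y s) \<le> dist (\<Phi> x t) (\<Phi> y t) + dist (\<Phi> y t) (\<Phi> y s)" by (rule dist_triangle)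
        also have "dist (\<Phi> x t) (\<Phi> y t) \<le> 2 * norm (x - y)" using dist_bounded dep by (rule order_trans)
        also have "dist (\<Phi> y t) (\<Phi> y s) \<le> M * \<bar>t - s\<bar>"
          using Ilip[of "\<Phi> y" t s] by (simp add: eq[of y t] eq[of y s] dist_norm)
        also have "2 * norm (x - y) \<le> 2 * dist (t, x) (s, y)"
          using dist_snd_le[of "(t,x)" "(s,y)"] by (simp add: dist_norm)
        also have "M * \<bar>t - s\<bar> \<le> M * dist (t, x) (s, y)"
          using dist_fst_le[of "(t,x)" "(s,y)"] M by (simp add: dist_norm)
        finally show ?thesis by (simp add: distrib_right)
      qed
      then have "(2 + M)-lipschitz_on UNIV (\<lambda>(t, x). \<Phi> x t)"
        using M by (intro lipschitz_onI) auto
      then show ?thesis by (rule lipschitz_on_continuous_on)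
    qed
    fix x s assume s: "s \<in> {0..h}"
    have "((\<lambda>t. x + integral {0..t} (\<lambda>s. X (\<Phi> x s))) has_vector_derivative 0 + X (\<Phi> x s)) (at s within {0..h})"
      by (intro has_vector_derivative_add has_vector_derivative_const integral_has_vector_derivative Xc s)
    moreover have "\<Phi> x t = x + integral {0..t} (\<lambda>s. X (\<Phi> x s))" if "t \<in> {0..h}" for t
      using eq[of x t] cl(2)[OF that] by (simp add: I_def)
    ultimately show "((\<lambda>t. \<Phi> x t) has_vector_derivative X (\<Phi> x s)) (at s within {0..h})"
      using s by (auto intro: has_vector_derivative_transform)
  qed
qed

subsection \<open>Gluing on the real line\<close>

lemma lebesgue_shift_measurable: "(+) (a::real) \<in> lebesgue \<rightarrow>\<^sub>M lebesgue"
  and lebesgue_shift_distr: "distr lebesgue lebesgue ((+) (a::real)) = lebesgue"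
proof -
  show "(+) a \<in> lebesgue \<rightarrow>\<^sub>M lebesgue"
    using lebesgue_affine_measurable[of "\<lambda>_. 1" a] by simp
  have "distr lebesgue lebesgue ((+) a) = density (distr lebesgue lebesgue (\<lambda>x. a + 1 * x)) (\<lambda>_. ennreal \<bar>1\<bar>)"
    by (simp add: density_1)
  also have "\<dots> = lebesgue" by (rule lebesgue_real_affine[symmetric]) simp
  finally show "distr lebesgue lebesgue ((+) a) = lebesgue" .
qed

lemma lebesgue_on_shift_measurable:
  "(+) (a::real) \<in> lebesgue_on {p..q} \<rightarrow>\<^sub>M lebesgue_on {a+p..a+q}"
  using lebesgue_shift_measurable by (intro measurable_restrict_space3) auto

lemma lebesgue_on_shift_distr:
  "distr (lebesgue_on {p..q}) (lebesgue_on {a+p..a+q}) ((+) (a::real)) = lebesgue_on {a+p..a+q}"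
proof (rule measure_eqI)
  fix A assume "A \<in> sets (distr (lebesgue_on {p..q}) (lebesgue_on {a+p..a+q}) ((+) a))"
  then have A: "A \<in> sets (lebesgue_on {a+p..a+q})" by simp
  then have A': "A \<in> sets lebesgue" "A \<subseteq> {a+p..a+q}"
    by (auto simp: sets_restrict_space)
  have v: "(+) a -` A \<subseteq> {p..q}" using A' by auto
  have "emeasure (distr (lebesgue_on {p..q}) (lebesgue_on {a+p..a+q}) ((+) a)) A
    = emeasure (lebesgue_on {p..q}) ((+) a -` A \<inter> {p..q})"
    using A lebesgue_on_shift_measurable by (simp add: emeasure_distr)
  also have "(+) a -` A \<inter> {p..q} = (+) a -` A" using v by auto
  also have "emeasure (lebesgue_on {p..q}) ((+) a -` A) = emeasure lebesgue ((+) a -` A)"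
    using v by (simp add: emeasure_restrict_space)
  also have "\<dots> = emeasure (distr lebesgue lebesgue ((+) a)) A"
    using A' lebesgue_shift_measurable by (simp add: emeasure_distr)
  also have "\<dots> = emeasure (lebesgue_on {a+p..a+q}) A"
    using A' by (simp add: lebesgue_shift_distr emeasure_restrict_space)
  finally show "emeasure (distr (lebesgue_on {p..q}) (lebesgue_on {a+p..a+q}) ((+) a)) A
    = emeasure (lebesgue_on {a+p..a+q}) A" .
qed simp

lemma measurable_lebesgue_on_shift:
  "g \<in> borel_measurable (lebesgue_on {a+p..a+q}) \<Longrightarrow> (\<lambda>r. g (a + r)) \<in> borel_measurable (lebesgue_on {p..q::real})"
  using measurable_compose[OF lebesgue_on_shift_measurable] by blast

lemma AE_lebesgue_on_shift:
  assumes "AE r in lebesgue_on {a+p..a+q}. Q r" shows "AE r in lebesgue_on {p..q::real}. Q (a + r)"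
  using AE_distrD[OF lebesgue_on_shift_measurable, where P = Q, of p q a] assms
  unfolding lebesgue_on_shift_distr by blast

lemma has_bochner_integral_lebesgue_on_shift:
  fixes g :: "real \<Rightarrow> 'b::{banach, second_countable_topology}"
  assumes "has_bochner_integral (lebesgue_on {a+p..a+q}) g x"
  shows "has_bochner_integral (lebesgue_on {p..q}) (\<lambda>r. g (a + r)) x"
proof -
  let ?D = "distr (lebesgue_on {p..q}) (lebesgue_on {a+p..a+q}) ((+) a)"
  have meas: "g \<in> borel_measurable (lebesgue_on {a+p..a+q})"
    and "integrable ?D g" "integral\<^sup>L ?D g = x"
    using assms by (auto simp: has_bochner_integral_iff lebesgue_on_shift_distr)
  then show ?thesis
    using integrable_distr_eq[OF lebesgue_on_shift_measurable meas]
      integral_distr[OF lebesgue_on_shift_measurable meas]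
    by (simp add: has_bochner_integral_iff)
qed

lemma AE_lebesgue_neq: "AE r in lebesgue_on S. r \<noteq> (c::real)" if "S \<in> sets lebesgue"
proof -
  have "AE r in lebesgue. r \<noteq> c" using AE_lborel_singleton[of c] by (rule AE_completion)
  then have "AE r in lebesgue. r \<in> S \<longrightarrow> r \<noteq> c" by eventually_elim simp
  then show ?thesis using that by (simp add: AE_restrict_space_iff)
qed

lemma AE_lebesgue_on_join:
  assumes "AE r in lebesgue_on {a..b}. Q r" "AE r in lebesgue_on {b..c}. Q r"
  shows "AE r in lebesgue_on {a..c::real}. Q r"
proof -
  have "AE r in lebesgue. r \<in> {a..b} \<longrightarrow> Q r" "AE r in lebesgue. r \<in> {b..c} \<longrightarrow> Q r"
    using assms by (simp_all add: AE_restrict_space_iff)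
  then have "AE r in lebesgue. r \<in> {a..c} \<longrightarrow> Q r" by eventually_elim auto
  then show ?thesis by (simp add: AE_restrict_space_iff)
qed

lemma measurable_lebesgue_on_join:
  assumes "g \<in> measurable (lebesgue_on {a..b}) N" "g \<in> measurable (lebesgue_on {b..c}) N"
    "a \<le> b" "b \<le> (c::real)"
  shows "g \<in> measurable (lebesgue_on {a..c}) N"
proof (rule measurable_piecewise_restrict[of "{{a..b}, {b..c}}"])
  fix \<Omega> assume "\<Omega> \<in> {{a..b}, {b..c}}"
  then have "{a..c} \<inter> \<Omega> = \<Omega>" "g \<in> measurable (lebesgue_on \<Omega>) N" "\<Omega> \<in> sets lebesgue"
    using assms by auto
  then show "g \<in> measurable (restrict_space (lebesgue_on {a..c}) \<Omega>) N" "\<Omega> \<inter> space (lebesgue_on {a..c}) \<in> sets (lebesgue_on {a..c})"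
    by (auto simp: restrict_restrict_space sets_restrict_space Int_commute)
qed (use assms in auto)

lemma has_bochner_integral_lebesgue_on_join:
  fixes g :: "real \<Rightarrow> 'b::{banach, second_countable_topology}"
  assumes x: "has_bochner_integral (lebesgue_on {a..b}) g x" and y: "has_bochner_integral (lebesgue_on {b..c}) g y"
    and ab: "a \<le> b" "b \<le> (c::real)"
  shows "has_bochner_integral (lebesgue_on {a..c}) g (x + y)"
proof -
  have iff: "has_bochner_integral (lebesgue_on {p..q}) g z \<longleftrightarrow>
      has_bochner_integral lebesgue (\<lambda>r. indicator {p..q} r *\<^sub>R g r) z" for p q z
    by (simp add: has_bochner_integral_iff integrable_restrict_space integral_restrict_space)
  have "g \<in> borel_measurable (lebesgue_on {a..c})"
    by (rule measurable_lebesgue_on_join[OF x[THEN borel_measurable_has_bochner_integral]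
        y[THEN borel_measurable_has_bochner_integral] ab])
  then have meas: "(\<lambda>r. indicator {a..c} r *\<^sub>R g r) \<in> borel_measurable lebesgue"
    by (subst (asm) borel_measurable_restrict_space_iff) auto
  \<comment> \<open>The closed intervals share the point b, where the sum of the indicators is 2; it
    is a null set.\<close>
  have "AE r in lebesgue. r \<noteq> b" using AE_lborel_singleton[of b] by (rule AE_completion)
  then have ae: "AE r in lebesgue. indicator {a..b} r *\<^sub>R g r + indicator {b..c} r *\<^sub>R g r = indicator {a..c} r *\<^sub>R g r"
    by eventually_elim (use ab in \<open>auto simp: indicator_def\<close>)
  show ?thesis
    unfolding iff
    by (rule has_bochner_integralI_AE[OF has_bochner_integral_add[OF x[unfolded iff] y[unfolded iff]] meas ae])
qed

lemma integrable_lebesgue_on_subinterval: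
  fixes g :: "real \<Rightarrow> 'b::{banach, second_countable_topology}"
  assumes "integrable (lebesgue_on {a..b}) g" "{c..d} \<subseteq> {a..b}"
  shows "integrable (lebesgue_on {c..d}) g"
proof -
  have "integrable lebesgue (\<lambda>r. indicator {a..b} r *\<^sub>R g r)"
    using assms(1) by (simp add: integrable_restrict_space)
  then have "integrable lebesgue (\<lambda>r. indicator {c..d} r *\<^sub>R (indicator {a..b} r *\<^sub>R g r))"
    by (rule integrable_mult_indicator[rotated]) auto
  also have "(\<lambda>r. indicator {c..d} r *\<^sub>R (indicator {a..b} r *\<^sub>R g r)) = (\<lambda>r. indicator {c..d} r *\<^sub>R g r)"
    using assms(2) by (auto simp: indicator_def fun_eq_iff)
  finally show ?thesis by (simp add: integrable_restrict_space)
qed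

lemma measurable_lebesgue_on_subinterval:
  assumes "g \<in> measurable (lebesgue_on {a..b}) N" "{c..d} \<subseteq> {a..b::real}"
  shows "g \<in> measurable (lebesgue_on {c..d}) N"
proof -
  have "{a..b} \<inter> {c..d} = {c..d}" using assms(2) by blast
  then have "lebesgue_on {c..d} = restrict_space (lebesgue_on {a..b}) {c..d}"
    by (subst restrict_restrict_space) auto
  then show ?thesis using assms(1) by (simp add: measurable_restrict_space1)
qed

lemma AE_lebesgue_on_subinterval:
  assumes "AE r in lebesgue_on {a..b}. Q r" "{c..d} \<subseteq> {a..b::real}"
  shows "AE r in lebesgue_on {c..d}. Q r"
proof -
  have "AE r in lebesgue. r \<in> {a..b} \<longrightarrow> Q r" using assms(1) by (simp add: AE_restrict_space_iff)
  then have "AE r in lebesgue. r \<in> {c..d} \<longrightarrow> Q r" by eventually_elim (use assms(2) in auto)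
  then show ?thesis by (simp add: AE_restrict_space_iff)
qed

section \<open>Absolute continuity under shifts, restriction and gluing\<close>

definition subintervals :: "real \<Rightarrow> real \<Rightarrow> nat \<Rightarrow> (nat \<Rightarrow> real) \<Rightarrow> (nat \<Rightarrow> real) \<Rightarrow> bool" where
  "subintervals a b n s e \<longleftrightarrow> (\<forall>i<n. a \<le> s i \<and> s i \<le> e i \<and> e i \<le> b) \<and>
     (\<forall>i<n. \<forall>j<n. i \<noteq> j \<longrightarrow> e i \<le> s j \<or> e j \<le> s i)"

lemma abs_cont_on_iff:
  "abs_cont_on a b g \<longleftrightarrow> (\<forall>\<epsilon>>0. \<exists>\<delta>>0. \<forall>n s e. subintervals a b n s e \<longrightarrow>
     (\<Sum>i<n. e i - s i) < \<delta> \<longrightarrow> (\<Sum>i<n. norm (g (e i) - g (s i))) < \<epsilon>)"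
  unfolding abs_cont_on_def subintervals_def by (simp only: conj_assoc imp_conjL)

lemma abs_cont_on_shift:
  assumes "abs_cont_on (a + p) (a + q) g" shows "abs_cont_on p q (\<lambda>r. g (a + r))"
proof -
  have "subintervals (a + p) (a + q) n (\<lambda>i. a + s i) (\<lambda>i. a + e i)" if "subintervals p q n s e" for n s e
    using that by (simp add: subintervals_def)
  moreover have "(\<Sum>i<n. (a + e i) - (a + s i)) = (\<Sum>i<n. e i - s i)" for n and s e :: "nat \<Rightarrow> real" by simp
  ultimately show ?thesis using assms unfolding abs_cont_on_iff by metis
qed

lemma abs_cont_on_subinterval:
  assumes "abs_cont_on a b g" "a \<le> c" "d \<le> b" shows "abs_cont_on c d g"
proof -
  have "subintervals a b n s e" if "subintervals c d n s e" for n s e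
    using that assms(2,3) by (force simp: subintervals_def)
  then show ?thesis using assms(1) unfolding abs_cont_on_iff by meson
qed

lemma abs_cont_on_cong:
  assumes "abs_cont_on a b g" "\<And>r. r \<in> {a..b} \<Longrightarrow> g r = g' r" shows "abs_cont_on a b g'"
proof -
  have "(\<Sum>i<n. norm (g' (e i) - g' (s i))) = (\<Sum>i<n. norm (g (e i) - g (s i)))" if "subintervals a b n s e" for n s e
  proof (rule sum.cong)
    fix i assume "i \<in> {..<n}"
    then have "s i \<in> {a..b}" "e i \<in> {a..b}" using that by (force simp: subintervals_def)+
    then show "norm (g' (e i) - g' (s i)) = norm (g (e i) - g (s i))" by (simp add: assms(2))
  qed simp
  then show ?thesis using assms(1) unfolding abs_cont_on_iff by (simp cong: imp_cong)
qed

lemma abs_cont_on_join: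
  assumes 1: "abs_cont_on a b g" and 2: "abs_cont_on b c g" and "a \<le> b" "b \<le> c"
  shows "abs_cont_on a c g"
  unfolding abs_cont_on_iff
proof (intro allI impI)
  fix \<epsilon> :: real assume "\<epsilon> > 0"
  then have "\<epsilon> / 2 > 0" by simp
  with 1 obtain \<delta> where \<delta>: "\<delta> > 0" "\<And>n s e. subintervals a b n s e \<Longrightarrow>
      (\<Sum>i<n. e i - s i) < \<delta> \<Longrightarrow> (\<Sum>i<n. norm (g (e i) - g (s i))) < \<epsilon> / 2"
    unfolding abs_cont_on_iff by meson
  from 2 \<open>\<epsilon> / 2 > 0\<close> obtain \<eta> where \<eta>: "\<eta> > 0" "\<And>n s e. subintervals b c n s e \<Longrightarrow>
      (\<Sum>i<n. e i - s i) < \<eta> \<Longrightarrow> (\<Sum>i<n. norm (g (e i) - g (s i))) < \<epsilon> / 2"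
    unfolding abs_cont_on_iff by meson
  show "\<exists>\<delta>>0. \<forall>n s e. subintervals a c n s e \<longrightarrow>
      (\<Sum>i<n. e i - s i) < \<delta> \<longrightarrow> (\<Sum>i<n. norm (g (e i) - g (s i))) < \<epsilon>"
  proof (intro exI[of _ "min \<delta> \<eta>"] conjI allI impI)
    show "min \<delta> \<eta> > 0" using \<delta>(1) \<eta>(1) by simp
    fix n :: nat and s e :: "nat \<Rightarrow> real"
    assume fam: "subintervals a c n s e" and len: "(\<Sum>i<n. e i - s i) < min \<delta> \<eta>"
    have le: "a \<le> s i" "s i \<le> e i" "e i \<le> c" if "i < n" for i
      using fam that by (auto simp: subintervals_def)
    have disj: "e i \<le> s j \<or> e j \<le> s i" if "i < n" "j < n" "i \<noteq> j" for i j
      using fam that by (auto simp: subintervals_def)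
    \<comment> \<open>clamping each interval at the junction point splits it into its parts on both sides\<close>
    have fam': "subintervals a b n (\<lambda>i. min (s i) b) (\<lambda>i. min (e i) b)"
      "subintervals b c n (\<lambda>i. max (s i) b) (\<lambda>i. max (e i) b)"
    proof -
      have "a \<le> min (s i) b \<and> min (s i) b \<le> min (e i) b \<and> min (e i) b \<le> b"
        "b \<le> max (s i) b \<and> max (s i) b \<le> max (e i) b \<and> max (e i) b \<le> c" if "i < n" for i
        using le[OF that] assms(3,4) by (auto simp: min_def max_def)
      moreover have "min (e i) b \<le> min (s j) b \<or> min (e j) b \<le> min (s i) b"
        "max (e i) b \<le> max (s j) b \<or> max (e j) b \<le> max (s i) b" if "i < n" "j < n" "i \<noteq> j" for i j
        using disj[OF that] by (auto simp: min_def max_def)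
      ultimately show "subintervals a b n (\<lambda>i. min (s i) b) (\<lambda>i. min (e i) b)"
        "subintervals b c n (\<lambda>i. max (s i) b) (\<lambda>i. max (e i) b)"
        unfolding subintervals_def by blast+
    qed
    have "(\<Sum>i<n. min (e i) b - min (s i) b) \<le> (\<Sum>i<n. e i - s i)"
      "(\<Sum>i<n. max (e i) b - max (s i) b) \<le> (\<Sum>i<n. e i - s i)"
      using le by (intro sum_mono; force simp: min_def max_def)+
    then have "(\<Sum>i<n. norm (g (min (e i) b) - g (min (s i) b))) < \<epsilon> / 2"
      "(\<Sum>i<n. norm (g (max (e i) b) - g (max (s i) b))) < \<epsilon> / 2"
      using len by (intro \<delta>(2)[OF fam'(1)] \<eta>(2)[OF fam'(2)]; linarith)+
    moreover have "(\<Sum>i<n. norm (g (e i) - g (s i))) \<le>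
      (\<Sum>i<n. norm (g (min (e i) b) - g (min (s i) b)) + norm (g (max (e i) b) - g (max (s i) b)))"
    proof (rule sum_mono)
      fix i assume "i \<in> {..<n}"
      then have "s i \<le> e i" using le by auto
      then consider "e i \<le> b" | "s i \<ge> b" | "s i < b" "b < e i" by linarith
      then show "norm (g (e i) - g (s i)) \<le>
        norm (g (min (e i) b) - g (min (s i) b)) + norm (g (max (e i) b) - g (max (s i) b))"
      proof cases
        case 3
        then show ?thesis using norm_triangle_ineq[of "g b - g (s i)" "g (e i) - g b"] by simp
      qed (use \<open>s i \<le> e i\<close> in \<open>auto simp: min_absorb1 min_absorb2 max_absorb1 max_absorb2\<close>)
    qed
    ultimately show "(\<Sum>i<n. norm (g (e i) - g (s i))) < \<epsilon>" by (simp add: sum.distrib)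
  qed
qed

lemma Lipschitz_imp_abs_cont_on:
  assumes "\<And>r s. r \<in> {a..b} \<Longrightarrow> s \<in> {a..b} \<Longrightarrow> norm (g r - g s) \<le> M * \<bar>r - s\<bar>"
  shows "abs_cont_on a b g"
  unfolding abs_cont_on_iff
proof (intro allI impI)
  fix \<epsilon> :: real assume "\<epsilon> > 0"
  show "\<exists>\<delta>>0. \<forall>n s e. subintervals a b n s e \<longrightarrow>
      (\<Sum>i<n. e i - s i) < \<delta> \<longrightarrow> (\<Sum>i<n. norm (g (e i) - g (s i))) < \<epsilon>"
  proof (intro exI[of _ "\<epsilon> / (\<bar>M\<bar> + 1)"] conjI allI impI)
    show "\<epsilon> / (\<bar>M\<bar> + 1) > 0" using \<open>\<epsilon> > 0\<close> by simp
    fix n :: nat and s e :: "nat \<Rightarrow> real"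
    assume fam: "subintervals a b n s e" and len: "(\<Sum>i<n. e i - s i) < \<epsilon> / (\<bar>M\<bar> + 1)"
    have "(\<Sum>i<n. norm (g (e i) - g (s i))) \<le> (\<Sum>i<n. (\<bar>M\<bar> + 1) * (e i - s i))"
    proof (rule sum_mono)
      fix i assume "i \<in> {..<n}"
      then have i: "a \<le> s i" "s i \<le> e i" "e i \<le> b" using fam by (auto simp: subintervals_def)
      then have "norm (g (e i) - g (s i)) \<le> M * \<bar>e i - s i\<bar>" by (intro assms) auto
      also have "\<dots> \<le> (\<bar>M\<bar> + 1) * (e i - s i)" using i by (simp add: mult_right_mono)
      finally show "norm (g (e i) - g (s i)) \<le> (\<bar>M\<bar> + 1) * (e i - s i)" .
    qed
    also have "\<dots> = (\<bar>M\<bar> + 1) * (\<Sum>i<n. e i - s i)" by (simp add: sum_distrib_left)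
    also have "\<dots> < \<epsilon>" using len by (simp add: pos_less_divide_eq mult.commute add_nonneg_pos)
    finally show "(\<Sum>i<n. norm (g (e i) - g (s i))) < \<epsilon>" .
  qed
qed

subsection \<open>Curves with finite action\<close>

text \<open>End points are exact points of the covering space, so curves can be concatenated before
  any translation by integers is considered. The action is finite and recorded as a real number,
  hence additive, and the degenerate length 0 is allowed.\<close>

definition conn :: "('m::finite \<Rightarrow> real^'d \<Rightarrow> real^'d) \<Rightarrow> (real^'d \<Rightarrow> real^'m \<Rightarrow> real) \<Rightarrow>
    real \<Rightarrow> real^'d \<Rightarrow> real^'d \<Rightarrow> real \<Rightarrow> bool" where
  "conn f L t x y a \<longleftrightarrow> 0 \<le> t \<and> (\<exists>\<gamma> u. admissible f t \<gamma> u \<and> \<gamma> 0 = x \<and> \<gamma> t = y \<and>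
     has_bochner_integral (lebesgue_on {0..t}) (\<lambda>s. L (\<gamma> s) (u s)) a)"

lemma conn_nonneg: "conn f L t x y a \<Longrightarrow> 0 \<le> t"
  by (simp add: conn_def)

lemma conn_trans:
  assumes "conn f L s x y a" "conn f L t y z b"
  shows "conn f L (s + t) x z (a + b)"
proof -
  obtain \<gamma>1 u1 where 1: "admissible f s \<gamma>1 u1" "\<gamma>1 0 = x" "\<gamma>1 s = y"
      "has_bochner_integral (lebesgue_on {0..s}) (\<lambda>r. L (\<gamma>1 r) (u1 r)) a" and s: "0 \<le> s"
    using assms(1) unfolding conn_def by blast
  obtain \<gamma>2 u2 where 2: "admissible f t \<gamma>2 u2" "\<gamma>2 0 = y" "\<gamma>2 t = z"
      "has_bochner_integral (lebesgue_on {0..t}) (\<lambda>r. L (\<gamma>2 r) (u2 r)) b" and t: "0 \<le> t"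
    using assms(2) unfolding conn_def by blast
  define \<gamma> where "\<gamma> = (\<lambda>r. if r \<le> s then \<gamma>1 r else \<gamma>2 (- s + r))"
  define u where "u = (\<lambda>r. if r \<le> s then u1 r else u2 (- s + r))"
  have \<gamma>2: "\<gamma> r = \<gamma>2 (- s + r)" if "r \<ge> s" for r
    using that 1 2 by (auto simp: \<gamma>_def)
  have sub: "- s + s = 0" "- s + (s + t) = t" by auto
  have meas1: "u \<in> borel_measurable (lebesgue_on {0..s})"
    using 1(1) by (subst measurable_cong[of _ _ u1]) (auto simp: admissible_def L2_on_def u_def)
  have ne: "AE r in lebesgue_on {s..s + t}. r \<noteq> s" by (rule AE_lebesgue_neq) auto
  have u2: "(\<lambda>r. u2 (- s + r)) \<in> borel_measurable (lebesgue_on {s..s + t})"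
    using 2(1) sub by (intro measurable_lebesgue_on_shift) (simp add: admissible_def L2_on_def)
  \<comment> \<open>At the junction s the glued functions take the values of the first curve, so on
    the second interval they agree with the shifted second curve only for \<open>r > s\<close>.
    Changing one value does not affect measurability.\<close>
  have glue_meas: "h \<in> borel_measurable (lebesgue_on {s..s + t})"
    if "h2 \<in> borel_measurable (lebesgue_on {s..s + t})" "\<And>r. r > s \<Longrightarrow> h r = h2 r"
    for h h2 :: "real \<Rightarrow> 'e::{t2_space,second_countable_topology}"
  proof -
    have "(\<lambda>r. if r = s then h s else h2 r) \<in> borel_measurable (lebesgue_on {s..s+t})"
    proof (rule measurable_If[OF measurable_const that(1)])
      show "h s \<in> space borel" by simp
      have "{s..s + t} \<inter> {s} \<in> sets (lebesgue_on {s..s + t})" by (simp add: sets_restrict_space)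
      also have "{s..s + t} \<inter> {s} = {r \<in> space (lebesgue_on {s..s + t}). r = s}" by auto
      finally show "{r \<in> space (lebesgue_on {s..s + t}). r = s} \<in> sets (lebesgue_on {s..s + t})" .
    qed
    also have "?this \<longleftrightarrow> h \<in> borel_measurable (lebesgue_on {s..s+t})"
      by (rule measurable_cong) (use that(2) in auto)
    finally show ?thesis .
  qed
  have meas2: "u \<in> borel_measurable (lebesgue_on {s..s + t})"
    by (rule glue_meas[OF u2]) (simp add: u_def)
  have int1: "has_bochner_integral (lebesgue_on {0..s}) (\<lambda>r. h (\<gamma> r) (u r)) k"
    if "has_bochner_integral (lebesgue_on {0..s}) (\<lambda>r. h (\<gamma>1 r) (u1 r)) k" for h :: "_ \<Rightarrow> _ \<Rightarrow> real" and k
    using that by (subst has_bochner_integral_cong[OF refl _ refl, of _ _ "\<lambda>r. h (\<gamma>1 r) (u1 r)"])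
      (auto simp: \<gamma>_def u_def)
  have int2: "has_bochner_integral (lebesgue_on {s..s + t}) (\<lambda>r. h (\<gamma> r) (u r)) k"
    if "has_bochner_integral (lebesgue_on {0..t}) (\<lambda>r. h (\<gamma>2 r) (u2 r)) k" for h :: "_ \<Rightarrow> _ \<Rightarrow> real" and k
  proof -
    have *: "has_bochner_integral (lebesgue_on {s..s + t}) (\<lambda>r. h (\<gamma>2 (- s + r)) (u2 (- s + r))) k"
      using that sub by (intro has_bochner_integral_lebesgue_on_shift) simp
    show ?thesis
    proof (rule has_bochner_integralI_AE[OF *])
      show "AE r in lebesgue_on {s..s + t}. h (\<gamma>2 (- s + r)) (u2 (- s + r)) = h (\<gamma> r) (u r)"
        using ne by (rule AE_mp) (auto simp: \<gamma>_def u_def intro!: AE_I2)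
      show "(\<lambda>r. h (\<gamma> r) (u r)) \<in> borel_measurable (lebesgue_on {s..s + t})"
        by (rule glue_meas[of "\<lambda>r. h (\<gamma>2 (- s + r)) (u2 (- s + r))"])
          (use * in \<open>auto simp: \<gamma>_def u_def has_bochner_integral_iff\<close>)
    qed
  qed
  have "abs_cont_on 0 (s + t) \<gamma>"
  proof (rule abs_cont_on_join)
    show "abs_cont_on 0 s \<gamma>"
      using 1(1) by (auto simp: admissible_def \<gamma>_def intro: abs_cont_on_cong)
    have "abs_cont_on s (s + t) (\<lambda>r. \<gamma>2 (- s + r))"
      using 2(1) sub by (intro abs_cont_on_shift) (simp add: admissible_def)
    then show "abs_cont_on s (s + t) \<gamma>" by (rule abs_cont_on_cong) (simp add: \<gamma>2)
  qed (use s t in auto)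
  moreover have "L2_on (s + t) u"
  proof -
    obtain k1 k2 where "has_bochner_integral (lebesgue_on {0..s}) (\<lambda>r. (norm (u1 r))\<^sup>2) k1"
      "has_bochner_integral (lebesgue_on {0..t}) (\<lambda>r. (norm (u2 r))\<^sup>2) k2"
      using 1(1) 2(1) unfolding admissible_def L2_on_def by (blast elim: integrable.cases)
    then have "has_bochner_integral (lebesgue_on {0..s + t}) (\<lambda>r. (norm (u r))\<^sup>2) (k1 + k2)"
      using int1[of "\<lambda>x v. (norm v)\<^sup>2"] int2[of "\<lambda>x v. (norm v)\<^sup>2"] s t
      by (intro has_bochner_integral_lebesgue_on_join) auto
    then show ?thesis
      using measurable_lebesgue_on_join[OF meas1 meas2] s t by (auto simp: L2_on_def intro: integrable.intros)
  qed
  moreover have "AE r in lebesgue_on {0..s + t}. (\<gamma> has_vector_derivative Fapp f (\<gamma> r) (u r)) (at r)"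
  proof (rule AE_lebesgue_on_join)
    \<comment> \<open>Admissibility asks for two-sided derivatives. The junction is discarded as a
      null set, and elsewhere the glued curve coincides with one of the pieces on an open
      set.\<close>
    have "AE r in lebesgue_on {0..s}. (\<gamma>1 has_vector_derivative Fapp f (\<gamma>1 r) (u1 r)) (at r)"
      "AE r in lebesgue_on {0..s}. r \<noteq> s" "AE r in lebesgue_on {0..s}. r \<in> space (lebesgue_on {0..s})"
      using 1(1) by (auto simp: admissible_def intro!: AE_lebesgue_neq)
    then show "AE r in lebesgue_on {0..s}. (\<gamma> has_vector_derivative Fapp f (\<gamma> r) (u r)) (at r)"
    proof eventually_elim
      case (elim r)
      then have "r \<in> {..<s}" by auto
      then have "(\<gamma> has_vector_derivative Fapp f (\<gamma>1 r) (u1 r)) (at r)"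
        by (intro has_vector_derivative_transform_within_open[OF elim(1) open_lessThan])
          (auto simp: \<gamma>_def)
      then show ?case using \<open>r \<in> {..<s}\<close> by (simp add: \<gamma>_def u_def)
    qed
    have "AE r in lebesgue_on {0..t}. (\<gamma>2 has_vector_derivative Fapp f (\<gamma>2 r) (u2 r)) (at r)"
      using 2(1) by (auto simp: admissible_def)
    then have "AE r in lebesgue_on {s..s+t}. (\<gamma>2 has_vector_derivative Fapp f (\<gamma>2 (- s + r)) (u2 (- s + r))) (at (- s + r))"
      by (rule AE_lebesgue_on_shift[where a = "- s" and p = s and q = "s + t", unfolded sub])
    moreover note ne
    moreover have "AE r in lebesgue_on {s..s + t}. r \<in> space (lebesgue_on {s..s + t})" by (rule AE_space)
    ultimately show "AE r in lebesgue_on {s..s + t}. (\<gamma> has_vector_derivative Fapp f (\<gamma> r) (u r)) (at r)"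
    proof eventually_elim
      case (elim r)
      then have r: "r \<in> {s<..}" by auto
      have "((\<lambda>r. - s + r) has_real_derivative 1) (at r)" by (auto intro!: derivative_eq_intros)
      then have "((\<gamma>2 \<circ> (\<lambda>r. - s + r)) has_vector_derivative 1 *\<^sub>R Fapp f (\<gamma>2 (- s + r)) (u2 (- s + r))) (at r)"
        by (intro vector_diff_chain_at elim(1)) (simp add: has_real_derivative_iff_has_vector_derivative)
      then have "(\<gamma> has_vector_derivative 1 *\<^sub>R Fapp f (\<gamma>2 (- s + r)) (u2 (- s + r))) (at r)"
        by (rule has_vector_derivative_transform_within_open[OF _ open_greaterThan r])
          (auto simp: \<gamma>_def)
      then show ?case using r by (simp add: \<gamma>_def u_def)
    qed
  qed
  ultimately have "admissible f (s + t) \<gamma> u" by (simp add: admissible_def)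
  moreover have "\<gamma> 0 = x" "\<gamma> (s + t) = z" using s t 1 2 \<gamma>2[of "s + t"] by (auto simp: \<gamma>_def)
  moreover have "has_bochner_integral (lebesgue_on {0..s + t}) (\<lambda>r. L (\<gamma> r) (u r)) (a + b)"
    using int1[OF 1(4)] int2[OF 2(4)] s t by (intro has_bochner_integral_lebesgue_on_join) auto
  ultimately show ?thesis using s t unfolding conn_def by auto
qed

lemma conn_split:
  assumes "conn f L (s + t) x z a" "0 \<le> s" "0 \<le> t"
  obtains y b c where "conn f L s x y b" "conn f L t y z c" "a = b + c"
proof -
  obtain \<gamma> u where ad: "admissible f (s + t) \<gamma> u" and \<gamma>: "\<gamma> 0 = x" "\<gamma> (s + t) = z"
    and a: "has_bochner_integral (lebesgue_on {0..s + t}) (\<lambda>r. L (\<gamma> r) (u r)) a"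
    using assms(1) unfolding conn_def by blast
  have sub: "{0..s} \<subseteq> {0..s + t}" "{s..s + t} \<subseteq> {0..s + t}" "{s + 0..s + t} \<subseteq> {0..s + t}"
    using assms(2,3) by auto
  have ac: "abs_cont_on 0 (s + t) \<gamma>" and um: "u \<in> borel_measurable (lebesgue_on {0..s + t})"
    and u2: "integrable (lebesgue_on {0..s + t}) (\<lambda>r. (norm (u r))\<^sup>2)"
    and d: "AE r in lebesgue_on {0..s + t}. (\<gamma> has_vector_derivative Fapp f (\<gamma> r) (u r)) (at r)"
    using ad unfolding admissible_def L2_on_def by blast+
  have La: "integrable (lebesgue_on {0..s + t}) (\<lambda>r. L (\<gamma> r) (u r))" using a by (rule integrable.intros)
  define b where "b = integral\<^sup>L (lebesgue_on {0..s}) (\<lambda>r. L (\<gamma> r) (u r))"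
  define c where "c = integral\<^sup>L (lebesgue_on {s..s + t}) (\<lambda>r. L (\<gamma> r) (u r))"
  have b: "has_bochner_integral (lebesgue_on {0..s}) (\<lambda>r. L (\<gamma> r) (u r)) b"
    and c: "has_bochner_integral (lebesgue_on {s..s + t}) (\<lambda>r. L (\<gamma> r) (u r)) c"
    unfolding b_def c_def
    by (intro has_bochner_integral_integrable integrable_lebesgue_on_subinterval[OF La] sub)+
  have "a = b + c"
    using has_bochner_integral_eq[OF a has_bochner_integral_lebesgue_on_join[OF b c]] assms(2,3) by simp
  moreover have "admissible f s \<gamma> u"
    unfolding admissible_def L2_on_def
    using abs_cont_on_subinterval[OF ac] measurable_lebesgue_on_subinterval[OF um sub(1)]
      integrable_lebesgue_on_subinterval[OF u2 sub(1)] AE_lebesgue_on_subinterval[OF d sub(1)] assms(3)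
    by auto
  then have "conn f L s x (\<gamma> s) b" using b \<gamma> assms(2) unfolding conn_def by blast
  moreover have "admissible f t (\<lambda>r. \<gamma> (s + r)) (\<lambda>r. u (s + r))"
    unfolding admissible_def L2_on_def
  proof (intro conjI)
    show "abs_cont_on 0 t (\<lambda>r. \<gamma> (s + r))"
      using assms(2) by (intro abs_cont_on_shift abs_cont_on_subinterval[OF ac]) auto
    show "(\<lambda>r. u (s + r)) \<in> borel_measurable (lebesgue_on {0..t})"
      by (intro measurable_lebesgue_on_shift measurable_lebesgue_on_subinterval[OF um sub(3)])
    have "has_bochner_integral (lebesgue_on {s + 0..s + t}) (\<lambda>r. (norm (u r))\<^sup>2)
       (integral\<^sup>L (lebesgue_on {s + 0..s + t}) (\<lambda>r. (norm (u r))\<^sup>2))"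
      by (intro has_bochner_integral_integrable integrable_lebesgue_on_subinterval[OF u2 sub(3)])
    from has_bochner_integral_lebesgue_on_shift[OF this]
    show "integrable (lebesgue_on {0..t}) (\<lambda>r. (norm (u (s + r)))\<^sup>2)" by (rule integrable.intros)
    have "AE r in lebesgue_on {0..t}. (\<gamma> has_vector_derivative Fapp f (\<gamma> (s + r)) (u (s + r))) (at (s + r))"
      by (intro AE_lebesgue_on_shift AE_lebesgue_on_subinterval[OF d sub(3)])
    then show "AE r in lebesgue_on {0..t}. ((\<lambda>r. \<gamma> (s + r)) has_vector_derivative Fapp f (\<gamma> (s + r)) (u (s + r))) (at r)"
    proof eventually_elim
      case (elim r)
      have "((\<lambda>r. s + r) has_real_derivative 1) (at r)" by (auto intro!: derivative_eq_intros)
      then have "((\<gamma> \<circ> (\<lambda>r. s + r)) has_vector_derivative 1 *\<^sub>R Fapp f (\<gamma> (s + r)) (u (s + r))) (at r)"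
        by (intro vector_diff_chain_at elim(1)) (simp add: has_real_derivative_iff_has_vector_derivative)
      then show ?case by (simp add: comp_def)
    qed
  qed
  then have "conn f L t (\<gamma> s) z c"
    unfolding conn_def using assms(3) \<gamma> has_bochner_integral_lebesgue_on_shift[of s 0 t] c by force
  ultimately show ?thesis using that by blast
qed

lemma int_vec_add: "int_vec k \<Longrightarrow> int_vec l \<Longrightarrow> int_vec (k + l)"
  and int_vec_uminus: "int_vec k \<Longrightarrow> int_vec (- k)"
  and int_vec_0: "int_vec 0"
  by (auto simp: int_vec_def)

lemma Fapp_periodic:
  assumes "\<And>i. periodic_on_torus (f i)" "int_vec k" shows "Fapp f (x + k) u = Fapp f x u"
  using assms by (simp add: Fapp_def Fmat_def periodic_on_torus_def)

lemma conn_translate: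
  assumes "\<And>i. periodic_on_torus (f i)" "periodic_on_torus L" "int_vec k" "conn f L t x y a"
  shows "conn f L t (x + k) (y + k) a"
proof -
  obtain \<gamma> u where ad: "admissible f t \<gamma> u" "\<gamma> 0 = x" "\<gamma> t = y" "0 \<le> t"
      "has_bochner_integral (lebesgue_on {0..t}) (\<lambda>r. L (\<gamma> r) (u r)) a"
    using assms(4) unfolding conn_def by blast
  have "abs_cont_on 0 t (\<lambda>r. \<gamma> r + k)"
    using ad(1) by (simp add: admissible_def abs_cont_on_def)
  moreover have "AE r in lebesgue_on {0..t}. ((\<lambda>r. \<gamma> r + k) has_vector_derivative Fapp f (\<gamma> r + k) (u r)) (at r)"
  proof -
    have "AE r in lebesgue_on {0..t}. (\<gamma> has_vector_derivative Fapp f (\<gamma> r) (u r)) (at r)"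
      using ad(1) by (simp add: admissible_def)
    then show ?thesis
      by eventually_elim (simp add: Fapp_periodic[OF assms(1,3)] has_vector_derivative_add_const)
  qed
  moreover have "L (x + k) = L x" for x using assms(2,3) by (simp add: periodic_on_torus_def)
  ultimately show ?thesis
    using ad unfolding conn_def admissible_def
    by (intro conjI exI[of _ "\<lambda>r. \<gamma> r + k"] exI[of _ u]) auto
qed

lemma conn_arc:
  assumes t: "0 \<le> t" and \<gamma>: "\<And>s. s \<in> {0..t} \<Longrightarrow> (\<gamma> has_vector_derivative Fapp f (\<gamma> s) w) (at s within {0..t})"
    and bdd: "bounded (range (\<lambda>x. Fapp f x w))"
    and L: "continuous_on UNIV (\<lambda>x. L x w)" "\<And>x. L x w \<le> B"
  obtains a where "conn f L t (\<gamma> 0) (\<gamma> t) a" "a \<le> B * t"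
proof -
  obtain M where M: "M > 0" "\<And>x. norm (Fapp f x w) \<le> M" using bdd unfolding bounded_pos by auto
  have on: "onorm (\<lambda>v. v *\<^sub>R Fapp f y w) \<le> M" for y
  proof (rule onorm_bound)
    show "norm (v *\<^sub>R Fapp f y w) \<le> M * norm v" for v
      using mult_left_mono[OF M(2)[of y], of "\<bar>v\<bar>"] by (simp add: mult.commute)
  qed (use M in simp)
  have "norm (\<gamma> r - \<gamma> s) \<le> M * \<bar>r - s\<bar>" if "r \<in> {0..t}" "s \<in> {0..t}" for r s
    using differentiable_bound[of "{0..t}" \<gamma> "\<lambda>s v. v *\<^sub>R Fapp f (\<gamma> s) w" M r s] \<gamma> on that
    by (auto simp: has_vector_derivative_def)
  then have "abs_cont_on 0 t \<gamma>" by (rule Lipschitz_imp_abs_cont_on)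
  moreover have "L2_on t (\<lambda>_. w)"
    by (auto simp: L2_on_def)
  moreover have "AE s in lebesgue_on {0..t}. (\<gamma> has_vector_derivative Fapp f (\<gamma> s) w) (at s)"
  proof -
    \<comment> \<open>At the two ends only a one-sided derivative is available; they are excluded as
      null sets.\<close>
    have "AE s in lebesgue_on {0..t}. s \<noteq> 0" "AE s in lebesgue_on {0..t}. s \<noteq> t"
      "AE s in lebesgue_on {0..t}. s \<in> space (lebesgue_on {0..t})"
      by (auto intro!: AE_lebesgue_neq)
    then show ?thesis
    proof eventually_elim
      case (elim s)
      then have s: "s \<in> {0<..<t}" by auto
      then have "at s within {0..t} = at s" by (simp add: at_within_Icc_at)
      then show ?case using \<gamma>[of s] s by auto
    qed
  qed
  ultimately have ad: "admissible f t \<gamma> (\<lambda>_. w)" by (simp add: admissible_def)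
  have "continuous_on {0..t} \<gamma>"
    using \<gamma> by (meson continuous_on_eq_continuous_within has_vector_derivative_continuous)
  then have "continuous_on {0..t} (\<lambda>s. L (\<gamma> s) w)"
    by (rule continuous_on_compose2[OF L(1)]) auto
  then have int: "integrable (lebesgue_on {0..t}) (\<lambda>s. L (\<gamma> s) w)"
    using continuous_imp_integrable_real by blast
  have "integral\<^sup>L (lebesgue_on {0..t}) (\<lambda>s. L (\<gamma> s) w) \<le> integral\<^sup>L (lebesgue_on {0..t}) (\<lambda>s. B)"
    using L(2) by (intro integral_mono int) auto
  also have "\<dots> = B * t" using t by (simp add: measure_restrict_space)
  finally show ?thesis
    using ad t has_bochner_integral_integrable[OF int] by (intro that) (auto simp: conn_def)
qed

lemma conn_lower_bound:
  assumes "conn f L t x y a" "\<And>x u. L x u \<ge> - K"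
  shows "a \<ge> - K * t"
proof -
  obtain \<gamma> u where 1: "0 \<le> t" "has_bochner_integral (lebesgue_on {0..t}) (\<lambda>r. L (\<gamma> r) (u r)) a"
    using assms(1) unfolding conn_def by blast
  have "integral\<^sup>L (lebesgue_on {0..t}) (\<lambda>r. - K) \<le> integral\<^sup>L (lebesgue_on {0..t}) (\<lambda>r. L (\<gamma> r) (u r))"
    using assms(2) by (intro integral_mono integrable.intros[OF 1(2)]) auto
  then show ?thesis
    using 1(1) by (simp add: has_bochner_integral_integral_eq[OF 1(2)] measure_restrict_space mult.commute)
qed

subsection \<open>Small-time local controllability\<close>

text \<open>Both directions are demanded, at a price of at most B per unit of time. Words of flows
  of a driftless system satisfy this, and the relation becomes symmetric, additive in time and
  monotone in time.\<close>

definition reach :: "('m::finite \<Rightarrow> real^'d \<Rightarrow> real^'d) \<Rightarrow> (real^'d \<Rightarrow> real^'m \<Rightarrow> real) \<Rightarrow> real \<Rightarrow>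
    real \<Rightarrow> real^'d \<Rightarrow> real^'d \<Rightarrow> bool" where
  "reach f L B t x y \<longleftrightarrow> (\<exists>a\<le>B * t. conn f L t x y a) \<and> (\<exists>a\<le>B * t. conn f L t y x a)"

lemma reach_sym: "reach f L B t x y \<Longrightarrow> reach f L B t y x"
  by (auto simp: reach_def)

lemma reach_trans:
  assumes "reach f L B s x y" "reach f L B t y z" shows "reach f L B (s + t) x z"
proof -
  obtain a b a' b' where "a \<le> B * s" "conn f L s x y a" "b \<le> B * t" "conn f L t y z b"
    "a' \<le> B * s" "conn f L s y x a'" "b' \<le> B * t" "conn f L t z y b'"
    using assms unfolding reach_def by blast
  then have "conn f L (s + t) x z (a + b)" "a + b \<le> B * (s + t)"
    "conn f L (s + t) z x (b' + a')" "b' + a' \<le> B * (s + t)"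
    using conn_trans[of f L s x y a t z b] conn_trans[of f L t z y b' s x a']
    by (simp_all add: distrib_left add.commute)
  then show ?thesis unfolding reach_def by blast
qed

lemma Fapp_uminus: "Fapp f x (- w) = - Fapp f x w"
  by (simp add: Fapp_def matrix_vector_mult_def vec_eq_iff sum_negf)

lemma Fapp_axis: "Fapp f x (axis i 1) = f i x"
  by (simp add: Fapp_def Fmat_def matrix_vector_mult_def vec_eq_iff axis_def if_distrib cong: if_cong)

text \<open>The bounds in the form in which they enter: all steering is done with controls of norm
  at most 1, for which B is a price per unit of time, and -K keeps mean actions bounded
  below.\<close>

locale lagrangian_system =
  fixes f :: "'m::finite \<Rightarrow> real^'d \<Rightarrow> real^'d" and L :: "real^'d \<Rightarrow> real^'m \<Rightarrow> real" and B K :: real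
  assumes tame: "\<And>i. tame_field (f i)"
    and hoer: "hoermander f"
    and L_periodic: "periodic_on_torus L"
    and L_continuous: "\<And>w. continuous_on UNIV (\<lambda>x. L x w)"
    and L_upper: "\<And>x u. norm u \<le> 1 \<Longrightarrow> L x u \<le> B"
    and L_lower: "\<And>x u. - K \<le> L x u"
    and B_nonneg: "0 \<le> B"
begin

lemma bounded_Fapp: "bounded (range (\<lambda>x. Fapp f x w))"
proof (rule periodic_continuous_bounded)
  show "periodic_on_torus (\<lambda>x. Fapp f x w)"
    using tame Fapp_periodic[of f] by (auto simp: periodic_on_torus_def tame_field_def)
  have "Fapp f x w = (\<Sum>i\<in>UNIV. w $ i *\<^sub>R f i x)" for x
    by (simp add: Fapp_def Fmat_def matrix_vector_mult_def vec_eq_iff mult.commute)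
  moreover have "continuous_on UNIV (\<lambda>x. \<Sum>i\<in>UNIV. w $ i *\<^sub>R f i x)"
    by (intro continuous_on_sum continuous_on_scaleR continuous_on_const tame_field_continuous tame)
  ultimately show "continuous_on UNIV (\<lambda>x. Fapp f x w)" by simp
qed

lemma reach_arc:
  assumes t: "0 \<le> t" and w: "norm w \<le> 1"
    and P: "\<And>s. s \<in> {0..t} \<Longrightarrow> (\<gamma> has_vector_derivative Fapp f (\<gamma> s) w) (at s within {0..t})"
  shows "reach f L B t (\<gamma> 0) (\<gamma> t)"
proof -
  obtain a where a: "conn f L t (\<gamma> 0) (\<gamma> t) a" "a \<le> B * t"
    by (rule conn_arc[where f = f and L = L and B = B and t = t and \<gamma> = \<gamma> and w = w, OF t P bounded_Fapp L_continuous L_upper[OF w]])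
  \<comment> \<open>Time reversal: the curve run backwards solves the equation with control
    \<open>- w\<close>, which again has norm at most 1.\<close>
  have rev: "((\<lambda>s. \<gamma> (t - s)) has_vector_derivative Fapp f (\<gamma> (t - s)) (- w)) (at s within {0..t})"
    if s: "s \<in> {0..t}" for s
  proof -
    have img: "(\<lambda>s. t - s) ` {0..t} = {0..t}"
      by (auto simp: image_iff intro!: bexI[of _ "t - _"])
    have "((\<lambda>s. t - s) has_vector_derivative - 1) (at s within {0..t})"
      by (auto intro!: derivative_eq_intros)
    moreover have "(\<gamma> has_vector_derivative Fapp f (\<gamma> (t - s)) w) (at (t - s) within (\<lambda>s. t - s) ` {0..t})"
      unfolding img using s by (intro P) auto
    ultimately have "(\<gamma> \<circ> (\<lambda>s. t - s) has_vector_derivative - 1 *\<^sub>R Fapp f (\<gamma> (t - s)) w) (at s within {0..t})"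
      by (rule vector_diff_chain_within)
    then show ?thesis by (simp add: comp_def Fapp_uminus)
  qed
  have w': "norm (- w) \<le> 1" using w by simp
  obtain b where b: "conn f L t (\<gamma> (t - 0)) (\<gamma> (t - t)) b" "b \<le> B * t"
    by (rule conn_arc[where f = f and L = L and B = B and t = t and \<gamma> = "\<lambda>s. \<gamma> (t - s)" and w = "- w",
          OF t rev bounded_Fapp L_continuous L_upper[OF w']])
  then show ?thesis using a unfolding reach_def by auto
qed

text \<open>Control 0 waits at x. Travel times can therefore be padded, which
  \<open>reach_mono\<close> and the common time in \<open>uniform_tconn\<close> rely on.\<close>

lemma reach_refl: "0 \<le> t \<Longrightarrow> reach f L B t x x"
  using reach_arc[of t 0 "\<lambda>_. x"] by (simp add: Fapp_def)

lemma reach_mono: "reach f L B s x y \<Longrightarrow> s \<le> t \<Longrightarrow> reach f L B t x y"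
  using reach_trans[OF _ reach_refl[of "t - s"]] by fastforce

text \<open>For a word in the flows, M is its number of letters: each letter runs for time t, so the
  word takes \<open>M * t\<close>.\<close>

definition steering :: "real \<Rightarrow> real \<Rightarrow> (real \<Rightarrow> real^'d \<Rightarrow> real^'d) \<Rightarrow> bool" where
  "steering h M P \<longleftrightarrow> (\<forall>x. P 0 x = x) \<and> continuous_on ({0..h} \<times> UNIV) (\<lambda>(t, x). P t x) \<and>
     (\<forall>t\<in>{0..h}. \<forall>x. reach f L B (M * t) x (P t x))"

lemma steering_compose:
  assumes "steering h M P" "steering h N Q"
  shows "steering h (M + N) (\<lambda>t x. Q t (P t x))"
proof -
  let ?S = "{0..h} \<times> (UNIV :: (real^'d) set)"
  have P: "continuous_on ?S (\<lambda>z. P (fst z) (snd z))" and Q: "continuous_on ?S (\<lambda>z. Q (fst z) (snd z))"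
    using assms by (simp_all add: steering_def case_prod_beta)
  have "continuous_on ?S (\<lambda>z. (fst z, P (fst z) (snd z)))"
    by (intro continuous_on_Pair continuous_on_fst continuous_on_id P)
  from continuous_on_compose2[OF Q this]
  have "continuous_on ?S (\<lambda>z. Q (fst z) (P (fst z) (snd z)))" by force
  then have "continuous_on ({0..h} \<times> UNIV) (\<lambda>(t, x). Q t (P t x))" by (simp add: case_prod_beta)
  moreover have "reach f L B ((M + N) * t) x (Q t (P t x))" if "t \<in> {0..h}" for t x
    unfolding distrib_right
    using assms that by (intro reach_trans[of f L B "M * t" x "P t x"]) (auto simp: steering_def)
  ultimately show ?thesis using assms by (simp add: steering_def)
qed

text \<open>One interval of existence for the flows of all \<open>f i\<close> and of their
  negatives, so that words of any length can be formed on it. The condition is the contraction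
  hypothesis of \<open>Lipschitz_flow_exists\<close> with the Lipschitz constants
  eliminated.\<close>

definition horizon :: real where
  "horizon = (SOME h. 0 < h \<and> h \<le> 1 \<and> (\<forall>i x y. h * norm (f i x - f i y) \<le> norm (x - y) / 2))"

lemma horizon: "0 < horizon" "horizon \<le> 1" "horizon * norm (f i x - f i y) \<le> norm (x - y) / 2"
proof -
  have "\<exists>\<Lambda>>0. \<forall>x y. norm (f i x - f i y) \<le> \<Lambda> * norm (x - y)" for i
    using tame_field_Lipschitz[OF tame] by metis
  then obtain \<Lambda> where \<Lambda>: "\<And>i. \<Lambda> i > 0" "\<And>i x y. norm (f i x - f i y) \<le> \<Lambda> i * norm (x - y)" by metis
  define S where "S = 1 + (\<Sum>i\<in>UNIV. \<Lambda> i)"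
  have S: "\<Lambda> i \<le> S" "S \<ge> 1" for i
    unfolding S_def using \<Lambda>(1) member_le_sum[of i UNIV \<Lambda>] by (auto simp: less_imp_le sum_nonneg add_increasing)
  have "0 < 1 / (2 * S) \<and> 1 / (2 * S) \<le> 1 \<and> (\<forall>i x y. 1 / (2 * S) * norm (f i x - f i y) \<le> norm (x - y) / 2)"
  proof (intro conjI allI)
    fix i x y
    have "norm (f i x - f i y) \<le> S * norm (x - y)"
      using \<Lambda>(2) S(1) by (meson mult_right_mono norm_ge_zero order_trans)
    then show "1 / (2 * S) * norm (f i x - f i y) \<le> norm (x - y) / 2"
      using S(2) by (simp add: field_simps)
  qed (use S(2) in auto)
  then have "\<exists>h. 0 < h \<and> h \<le> 1 \<and> (\<forall>i x y. h * norm (f i x - f i y) \<le> norm (x - y) / 2)" by blast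
  from someI_ex[OF this] show "0 < horizon" "horizon \<le> 1" "horizon * norm (f i x - f i y) \<le> norm (x - y) / 2"
    unfolding horizon_def by blast+
qed

lemma steering_flow:
  assumes tX: "tame_field X" and X: "\<And>x. X x = Fapp f x w" and w: "norm w \<le> 1"
    and lip: "\<And>x y. horizon * norm (X x - X y) \<le> norm (x - y) / 2"
  obtains P where "steering horizon 1 P" "expands horizon P (exp_series (along X))"
proof -
  have "norm (X x - X y) \<le> (1 / (2 * horizon)) * norm (x - y)" for x y
    using lip[of x y] horizon(1) by (simp add: field_simps)
  moreover have "0 \<le> 1 / (2 * horizon)" "horizon * (1 / (2 * horizon)) \<le> 1 / 2"
    using horizon(1) by auto
  ultimately have "\<exists>P. (\<forall>x. P 0 x = x) \<and> continuous_on UNIV (\<lambda>(t,x). P t x) \<and>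
    (\<forall>x. \<forall>s\<in>{0..horizon}. ((\<lambda>t. P t x) has_vector_derivative X (P s x)) (at s within {0..horizon}))"
    by (intro Lipschitz_flow_exists[OF _ _ tame_field_bounded[OF tX] horizon(1)])
  then obtain P where P: "\<And>x. P 0 x = x" "continuous_on UNIV (\<lambda>(t,x). P t x)"
    "\<And>x s. s \<in> {0..horizon} \<Longrightarrow> ((\<lambda>t. P t x) has_vector_derivative X (P s x)) (at s within {0..horizon})"
    by blast
  have "reach f L B t x (P t x)" if t: "t \<in> {0..horizon}" for t x
  proof -
    have "((\<lambda>t. P t x) has_vector_derivative Fapp f (P s x) w) (at s within {0..t})" if "s \<in> {0..t}" for s
    proof -
      have "s \<in> {0..horizon}" using t that by auto
      from P(3)[OF this, of x] show ?thesis
        unfolding X by (rule has_vector_derivative_within_subset) (use t in auto)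
    qed
    then show ?thesis using reach_arc[of t w "\<lambda>t. P t x"] w t by (simp add: P(1))
  qed
  then have "steering horizon 1 P"
    using P(1) continuous_on_subset[OF P(2), of "{0..horizon} \<times> UNIV"] by (simp add: steering_def)
  then show ?thesis using that expands_flow[OF tX P(1,3)] by blast
qed

text \<open>A commutator of series involves the inverses of its factors, so the induction carries
  each word together with a partner whose series is the inverse and leads with the opposite sign.
  Exchanging the two factors inverts a commutator and thus supplies the next partner; orders
  add.\<close>

lemma bracket_steering:
  assumes "X \<in> lie_gen f"
  shows "\<exists>k\<ge>1. \<exists>P P' c c' M. expands horizon P c \<and> expands horizon P' c' \<and>
    leads k c (along X) \<and> leads k c' (- along X) \<and> c * c' = 1 \<and> c' * c = 1 \<and>
    steering horizon M P \<and> steering horizon M P'"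
  using assms
proof induction
  case (base i)
  have neg: "tame_field (\<lambda>x. - f i x)"
  proof -
    have "smooth_fun (\<lambda>x. (-1) * f i x $ j)" for j
      using tame[of i] by (intro smooth_fun_mult smooth_fun_const) (auto simp: tame_field_def smooth_field_def)
    then show ?thesis using tame[of i] by (auto simp: tame_field_def smooth_field_def periodic_on_torus_def)
  qed
  have along: "along (\<lambda>x. - f i x) = - along (f i)"
    by (rule endo_eqI) (simp add: ev_along[OF neg] ev_along[OF tame] linear_neg
        linear_frechet_derivative smooth_fun_differentiable smooth_ev)
  obtain P where P: "steering horizon 1 P" "expands horizon P (exp_series (along (f i)))"
    using steering_flow[OF tame, of i "axis i 1"] horizon(3) by (auto simp: Fapp_axis)
  obtain P' where P': "steering horizon 1 P'" "expands horizon P' (exp_series (- along (f i)))"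
    using steering_flow[OF neg, of "- axis i 1"] horizon(3)[of i]
    by (auto simp: Fapp_axis Fapp_uminus along norm_minus_commute)
  show ?case
    using P P' leads_exp_series[of "along (f i)"] leads_exp_series[of "- along (f i)"]
      exp_series_inverse[of "along (f i)"] exp_series_inverse[of "- along (f i)"]
    by (intro exI[of _ 1] conjI exI[of _ P] exI[of _ P'] exI[of _ "exp_series (along (f i))"]
        exI[of _ "exp_series (- along (f i))"] exI[of _ 1]) auto
next
  case (brk X Y)
  obtain k P P' c c' M where X: "k \<ge> 1" "expands horizon P c" "expands horizon P' c'"
    "leads k c (along X)" "leads k c' (- along X)" "c * c' = 1" "c' * c = 1"
    "steering horizon M P" "steering horizon M P'" using brk.IH(1) by blast
  obtain l Q Q' e e' N where Y: "l \<ge> 1" "expands horizon Q e" "expands horizon Q' e'"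
    "leads l e (along Y)" "leads l e' (- along Y)" "e * e' = 1" "e' * e = 1"
    "steering horizon N Q" "steering horizon N Q'" using brk.IH(2) by blast
  have tXY: "tame_field X" "tame_field Y" using tame_field_lie_gen[of f, OF tame] brk.hyps by auto
  have zero: "fps_nth c' 0 = 1" "fps_nth e' 0 = 1" using X(5) Y(5) by (auto simp: leads_def)
  have "expands horizon (\<lambda>t x. Q' t (P' t (Q t (P t x)))) (c * e * c' * e')"
    using expands_compose[OF expands_compose[OF expands_compose[OF X(2) Y(2)] X(3)] Y(3)] by simp
  moreover have "expands horizon (\<lambda>t x. P' t (Q' t (P t (Q t x)))) (e * c * e' * c')"
    using expands_compose[OF expands_compose[OF expands_compose[OF Y(2) X(2)] Y(3)] X(3)] by simp
  moreover have "leads (k + l) (c * e * c' * e') (along (lie_bracket X Y))"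
    unfolding along_bracket[OF tXY] by (rule leads_commutator) (use X Y zero in auto)
  moreover have "leads (k + l) (e * c * e' * c') (- along (lie_bracket X Y))"
    unfolding along_bracket[OF tXY] minus_diff_eq add.commute[of k l]
    by (rule leads_commutator) (use X Y zero in auto)
  moreover have "(c * e * c' * e') * (e * c * e' * c') = 1" "(e * c * e' * c') * (c * e * c' * e') = 1"
  proof -
    have "e' * (e * z) = z" "e * (e' * z) = z" "c' * (c * z) = z" "c * (c' * z) = z" for z
      by (simp_all add: mult.assoc[symmetric] X(6,7) Y(6,7))
    then show "(c * e * c' * e') * (e * c * e' * c') = 1" "(e * c * e' * c') * (c * e * c' * e') = 1"
      by (simp_all add: mult.assoc X(6,7) Y(6,7))
  qed
  moreover have "steering horizon (M + N + M + N) (\<lambda>t x. Q' t (P' t (Q t (P t x))))"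
    by (intro steering_compose X Y)
  moreover have "steering horizon (N + M + N + M) (\<lambda>t x. P' t (Q' t (P t (Q t x))))"
    by (intro steering_compose X Y)
  then have "steering horizon (M + N + M + N) (\<lambda>t x. P' t (Q' t (P t (Q t x))))"
    by (simp add: add_ac)
  moreover have "k + l \<ge> 1" using X(1) by simp
  ultimately show ?case by blast
qed

text \<open>The coordinates are used as test functions, expanded to order \<open>Suc k\<close>: the
  coefficients strictly between 0 and k vanish, coefficient 0 gives x and coefficient k gives X. The
  operator A is left general in order to cover the word for -X as well.\<close>

lemma leading_displacement:
  fixes X :: "real^'d \<Rightarrow> real^'d"
  assumes k: "k \<ge> 1" and P: "expands h P c" and c: "leads k c A"
    and A: "\<And>x j. ev (app A (coord j)) x = X x $ j"
  obtains C where "C \<ge> 0" "\<And>t x. t \<in> {0..h} \<Longrightarrow> norm (P t x - x - t ^ k *\<^sub>R X x) \<le> C * t ^ Suc k"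
proof -
  have "\<exists>C. \<forall>t\<in>{0..h}. \<forall>x. \<bar>ev (coord j) (P t x) - (\<Sum>n<Suc k. t ^ n * ev (app (fps_nth c n) (coord j)) x)\<bar> \<le> C * t ^ Suc k" for j
    by (rule P[unfolded expands_def, THEN spec, THEN spec, THEN mp]) simp
  then have "\<forall>j. \<exists>C. \<forall>t\<in>{0..h}. \<forall>x. \<bar>ev (coord j) (P t x) - (\<Sum>n<Suc k. t ^ n * ev (app (fps_nth c n) (coord j)) x)\<bar> \<le> C * t ^ Suc k" ..
  from choice[OF this] obtain C where C: "\<And>j t x. t \<in> {0..h} \<Longrightarrow>
      \<bar>ev (coord j) (P t x) - (\<Sum>n<Suc k. t ^ n * ev (app (fps_nth c n) (coord j)) x)\<bar> \<le> C j * t ^ Suc k"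
    by blast
  have sum: "(\<Sum>n<Suc k. t ^ n * ev (app (fps_nth c n) (coord j)) x) = x $ j + t ^ k * X x $ j" for t x j
  proof -
    have "(\<Sum>n<Suc k. t ^ n * ev (app (fps_nth c n) (coord j)) x)
      = (\<Sum>n\<in>{0,k}. t ^ n * ev (app (fps_nth c n) (coord j)) x)"
      using c by (intro sum.mono_neutral_right) (auto simp: leads_def less_Suc_eq)
    also have "\<dots> = x $ j + t ^ k * X x $ j"
      using c k by (simp add: leads_def A)
    finally show ?thesis .
  qed
  show ?thesis
  proof (rule that[of "\<Sum>j\<in>UNIV. \<bar>C j\<bar>"])
    fix t x assume t: "t \<in> {0..h}"
    have "norm (P t x - x - t ^ k *\<^sub>R X x) \<le> (\<Sum>j\<in>UNIV. \<bar>(P t x - x - t ^ k *\<^sub>R X x) $ j\<bar>)"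
      by (rule norm_le_l1_cart)
    also have "\<dots> \<le> (\<Sum>j\<in>UNIV. \<bar>C j\<bar> * t ^ Suc k)"
    proof (rule sum_mono)
      fix j
      have "\<bar>(P t x - x - t ^ k *\<^sub>R X x) $ j\<bar> \<le> C j * t ^ Suc k"
        using C[of t j x, OF t] unfolding sum by (simp add: algebra_simps)
      also have "\<dots> \<le> \<bar>C j\<bar> * t ^ Suc k" using t by (intro mult_right_mono) auto
      finally show "\<bar>(P t x - x - t ^ k *\<^sub>R X x) $ j\<bar> \<le> \<bar>C j\<bar> * t ^ Suc k" .
    qed
    finally show "norm (P t x - x - t ^ k *\<^sub>R X x) \<le> (\<Sum>j\<in>UNIV. \<bar>C j\<bar>) * t ^ Suc k"
      by (simp add: sum_distrib_right)
  qed (simp add: sum_nonneg)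
qed

text \<open>Run the word of order \<open>k\<close> for time \<open>\<bar>a\<bar>\<^sup>1\<^sup>/\<^sup>k\<close>, and its inverse word when \<open>a\<close> is negative.\<close>
lemma bracket_move:
  assumes X: "X \<in> lie_gen f"
  shows "\<exists>W. \<forall>\<epsilon>>0. \<exists>\<eta>>0. continuous_on ({-\<eta>..\<eta>} \<times> UNIV) (\<lambda>z. W (fst z) (snd z)) \<and>
    (\<forall>a\<in>{-\<eta>..\<eta>}. \<forall>x. norm (W a x - x - a *\<^sub>R X x) \<le> \<epsilon> * \<bar>a\<bar> \<and> reach f L B \<epsilon> x (W a x))"
proof -
  obtain k P P' c c' M where k: "k \<ge> 1" and P: "expands horizon P c" "expands horizon P' c'"
    "leads k c (along X)" "leads k c' (- along X)" "steering horizon M P" "steering horizon M P'"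
    using bracket_steering[OF X] by blast
  have tX: "tame_field X" using tame_field_lie_gen[of f, OF tame X] .
  obtain C where C: "C \<ge> 0" "\<And>t x. t \<in> {0..horizon} \<Longrightarrow> norm (P t x - x - t ^ k *\<^sub>R X x) \<le> C * t ^ Suc k"
    using leading_displacement[OF k P(1,3)] along_coord[OF tX] by metis
  obtain C' where C': "C' \<ge> 0" "\<And>t x. t \<in> {0..horizon} \<Longrightarrow> norm (P' t x - x - t ^ k *\<^sub>R - X x) \<le> C' * t ^ Suc k"
    using leading_displacement[OF k P(2,4), of "\<lambda>x. - X x"] along_coord[OF tX] by (auto simp del: scaleR_minus_right)
  define W where "W = (\<lambda>a x. if a \<le> 0 then P' (root k (- a)) x else P (root k a) x)"
  show ?thesis
  proof (intro exI[of _ W] allI impI)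
    fix \<epsilon> :: real assume \<epsilon>: "\<epsilon> > 0"
    \<comment> \<open>Below this time the error \<open>C * t ^ Suc k\<close> is at most
      \<open>\<epsilon> * t ^ k\<close>, and the duration \<open>M * t\<close> of the word is at
      most \<epsilon>. In terms of a the window is \<open>\<tau> ^ k\<close>.\<close>
    define \<tau> where "\<tau> = min horizon (\<epsilon> / (C + C' + \<bar>M\<bar> + 1))"
    have den: "C + C' + \<bar>M\<bar> + 1 > 0" using C C' by auto
    have \<tau>: "\<tau> > 0" "\<tau> \<le> horizon" using \<epsilon> den horizon(1) by (auto simp: \<tau>_def)
    have "\<tau> \<le> \<epsilon> / (C + C' + \<bar>M\<bar> + 1)" by (simp add: \<tau>_def)
    then have "(C + C' + \<bar>M\<bar> + 1) * \<tau> \<le> \<epsilon>"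
      using den by (simp add: pos_le_divide_eq mult.commute)
    moreover have "0 \<le> C * \<tau>" "0 \<le> C' * \<tau>" "0 \<le> \<bar>M\<bar> * \<tau>" using C C' \<tau> by auto
    ultimately have small: "C * \<tau> \<le> \<epsilon>" "C' * \<tau> \<le> \<epsilon>" "\<bar>M\<bar> * \<tau> \<le> \<epsilon>"
      using \<tau>(1) unfolding distrib_right by linarith+
    have root: "root k a \<in> {0..\<tau>}" "root k a ^ k = a" if "0 \<le> a" "a \<le> \<tau> ^ k" for a
    proof -
      have "root k a \<le> root k (\<tau> ^ k)" using k that by simp
      also have "\<dots> = \<tau>" using k \<tau> by (simp add: real_root_power_cancel)
      finally show "root k a \<in> {0..\<tau>}" using that k by simp
      show "root k a ^ k = a" using that k by (simp add: real_root_pow_pos2)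
    qed
    have err: "D * t ^ Suc k \<le> \<epsilon> * t ^ k" "M * t \<le> \<epsilon>" if "t \<in> {0..\<tau>}" "D * \<tau> \<le> \<epsilon>" "D \<ge> 0" for t D
    proof -
      have "D * t \<le> D * \<tau>" using that by (intro mult_left_mono) auto
      then have "D * t * t ^ k \<le> \<epsilon> * t ^ k" using that by (intro mult_right_mono) auto
      then show "D * t ^ Suc k \<le> \<epsilon> * t ^ k" by (simp add: mult_ac)
      have "M * t \<le> \<bar>M\<bar> * \<tau>" using that by (intro mult_mono) auto
      then show "M * t \<le> \<epsilon>" using small by simp
    qed
    \<comment> \<open>The sign s is 1 for the word and - 1 for its inverse word; at a = 0 both are
      the identity, so the two halves of W fit together.\<close>
    have cont: "continuous_on S (\<lambda>z. P (root k (s * fst z)) (snd z))"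
      if "steering horizon M P" "\<And>a x. (a, x) \<in> S \<Longrightarrow> 0 \<le> s * a \<and> s * a \<le> \<tau> ^ k"
      for S :: "(real \<times> (real^'d)) set" and s P
    proof -
      have "continuous_on ({0..horizon} \<times> UNIV) (\<lambda>z. P (fst z) (snd z))"
        using that(1) by (simp add: steering_def case_prod_beta)
      moreover have "continuous_on S (\<lambda>z. (root k (s * fst z), snd z))"
        by (intro continuous_on_Pair continuous_on_real_root continuous_on_mult continuous_on_const
            continuous_on_fst continuous_on_snd continuous_on_id)
      moreover have "(\<lambda>z. (root k (s * fst z), snd z)) ` S \<subseteq> {0..horizon} \<times> UNIV"
      proof clarsimp
        fix a x assume "(a, x) \<in> S"
        from root(1)[of "s * a"] that(2)[OF this] \<tau>(2)
        show "0 \<le> root k (s * a) \<and> root k (s * a) \<le> horizon" by simp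
      qed
      ultimately have "continuous_on S (\<lambda>z. P (fst (root k (s * fst z), snd z)) (snd (root k (s * fst z), snd z)))"
        by (rule continuous_on_compose2)
      then show ?thesis by simp
    qed
    show "\<exists>\<eta>>0. continuous_on ({-\<eta>..\<eta>} \<times> UNIV) (\<lambda>z. W (fst z) (snd z)) \<and>
      (\<forall>a\<in>{-\<eta>..\<eta>}. \<forall>x. norm (W a x - x - a *\<^sub>R X x) \<le> \<epsilon> * \<bar>a\<bar> \<and> reach f L B \<epsilon> x (W a x))"
    proof (intro exI[of _ "\<tau> ^ k"] conjI ballI allI)
      show "\<tau> ^ k > 0" using \<tau> by simp
      show "continuous_on ({-(\<tau> ^ k)..\<tau> ^ k} \<times> UNIV) (\<lambda>z. W (fst z) (snd z))"
        unfolding W_def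
      proof (rule continuous_on_cases_le)
        show "continuous_on {z \<in> {-(\<tau> ^ k)..\<tau> ^ k} \<times> UNIV. fst z \<le> 0} (\<lambda>z. P' (root k (- fst z)) (snd z))"
          using cont[OF P(6), of "{z \<in> {-(\<tau> ^ k)..\<tau> ^ k} \<times> UNIV. fst z \<le> 0}" "- 1"] by simp
        show "continuous_on {z \<in> {-(\<tau> ^ k)..\<tau> ^ k} \<times> UNIV. 0 \<le> fst z} (\<lambda>z. P (root k (fst z)) (snd z))"
          using cont[OF P(5), of "{z \<in> {-(\<tau> ^ k)..\<tau> ^ k} \<times> UNIV. 0 \<le> fst z}" 1] by simp
        show "continuous_on ({-(\<tau> ^ k)..\<tau> ^ k} \<times> UNIV) (fst :: real \<times> (real^'d) \<Rightarrow> real)"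
          by (intro continuous_on_fst continuous_on_id)
        show "P' (root k (- fst z)) (snd z) = P (root k (fst z)) (snd z)" if "fst z = 0" for z :: "real \<times> (real^'d)"
          using that P(5,6) by (simp add: steering_def)
      qed
      fix a :: real and x assume a: "a \<in> {-(\<tau> ^ k)..\<tau> ^ k}"
      have *: "norm (Q t x - x - t ^ k *\<^sub>R Y x) \<le> \<epsilon> * t ^ k \<and> reach f L B \<epsilon> x (Q t x)"
        if "t \<in> {0..\<tau>}" "steering horizon M Q" "D * \<tau> \<le> \<epsilon>" "D \<ge> 0"
          "\<And>t x. t \<in> {0..horizon} \<Longrightarrow> norm (Q t x - x - t ^ k *\<^sub>R Y x) \<le> D * t ^ Suc k"
        for t D Q and Y :: "real^'d \<Rightarrow> real^'d"
      proof
        have t: "t \<in> {0..horizon}" using that(1) \<tau> by auto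
        show "norm (Q t x - x - t ^ k *\<^sub>R Y x) \<le> \<epsilon> * t ^ k"
          using that(5)[OF t, of x] err(1)[OF that(1,3,4)] by linarith
        have "reach f L B (M * t) x (Q t x)" using that(2) t by (simp add: steering_def)
        then show "reach f L B \<epsilon> x (Q t x)" using err(2)[OF that(1,3,4)] by (rule reach_mono)
      qed
      have "norm (W a x - x - a *\<^sub>R X x) \<le> \<epsilon> * \<bar>a\<bar> \<and> reach f L B \<epsilon> x (W a x)"
      proof (cases "a \<le> 0")
        case True
        then have r: "root k (- a) \<in> {0..\<tau>}" "root k (- a) ^ k = - a" using a root[of "- a"] by auto
        from *[OF r(1) P(6) small(2) C'] show ?thesis
          unfolding r(2) using True by (simp add: W_def)
      next
        case False
        then have r: "root k a \<in> {0..\<tau>}" "root k a ^ k = a" using a root[of a] by auto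
        from *[OF r(1) P(5) small(1) C] show ?thesis
          unfolding r(2) using False by (simp add: W_def)
      qed
      then show "norm (W a x - x - a *\<^sub>R X x) \<le> \<epsilon> * \<bar>a\<bar>" "reach f L B \<epsilon> x (W a x)" by auto
    qed
  qed
qed

text \<open>Brackets evaluated at x0 contain a basis E. Performing the moves of
  \<open>bracket_move\<close> one after another, by the coordinates of v in E, gives a continuous
  map G with \<open>G v = x0 + v\<close> up to an error of size \<open>\<epsilon> * norm v\<close>,
  and such a map covers a ball around x0.\<close>

lemma local_controllability:
  assumes \<delta>: "\<delta> > 0"
  shows "\<exists>\<rho>>0. \<forall>y\<in>cball x0 \<rho>. reach f L B \<delta> x0 y"
proof -
  define V where "V = {X x0 | X. X \<in> lie_gen f}"
  have "span V = UNIV" using hoer by (simp add: hoermander_def V_def)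
  obtain E where E: "E \<subseteq> V" "independent E" "V \<subseteq> span E" by (rule maximal_independent_subset)
  have spanE: "span E = UNIV"
    using E(3) \<open>span V = UNIV\<close> by (metis span_mono span_span top.extremum_uniqueI)
  have finE: "finite E" using E(2) independent_imp_finite by blast
  define r where "r = (\<lambda>b v. representation E v b)"
  have r_sum: "(\<Sum>b\<in>E. r b v *\<^sub>R b) = v" for v
    unfolding r_def by (rule real_vector.sum_representation_eq[OF E(2) _ finE]) (simp_all add: spanE)
  have r_lin: "linear (r b)" for b
    unfolding r_def using E(2) spanE
    by (intro linearI) (simp_all add: real_vector.representation_add real_vector.representation_scale)
  have r_cont: "continuous_on S (r b)" for b S
    using r_lin linear_continuous_on linear_conv_bounded_linear by blast
  have "\<exists>A. \<forall>v. \<bar>r b v\<bar> \<le> A * norm v" for b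
    using linear_bounded[OF r_lin, of b] by (auto simp: mult.commute)
  then obtain A0 where A0: "\<And>b v. \<bar>r b v\<bar> \<le> A0 b * norm v" by metis
  define A where "A = (\<Sum>b\<in>E. \<bar>A0 b\<bar>)"
  have A: "A \<ge> 0" by (simp add: A_def sum_nonneg)
  have rA: "\<bar>r b v\<bar> \<le> A * norm v" if "b \<in> E" for b v
  proof -
    have "A0 b \<le> A" unfolding A_def using member_le_sum[of b E "\<lambda>b. \<bar>A0 b\<bar>"] that finE by auto
    then show ?thesis using A0[of b v] by (meson mult_right_mono norm_ge_zero order_trans)
  qed
  \<comment> \<open>Induction over the basis vectors. The same \<epsilon> bounds the relative error
    and the total time; the induction hypothesis is used with half of it.\<close>
  have main: "\<exists>\<rho>>0. \<exists>G. continuous_on (cball 0 \<rho>) G \<and> (\<forall>v\<in>cball 0 \<rho>.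
      norm (G v - x0 - (\<Sum>b\<in>F. r b v *\<^sub>R b)) \<le> \<epsilon> * norm v \<and> reach f L B \<epsilon> x0 (G v))"
    if "finite F" "F \<subseteq> E" "\<epsilon> > 0" for F \<epsilon>
    using that
  proof (induction F arbitrary: \<epsilon> rule: finite_induct)
    case empty
    then show ?case
      by (intro exI[of _ 1] conjI exI[of _ "\<lambda>_. x0"]) (auto simp: reach_refl)
  next
    case (insert b F)
    obtain X where X: "X \<in> lie_gen f" "X x0 = b" using insert.prems(1) E(1) by (auto simp: V_def)
    \<comment> \<open>Chosen so that each of the two new errors is at most a quarter of
      \<open>\<epsilon> * norm v\<close> and the new move takes at most a quarter of the time
      \<epsilon>; A bounds every coordinate by \<open>A * norm v\<close>.\<close>
    define \<epsilon>1 where "\<epsilon>1 = \<epsilon> / (4 * (A + 1))"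
    have \<epsilon>1: "\<epsilon>1 > 0" "\<epsilon>1 * A \<le> \<epsilon> / 4" "\<epsilon>1 \<le> \<epsilon> / 4"
      using insert.prems(2) A by (auto simp: \<epsilon>1_def field_simps)
    obtain W where W: "\<And>\<epsilon>. \<epsilon> > 0 \<Longrightarrow> \<exists>\<eta>>0. continuous_on ({-\<eta>..\<eta>} \<times> UNIV) (\<lambda>z. W (fst z) (snd z)) \<and>
      (\<forall>a\<in>{-\<eta>..\<eta>}. \<forall>x. norm (W a x - x - a *\<^sub>R X x) \<le> \<epsilon> * \<bar>a\<bar> \<and> reach f L B \<epsilon> x (W a x))"
      using bracket_move[OF X(1)] by blast
    obtain \<eta> where \<eta>: "\<eta> > 0" "continuous_on ({-\<eta>..\<eta>} \<times> UNIV) (\<lambda>z. W (fst z) (snd z))"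
      "\<And>a x. a \<in> {-\<eta>..\<eta>} \<Longrightarrow> norm (W a x - x - a *\<^sub>R X x) \<le> \<epsilon>1 * \<bar>a\<bar> \<and> reach f L B \<epsilon>1 x (W a x)"
      using W[OF \<epsilon>1(1)] by blast
    have "isCont X x0"
      using tame_field_continuous[OF tame_field_lie_gen[of f, OF tame X(1)], of UNIV]
      by (simp add: continuous_on_eq_continuous_at)
    then obtain \<theta> where \<theta>: "\<theta> > 0" "\<And>y. dist y x0 < \<theta> \<Longrightarrow> dist (X y) (X x0) < \<epsilon>1"
      using \<epsilon>1(1) unfolding continuous_at_eps_delta by metis
    obtain \<rho>1 G where G: "\<rho>1 > 0" "continuous_on (cball 0 \<rho>1) G" "\<And>v. v \<in> cball 0 \<rho>1 \<Longrightarrow>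
      norm (G v - x0 - (\<Sum>b\<in>F. r b v *\<^sub>R b)) \<le> \<epsilon> / 2 * norm v \<and> reach f L B (\<epsilon> / 2) x0 (G v)"
      using insert.IH[of "\<epsilon> / 2"] insert.prems by auto
    define D where "D = (\<Sum>b\<in>F. A * norm b)"
    have D: "D \<ge> 0" unfolding D_def using A by (intro sum_nonneg) auto
    \<comment> \<open>The three terms keep v where G is defined, the coordinate of v inside the
      window \<eta> of the new move, and \<open>G v\<close> so close to x0 that X there differs from
      b by at most \<epsilon>1.\<close>
    define \<rho> where "\<rho> = min \<rho>1 (min (\<eta> / (A + 1)) (\<theta> / (\<epsilon> + D + 1)))"
    have \<rho>: "\<rho> > 0" "\<rho> \<le> \<rho>1" "\<rho> \<le> \<eta> / (A + 1)" "\<rho> \<le> \<theta> / (\<epsilon> + D + 1)"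
      using G(1) \<eta>(1) \<theta>(1) A D insert.prems(2) by (auto simp: \<rho>_def)
    have ra: "r b v \<in> {-\<eta>..\<eta>}" if "v \<in> cball 0 \<rho>" for v
    proof -
      have "\<bar>r b v\<bar> \<le> A * norm v" using rA insert.prems(1) by auto
      also have "\<dots> \<le> (A + 1) * \<rho>" using that A by (intro mult_mono) auto
      also have "\<dots> \<le> \<eta>" using \<rho>(3) A by (simp add: field_simps)
      finally show ?thesis by auto
    qed
    show ?case
    proof (intro exI[of _ \<rho>] conjI \<rho>(1) exI[of _ "\<lambda>v. W (r b v) (G v)"] ballI)
      have "continuous_on (cball 0 \<rho>) (\<lambda>v. (r b v, G v))"
        using \<rho>(2) by (intro continuous_on_Pair r_cont continuous_on_subset[OF G(2)]) auto
      from continuous_on_compose2[OF \<eta>(2) this] ra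
      show "continuous_on (cball 0 \<rho>) (\<lambda>v. W (r b v) (G v))" by force
      fix v :: "real^'d" assume v: "v \<in> cball 0 \<rho>"
      then have v1: "v \<in> cball 0 \<rho>1" using \<rho>(2) by auto
      note Gv = G(3)[OF v1] and Wv = \<eta>(3)[OF ra[OF v], of "G v"]
      have "norm (\<Sum>b\<in>F. r b v *\<^sub>R b) \<le> (\<Sum>b\<in>F. A * norm v * norm b)"
        using rA insert.prems(1) by (intro order_trans[OF norm_sum] sum_mono) (auto intro!: mult_right_mono)
      also have "\<dots> = D * norm v"
        unfolding D_def sum_distrib_right by (intro sum.cong) auto
      finally have "norm (\<Sum>b\<in>F. r b v *\<^sub>R b) \<le> D * norm v" .
      then have "norm (G v - x0) \<le> \<epsilon> / 2 * norm v + D * norm v"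
        using Gv norm_triangle_ineq[of "G v - x0 - (\<Sum>b\<in>F. r b v *\<^sub>R b)" "\<Sum>b\<in>F. r b v *\<^sub>R b"] by simp
      also have "\<dots> \<le> (\<epsilon> / 2 + D) * \<rho>"
        using v insert.prems(2) D unfolding distrib_right[symmetric] by (intro mult_left_mono) auto
      also have "\<dots> < (\<epsilon> + D + 1) * \<rho>" using \<rho>(1) insert.prems(2) by (intro mult_strict_right_mono) auto
      also have "\<dots> \<le> \<theta>" using \<rho>(4) insert.prems(2) D by (simp add: field_simps)
      finally have "norm (X (G v) - b) \<le> \<epsilon>1" using \<theta>(2)[of "G v"] X(2) by (simp add: dist_norm)
      then have "norm (r b v *\<^sub>R (X (G v) - b)) \<le> (A * norm v) * \<epsilon>1"
        using rA[of b v] insert.prems(1) A by (auto intro!: mult_mono)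
      moreover have "norm (W (r b v) (G v) - G v - r b v *\<^sub>R X (G v)) \<le> \<epsilon>1 * (A * norm v)"
      proof -
        have "\<epsilon>1 * \<bar>r b v\<bar> \<le> \<epsilon>1 * (A * norm v)"
          using rA[of b v] insert.prems(1) \<epsilon>1(1) by (intro mult_left_mono) auto
        then show ?thesis using Wv by linarith
      qed
      moreover have "norm (G v - x0 - (\<Sum>b\<in>F. r b v *\<^sub>R b)) \<le> \<epsilon> / 2 * norm v" using Gv by simp
      \<comment> \<open>Three errors: that of the new move from its actual starting point, that of
        evaluating X at \<open>G v\<close> instead of x0, and the inherited one.\<close>
      moreover have "W (r b v) (G v) - x0 - (\<Sum>b\<in>insert b F. r b v *\<^sub>R b)
        = (W (r b v) (G v) - G v - r b v *\<^sub>R X (G v)) + r b v *\<^sub>R (X (G v) - b)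
          + (G v - x0 - (\<Sum>b\<in>F. r b v *\<^sub>R b))"
        using insert.hyps by (simp add: algebra_simps)
      ultimately have "norm (W (r b v) (G v) - x0 - (\<Sum>b\<in>insert b F. r b v *\<^sub>R b))
        \<le> \<epsilon>1 * (A * norm v) + (A * norm v) * \<epsilon>1 + \<epsilon> / 2 * norm v"
        by (simp only:) (intro norm_triangle_mono)
      also have "\<dots> = (\<epsilon>1 * A + \<epsilon>1 * A + \<epsilon> / 2) * norm v" by (simp add: algebra_simps)
      also have "\<dots> \<le> \<epsilon> * norm v"
      proof (rule mult_right_mono)
        show "\<epsilon>1 * A + \<epsilon>1 * A + \<epsilon> / 2 \<le> \<epsilon>" using \<epsilon>1(2) by linarith
      qed simp
      finally show "norm (W (r b v) (G v) - x0 - (\<Sum>b\<in>insert b F. r b v *\<^sub>R b)) \<le> \<epsilon> * norm v" .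
      have "reach f L B (\<epsilon> / 2 + \<epsilon>1) x0 (W (r b v) (G v))"
        by (rule reach_trans[OF conjunct2[OF Gv] conjunct2[OF Wv]])
      then show "reach f L B \<epsilon> x0 (W (r b v) (G v))" by (rule reach_mono) (use \<epsilon>1(3) insert.prems(2) in simp)
    qed
  qed
  \<comment> \<open>The factor 1/2 leaves room for Brouwer: for z within \<open>\<rho> / 2\<close>
    of x0, the map taking v to \<open>z + (v - G v)\<close> sends the ball of radius \<rho> into
    itself, and a fixed point solves \<open>G v = z\<close>.\<close>
  define \<epsilon> where "\<epsilon> = min \<delta> (1/2)"
  have \<epsilon>: "\<epsilon> > 0" "\<epsilon> \<le> \<delta>" "\<epsilon> \<le> 1/2" using \<delta> by (auto simp: \<epsilon>_def)
  obtain \<rho> G where \<rho>: "\<rho> > 0" and G: "continuous_on (cball 0 \<rho>) G"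
    "\<And>v. v \<in> cball 0 \<rho> \<Longrightarrow> norm (G v - x0 - v) \<le> \<epsilon> * norm v" "\<And>v. v \<in> cball 0 \<rho> \<Longrightarrow> reach f L B \<epsilon> x0 (G v)"
    using main[OF finE subset_refl \<epsilon>(1)] unfolding r_sum by blast
  have "\<exists>v\<in>cball 0 \<rho>. G v = y" if y: "y \<in> cball x0 (\<rho> / 2)" for y
  proof (rule brouwer_surjective[OF compact_cball convex_cball _ G(1), of "cball x0 (\<rho> / 2)"])
    fix z v assume z: "z \<in> cball x0 (\<rho> / 2)" and v: "v \<in> cball (0::real^'d) \<rho>"
    have "norm (G v - x0 - v) \<le> 1/2 * \<rho>"
    proof -
      have "\<epsilon> * norm v \<le> 1/2 * \<rho>" using \<epsilon> v by (intro mult_mono) auto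
      then show ?thesis using G(2)[OF v] by linarith
    qed
    moreover have "norm (z - x0) \<le> \<rho> / 2" using z by (simp add: dist_norm norm_minus_commute)
    moreover have "z + (v - G v) = (z - x0) - (G v - x0 - v)" by simp
    then have "norm (z + (v - G v)) \<le> norm (z - x0) + norm (G v - x0 - v)"
      by (metis norm_triangle_ineq4)
    ultimately have "norm (z + (v - G v)) \<le> \<rho>" by linarith
    then show "z + (v - G v) \<in> cball 0 \<rho>" by simp
  qed (use \<rho> y in auto)
  then have "reach f L B \<delta> x0 y" if "y \<in> cball x0 (\<rho> / 2)" for y
    using that G(3) reach_mono[OF _ \<epsilon>(2)] by blast
  then show ?thesis using \<rho> by (intro exI[of _ "\<rho> / 2"]) auto
qed

end

subsection \<open>Recurrence of cheap curves\<close>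

context lagrangian_system
begin

section \<open>Connections on the torus in bounded time\<close>

lemma f_periodic: "periodic_on_torus (f i)"
  using tame by (simp add: tame_field_def)

text \<open>The curves that compete in \<open>actionA\<close>, with finite action. Only the end
  point is taken modulo integers; by periodicity both ends may be shifted, see
  \<open>tconn_translate\<close>.\<close>

definition tconn :: "real \<Rightarrow> real^'d \<Rightarrow> real^'d \<Rightarrow> real \<Rightarrow> bool" where
  "tconn t x y a \<longleftrightarrow> (\<exists>k. int_vec k \<and> conn f L t x (y + k) a)"

lemma conn_imp_tconn: "conn f L t x y a \<Longrightarrow> tconn t x y a"
  unfolding tconn_def by (rule exI[of _ 0]) (simp add: int_vec_0)

lemma tconn_trans:
  assumes "tconn s x y a" "tconn t y z b" shows "tconn (s + t) x z (a + b)"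
proof -
  obtain k l where k: "int_vec k" "conn f L s x (y + k) a" and l: "int_vec l" "conn f L t y (z + l) b"
    using assms by (auto simp: tconn_def)
  have "conn f L t (y + k) (z + l + k) b"
    by (rule conn_translate[OF f_periodic L_periodic k(1) l(2)])
  then have "conn f L (s + t) x (z + (l + k)) (a + b)"
    using conn_trans[OF k(2)] by (simp add: add.assoc)
  then show ?thesis using int_vec_add[OF l(1) k(1)] by (auto simp: tconn_def)
qed

lemma tconn_translate:
  assumes "tconn t x y a" "int_vec k" "int_vec l" shows "tconn t (x + k) (y + l) a"
proof -
  obtain j where j: "int_vec j" "conn f L t x (y + j) a" using assms(1) by (auto simp: tconn_def)
  have "conn f L t (x + k) (y + l + (j + k + - l)) a"
    using conn_translate[OF f_periodic L_periodic assms(2) j(2)] by (simp add: algebra_simps)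
  then show ?thesis
    using int_vec_add[OF int_vec_add[OF j(1) assms(2)] int_vec_uminus[OF assms(3)]] unfolding tconn_def by blast
qed

lemma tconn_lower_bound: "tconn t x y a \<Longrightarrow> - K * t \<le> a"
  using conn_lower_bound[OF _ L_lower] by (auto simp: tconn_def)

lemma tconn_repeat:
  assumes "tconn t x x a" shows "tconn (real (Suc n) * t) x x (real (Suc n) * a)"
proof (induction n)
  case (Suc n)
  have "tconn (real (Suc n) * t + t) x x (real (Suc n) * a + a)" by (rule tconn_trans[OF Suc assms])
  then show ?case by (simp add: algebra_simps)
qed (simp add: assms)

lemma reach_imp_tconn: "reach f L B t x y \<Longrightarrow> \<exists>a\<le>B * t. tconn t x y a"
  using conn_imp_tconn by (auto simp: reach_def)

text \<open>The set reached from x is open by local controllability, its complement is open because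
  \<open>reach\<close> is symmetric, and the covering space is connected.\<close>

lemma reach_connected: "\<exists>t. reach f L B t x y"
proof -
  define U where "U = {y. \<exists>t. reach f L B t x y}"
  have loc: "\<exists>\<rho>>0. \<forall>z\<in>ball y \<rho>. reach f L B 1 y z" for y
    using local_controllability[of 1 y] ball_subset_cball by (meson subset_iff zero_less_one)
  have "open U"
    unfolding open_contains_ball
  proof
    fix y assume "y \<in> U"
    then obtain t where t: "reach f L B t x y" by (auto simp: U_def)
    obtain \<rho> where "\<rho> > 0" "\<And>z. z \<in> ball y \<rho> \<Longrightarrow> reach f L B 1 y z" using loc by blast
    then have "ball y \<rho> \<subseteq> U" using reach_trans[OF t] unfolding U_def by blast
    then show "\<exists>e>0. ball y e \<subseteq> U" using \<open>\<rho> > 0\<close> by blast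
  qed
  moreover have "open (- U)"
    unfolding open_contains_ball
  proof
    fix y assume y: "y \<in> - U"
    obtain \<rho> where \<rho>: "\<rho> > 0" "\<And>z. z \<in> ball y \<rho> \<Longrightarrow> reach f L B 1 y z" using loc by blast
    have "z \<notin> U" if "z \<in> ball y \<rho>" for z
    proof
      assume "z \<in> U"
      then obtain t where "reach f L B t x z" by (auto simp: U_def)
      from reach_trans[OF this reach_sym[OF \<rho>(2)[OF that]]] y show False by (auto simp: U_def)
    qed
    then show "\<exists>e>0. ball y e \<subseteq> - U" using \<rho>(1) by blast
  qed
  ultimately have "U = {} \<or> U = UNIV"
    using clopen[of U] by (simp add: closed_def)
  moreover have "x \<in> U" using reach_refl[of 0 x] by (auto simp: U_def)
  ultimately show ?thesis by (auto simp: U_def)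
qed

text \<open>Compactness of the unit cell gives a net that is fine in travel time rather than in
  Euclidean distance. Its nodes later serve as the pigeonholes for position.\<close>

lemma finite_reach_net:
  assumes "\<delta> > 0"
  obtains Z where "finite Z" "\<And>x. x \<in> cbox 0 1 \<Longrightarrow> \<exists>z\<in>Z. reach f L B \<delta> z x"
proof -
  have "\<forall>z. \<exists>\<rho>>0. \<forall>y\<in>cball z \<rho>. reach f L B \<delta> z y" using local_controllability[OF assms] by blast
  then obtain \<rho> where \<rho>: "\<And>z. \<rho> z > 0" "\<And>z y. y \<in> cball z (\<rho> z) \<Longrightarrow> reach f L B \<delta> z y" by metis
  have cover: "cbox 0 1 \<subseteq> (\<Union>z\<in>cbox 0 1. ball z (\<rho> z))"
    using \<rho>(1) by (auto intro: centre_in_ball[THEN iffD2])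
  obtain Z where Z: "Z \<subseteq> cbox 0 1" "finite Z" "cbox (0::real^'d) 1 \<subseteq> (\<Union>z\<in>Z. ball z (\<rho> z))"
    by (rule compactE_image[OF compact_cbox open_ball cover])
  have "\<exists>z\<in>Z. reach f L B \<delta> z x" if x: "x \<in> cbox 0 1" for x
  proof -
    obtain z where "z \<in> Z" "x \<in> ball z (\<rho> z)" using Z(3) x by blast
    then show ?thesis using \<rho>(2)[of x z] by auto
  qed
  then show ?thesis using that Z(2) by blast
qed

text \<open>Every point of the cell is joined to 0 through one of finitely many nodes; waiting makes
  all these times equal, and going through 0 joins any two points.\<close>

lemma uniform_tconn:
  obtains T0 C where "T0 \<ge> 0" "\<And>x y. \<exists>a\<le>C. tconn T0 x y a"
proof -
  obtain Z where Z: "finite Z" "\<And>x. x \<in> cbox 0 1 \<Longrightarrow> \<exists>z\<in>Z. reach f L B 1 z x"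
    using finite_reach_net[of 1] by auto
  obtain \<tau> where \<tau>: "\<And>z. reach f L B (\<tau> z) 0 z" using reach_connected by metis
  have \<tau>0: "\<tau> z \<ge> 0" for z using \<tau>[of z] by (auto simp: reach_def dest: conn_nonneg)
  define T1 where "T1 = (\<Sum>z\<in>Z. \<tau> z)"
  have T1: "T1 \<ge> 0" "z \<in> Z \<Longrightarrow> \<tau> z \<le> T1" for z
    unfolding T1_def using \<tau>0 Z(1) by (auto intro: sum_nonneg member_le_sum)
  have cell: "reach f L B (T1 + 1) 0 x" if "x \<in> cbox 0 1" for x
    using Z(2)[OF that] T1(2) \<tau> by (meson reach_mono reach_trans)
  show ?thesis
  proof (rule that[of "(T1 + 1) + (T1 + 1)" "B * ((T1 + 1) + (T1 + 1))"])
    fix x y :: "real^'d"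
    obtain k where k: "int_vec k" "x + k \<in> cbox 0 1" by (rule unit_cell_representative)
    obtain l where l: "int_vec l" "y + l \<in> cbox 0 1" by (rule unit_cell_representative)
    obtain a where a: "a \<le> B * ((T1 + 1) + (T1 + 1))" "tconn ((T1 + 1) + (T1 + 1)) (x + k) (y + l) a"
      using reach_imp_tconn[OF reach_trans[OF reach_sym[OF cell[OF k(2)]] cell[OF l(2)]]] by blast
    have "tconn ((T1 + 1) + (T1 + 1)) (x + k + - k) (y + l + - l) a"
      by (intro tconn_translate a int_vec_uminus k l)
    then show "\<exists>a\<le>B * ((T1 + 1) + (T1 + 1)). tconn ((T1 + 1) + (T1 + 1)) x y a" using a(1) by auto
  qed (use T1 in simp)
qed

lemma conn_split_many:
  assumes "conn f L (real q * T + r) x z a" "0 \<le> T" "0 \<le> r"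
  shows "\<exists>y b. y 0 = x \<and> (\<forall>i<q. conn f L T (y i) (y (Suc i)) (b i)) \<and> conn f L r (y q) z (b q) \<and>
    a = (\<Sum>i\<le>q. b i)"
  using assms(1)
proof (induction q arbitrary: x a)
  case 0
  then show ?case by (intro exI[of _ "\<lambda>_. x"] exI[of _ "\<lambda>_. a"]) auto
next
  case (Suc q)
  have "conn f L (T + (real q * T + r)) x z a" using Suc.prems by (simp add: algebra_simps)
  moreover have "0 \<le> real q * T + r" using assms(2,3) by simp
  ultimately obtain w b0 a' where w: "conn f L T x w b0" "conn f L (real q * T + r) w z a'" "a = b0 + a'"
    using conn_split[OF _ assms(2)] by blast
  obtain y b where y: "y 0 = w" "\<forall>i<q. conn f L T (y i) (y (Suc i)) (b i)" "conn f L r (y q) z (b q)"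
    "a' = (\<Sum>i\<le>q. b i)" using Suc.IH[OF w(2)] by blast
  define y' where "y' = case_nat x y"
  define b' where "b' = case_nat b0 b"
  have "conn f L T (y' i) (y' (Suc i)) (b' i)" if "i < Suc q" for i
    using that w(1) y by (cases i) (auto simp: y'_def b'_def)
  moreover have "(\<Sum>i\<le>Suc q. b' i) = a"
    unfolding sum.atMost_Suc_shift using w(3) y(4) by (simp add: b'_def)
  ultimately show ?case
    using y(3) by (intro exI[of _ y'] exI[of _ b']) (auto simp: y'_def b'_def)
qed

section \<open>The mean cost of closed curves\<close>

definition mean_cost :: real where
  "mean_cost = Inf {a / t | a t x. t > 0 \<and> tconn t x x a}"

lemma tconn_const: "t \<ge> 0 \<Longrightarrow> \<exists>a\<le>B * t. tconn t x x a"
  using reach_imp_tconn[OF reach_refl] .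

lemma loop_cost:
  assumes "tconn t x x a" "t > 0" shows "mean_cost * t \<le> a"
proof -
  have "bdd_below {a / t | a t x. t > 0 \<and> tconn t x x a}"
  proof (rule bdd_belowI[of _ "- K"])
    fix q assume "q \<in> {a / t | a t x. t > 0 \<and> tconn t x x a}"
    then obtain a t x where "q = a / t" "t > 0" "tconn t x x a" by blast
    then show "- K \<le> q" using tconn_lower_bound[of t x x a] by (simp add: pos_le_divide_eq)
  qed
  then have "mean_cost \<le> a / t"
    unfolding mean_cost_def using assms by (intro cInf_lower) auto
  then show ?thesis using assms(2) by (simp add: pos_le_divide_eq)
qed

lemma cheap_loop:
  assumes "\<epsilon> > 0" obtains t x a where "t > 0" "tconn t x x a" "a \<le> (mean_cost + \<epsilon>) * t"
proof -
  obtain a where "tconn 1 0 0 a" using tconn_const[of 1 0] by auto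
  then have "a / 1 \<in> {a / t | a t x. t > 0 \<and> tconn t x x a}"
    by (intro CollectI exI[of _ a] exI[of _ 1] exI[of _ 0]) auto
  then have ne: "{a / t | a t x. t > 0 \<and> tconn t x x a} \<noteq> {}" by blast
  have "Inf {a / t | a t x. t > 0 \<and> tconn t x x a} < mean_cost + \<epsilon>"
    unfolding mean_cost_def[symmetric] using assms by simp
  from cInf_lessD[OF ne this]
  obtain a t x where "a / t < mean_cost + \<epsilon>" "t > 0" "tconn t x x a" by blast
  then show ?thesis using that by (simp add: pos_divide_less_eq less_imp_le)
qed

text \<open>Closing the curve up through 0 costs a bounded time and a bounded action, and
  \<open>loop_cost\<close> applies to the resulting loop.\<close>

lemma conn_cost_lower:
  obtains C where "C \<ge> 0" "\<And>t x y a. conn f L t x y a \<Longrightarrow> mean_cost * t - C \<le> a"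
proof -
  obtain T0 C where T0: "T0 \<ge> 0" "\<And>x y. \<exists>a\<le>C. tconn T0 x y a" using uniform_tconn by metis
  \<comment> \<open>A unit of waiting at 0 is inserted so that the loop has positive length even
    when t and T0 are 0.\<close>
  obtain a1 where a1: "a1 \<le> B * 1" "tconn 1 0 0 a1" using tconn_const[of 1 0] by auto
  define D where "D = \<bar>C\<bar> + \<bar>C\<bar> + B + \<bar>mean_cost\<bar> * (T0 + 1 + T0)"
  have "mean_cost * t - D \<le> a" if c: "conn f L t x y a" for t x y a
  proof -
    have t: "t \<ge> 0" using c by (rule conn_nonneg)
    obtain b where b: "b \<le> C" "tconn T0 y 0 b" using T0(2) by blast
    obtain d where d: "d \<le> C" "tconn T0 0 x d" using T0(2) by blast
    have "tconn (t + (T0 + (1 + T0))) x x (a + (b + (a1 + d)))"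
      by (intro tconn_trans[OF conn_imp_tconn[OF c]] tconn_trans[OF b(2)] tconn_trans[OF a1(2)] d(2))
    then have "mean_cost * (t + (T0 + (1 + T0))) \<le> a + (b + (a1 + d))"
      using t T0(1) by (intro loop_cost) auto
    moreover have "- (\<bar>mean_cost\<bar> * (T0 + 1 + T0)) \<le> mean_cost * (T0 + (1 + T0))"
      using T0(1) by (simp add: abs_if mult_nonneg_nonneg mult_nonpos_nonneg add_nonneg_nonneg algebra_simps)
    ultimately show ?thesis using b(1) d(1) a1(1) unfolding D_def distrib_left[of _ t] by linarith
  qed
  moreover have "D \<ge> 0" using B_nonneg T0(1) by (auto simp: D_def intro!: add_nonneg_nonneg mult_nonneg_nonneg)
  ultimately show ?thesis using that by blast
qed

text \<open>Cut many rounds of a cheap loop into pieces of length \<open>T\<close>; some piece is no dearer than the average.\<close>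
lemma cheap_curve:
  assumes T: "T > 0" obtains x y a where "conn f L T x y a" "a \<le> mean_cost * T + 1"
proof (rule ccontr)
  assume "\<not> thesis"
  then have dear: "mean_cost * T + 1 < a" if "conn f L T x y a" for x y a
    using that \<open>\<And>x y a. conn f L T x y a \<Longrightarrow> a \<le> mean_cost * T + 1 \<Longrightarrow> thesis\<close> by force
  \<comment> \<open>If every piece of length T exceeded the mean by more than 1, q pieces would
    exceed it by more than q, whereas the loop allows only about
    \<open>\<epsilon> * (q * T)\<close>, that is q/2.\<close>
  define \<epsilon> where "\<epsilon> = 1 / (2 * T)"
  have \<epsilon>: "\<epsilon> > 0" "\<epsilon> * T = 1/2" using T by (auto simp: \<epsilon>_def)
  obtain t x a where loop: "t > 0" "tconn t x x a" "a \<le> (mean_cost + \<epsilon>) * t"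
    using cheap_loop[OF \<epsilon>(1)] by blast
  \<comment> \<open>M absorbs what the incomplete last piece of length r can contribute on either
    side; n is then taken so large that \<open>q > 2 * M\<close>.\<close>
  define M where "M = \<bar>mean_cost + \<epsilon>\<bar> * T + \<bar>K\<bar> * T"
  obtain n :: nat where n: "real n * t > (2 * M + 2) * T" using reals_Archimedean3[OF loop(1)] by blast
  define S where "S = real (Suc n) * t"
  define q where "q = nat \<lfloor>S / T\<rfloor>"
  define r where "r = S - real q * T"
  have S: "S > 0" using loop(1) by (simp add: S_def)
  then have "S / T \<ge> 0" using T by simp
  then have "real q \<le> S / T" "S / T < real q + 1" by (auto simp: q_def)
  then have q: "real q * T \<le> S" "S < (real q + 1) * T" using T by (simp_all add: field_simps)
  then have r: "0 \<le> r" "r \<le> T" by (auto simp: r_def distrib_right)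
  have M: "M \<ge> 0" using T by (auto simp: M_def intro!: add_nonneg_nonneg)
  have big: "real q > 2 * M"
  proof -
    have "(2 * M + 2) * T < (real q + 1) * T" using n q(2) loop(1) by (simp add: S_def distrib_right)
    then show ?thesis using T by simp
  qed
  obtain k where k: "conn f L (real q * T + r) x (x + k) (real (Suc n) * a)"
    using tconn_repeat[OF loop(2), of n] by (auto simp: tconn_def r_def S_def)
  obtain y b where y: "\<forall>i<q. conn f L T (y i) (y (Suc i)) (b i)" "conn f L r (y q) (x + k) (b q)"
    "real (Suc n) * a = (\<Sum>i\<le>q. b i)"
    using conn_split_many[OF k] T r by auto
  have "real q * (mean_cost * T + 1) \<le> (\<Sum>i<q. b i)"
    using sum_bounded_below[of "{..<q}" "mean_cost * T + 1" b] dear y(1) by (force simp: less_imp_le)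
  moreover have "- (\<bar>K\<bar> * T) \<le> b q"
  proof -
    have "K * r \<le> \<bar>K\<bar> * T" using r by (intro mult_mono) auto
    then show ?thesis using conn_lower_bound[OF y(2) L_lower] by simp
  qed
  moreover have "(\<Sum>i\<le>q. b i) = (\<Sum>i<q. b i) + b q" by (simp add: lessThan_Suc_atMost[symmetric])
  moreover have "real (Suc n) * a \<le> (mean_cost + \<epsilon>) * (real q * T + r)"
  proof -
    have "real (Suc n) * a \<le> real (Suc n) * ((mean_cost + \<epsilon>) * t)" using loop(3) by (intro mult_left_mono) auto
    also have "\<dots> = (mean_cost + \<epsilon>) * (real q * T + r)" by (simp add: r_def S_def)
    finally show ?thesis .
  qed
  moreover have "(mean_cost + \<epsilon>) * (real q * T + r) \<le> real q * (mean_cost * T + 1/2) + \<bar>mean_cost + \<epsilon>\<bar> * T"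
  proof -
    have "(mean_cost + \<epsilon>) * r \<le> \<bar>mean_cost + \<epsilon>\<bar> * T" using r by (intro mult_mono) auto
    moreover have "(mean_cost + \<epsilon>) * (real q * T) = real q * (mean_cost * T + \<epsilon> * T)" by (simp add: algebra_simps)
    ultimately show ?thesis unfolding \<epsilon>(2) distrib_left[of "mean_cost + \<epsilon>"] by linarith
  qed
  ultimately have "real q * (1/2) \<le> M"
    using y(3) unfolding M_def distrib_left[of "real q"] by linarith
  then show False using big by simp
qed

lemma conn_chain:
  assumes "\<And>i. i < n \<Longrightarrow> conn f L T (y i) (y (Suc i)) (b i)" "i < j" "j \<le> n"
  shows "conn f L (real (j - i) * T) (y i) (y j) (\<Sum>l\<in>{i..<j}. b l)"
  using assms(2,3)
proof (induction j)
  case (Suc j)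
  show ?case
  proof (cases "i = j")
    case True
    then show ?thesis using assms(1)[of j] Suc.prems by simp
  next
    case False
    then have "i < j" "j \<le> n" "j < n" using Suc.prems by auto
    then have "conn f L (real (j - i) * T + T) (y i) (y (Suc j)) ((\<Sum>l\<in>{i..<j}. b l) + b j)"
      by (intro conn_trans[OF Suc.IH assms(1)])
    moreover have "real (Suc j - i) * T = real (j - i) * T + T"
      using False Suc.prems by (simp add: Suc_diff_le distrib_right)
    ultimately show ?thesis using False Suc.prems by simp
  qed
qed simp

lemma near_optimal_loop:
  assumes \<epsilon>: "\<epsilon> > 0" and \<tau>: "\<tau> > 0"
  obtains t x a where "t \<ge> \<tau>" "tconn t x x a" "a \<le> mean_cost * t + \<epsilon>"
proof -
  obtain C where C: "C \<ge> 0" "\<And>t x y a. conn f L t x y a \<Longrightarrow> mean_cost * t - C \<le> a"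
    using conn_cost_lower by metis
  \<comment> \<open>Closing the piece takes time \<open>\<delta> + \<delta>\<close> at price at most
    B, an excess of \<open>2 * (B - mean_cost) * \<delta>\<close>, which is at most
    \<open>\<epsilon> / 2\<close>.\<close>
  define \<delta> where "\<delta> = \<epsilon> / (4 * (B + \<bar>mean_cost\<bar> + 1))"
  have den: "B + \<bar>mean_cost\<bar> + 1 > 0" using B_nonneg by simp
  have \<delta>: "\<delta> > 0" using den \<epsilon> by (simp add: \<delta>_def)
  have "(B + \<bar>mean_cost\<bar> + 1) * \<delta> = \<epsilon> / 4" using den by (simp add: \<delta>_def field_simps)
  moreover have "(B - mean_cost) * \<delta> \<le> (B + \<bar>mean_cost\<bar> + 1) * \<delta>" using \<delta> by (intro mult_right_mono) auto
  ultimately have \<delta>B: "(B - mean_cost) * \<delta> \<le> \<epsilon> / 4" by simp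
  obtain Z where Z: "finite Z" "\<And>x. x \<in> cbox 0 1 \<Longrightarrow> \<exists>z\<in>Z. reach f L B \<delta> z x"
    using finite_reach_net[OF \<delta>] by metis
  have "\<exists>k z. int_vec k \<and> z \<in> Z \<and> reach f L B \<delta> z (x + k)" for x
    using unit_cell_representative[of x] Z(2) by metis
  then obtain k z where kz: "\<And>x. int_vec (k x)" "\<And>x. z x \<in> Z" "\<And>x. reach f L B \<delta> (z x) (x + k x)" by metis
  \<comment> \<open>Indices of the boxes of width \<open>\<epsilon> / 2\<close> that meet the
    interval from - C to 1 + C, to which the accumulated excess is confined.\<close>
  define I where "I = {\<lfloor>- C / (\<epsilon> / 2)\<rfloor>..\<lfloor>(1 + C) / (\<epsilon> / 2)\<rfloor>}"
  define N where "N = Suc (card (Z \<times> I))"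
  have N: "N > 0" by (simp add: N_def)
  obtain x y a where "conn f L (real N * \<tau>) x y a" and a: "a \<le> mean_cost * (real N * \<tau>) + 1"
    using cheap_curve[of "real N * \<tau>"] N \<tau> by auto
  then have "conn f L (real (N - 1) * \<tau> + \<tau>) x y a" using N by (simp add: of_nat_diff algebra_simps)
  from conn_split_many[OF this] \<tau> obtain w b where w: "w 0 = x"
    "\<forall>i<N - 1. conn f L \<tau> (w i) (w (Suc i)) (b i)" "conn f L \<tau> (w (N - 1)) y (b (N - 1))" "a = (\<Sum>i\<le>N - 1. b i)"
    by (auto simp: less_imp_le)
  \<comment> \<open>The split yields N - 1 pieces and a last one, here also of length \<tau>; v adds
    the end point y, so there are N + 1 samples for fewer than N pairs of node and box.\<close>
  define v where "v = (\<lambda>i. if i < N then w i else y)"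
  have v: "conn f L \<tau> (v i) (v (Suc i)) (b i)" if "i < N" for i
    using that w by (cases "i = N - 1") (auto simp: v_def)
  have sum: "a = (\<Sum>i<N. b i)" using w(4) N by (simp add: lessThan_Suc_atMost[symmetric])
  define e where "e = (\<lambda>i. (\<Sum>l<i. b l) - mean_cost * (real i * \<tau>))"
  have e_diff: "e j - e i = (\<Sum>l\<in>{i..<j}. b l) - mean_cost * (real (j - i) * \<tau>)" if "i \<le> j" for i j
  proof -
    have "(\<Sum>l<j. b l) = (\<Sum>l<i. b l) + (\<Sum>l\<in>{i..<j}. b l)"
      using that by (simp add: lessThan_atLeast0 sum.atLeastLessThan_concat)
    then show ?thesis using that by (simp add: e_def of_nat_diff algebra_simps)
  qed
  have e_lower: "e j - e i \<ge> - C" if "i \<le> j" "j \<le> N" for i j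
  proof (cases "i = j")
    case False
    then show ?thesis using C(2)[OF conn_chain[of N \<tau> v b i j, OF v]] that e_diff[of i j] by simp
  qed (use C(1) in simp)
  have e0: "e 0 = 0" and eN: "e N \<le> 1" using a by (auto simp: e_def sum)
  have "\<lfloor>e i / (\<epsilon> / 2)\<rfloor> \<in> I" if "i \<le> N" for i
  proof -
    \<comment> \<open>From below the initial piece is estimated, from above the final one: it has
      excess at least - C, while the whole curve has excess at most 1.\<close>
    have "- C \<le> e i" "e i \<le> 1 + C" using e_lower[of 0 i] e_lower[of i N] that e0 eN by auto
    then show ?thesis unfolding I_def 
      unfolding atLeastAtMost_iff using \<epsilon> by (intro conjI floor_mono divide_right_mono) auto
  qed
  then have sub: "(\<lambda>i. (z (v i), \<lfloor>e i / (\<epsilon> / 2)\<rfloor>)) ` {..N} \<subseteq> Z \<times> I" using kz(2) by auto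
  have "card ((\<lambda>i. (z (v i), \<lfloor>e i / (\<epsilon> / 2)\<rfloor>)) ` {..N}) \<le> card (Z \<times> I)"
    by (rule card_mono[OF _ sub]) (simp add: Z(1) I_def)
  also have "\<dots> < card {..N}" by (simp add: N_def)
  finally have "\<not> inj_on (\<lambda>i. (z (v i), \<lfloor>e i / (\<epsilon> / 2)\<rfloor>)) {..N}" by (rule pigeonhole)
  then have "\<exists>i j. i < j \<and> j \<le> N \<and> z (v i) = z (v j) \<and> \<lfloor>e i / (\<epsilon> / 2)\<rfloor> = \<lfloor>e j / (\<epsilon> / 2)\<rfloor>"
    unfolding inj_on_def by (auto; metis linorder_neqE_nat)
  then obtain i j where ij: "i < j" "j \<le> N" "z (v i) = z (v j)" "\<lfloor>e i / (\<epsilon> / 2)\<rfloor> = \<lfloor>e j / (\<epsilon> / 2)\<rfloor>"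
    by blast
  have "\<bar>e j / (\<epsilon> / 2) - e i / (\<epsilon> / 2)\<bar> < 1" using ij(4) by linarith
  then have ediff: "e j - e i \<le> \<epsilon> / 2" using \<epsilon> by (simp add: field_simps abs_if split: if_splits)
  \<comment> \<open>Both samples, moved into the cell, are within travel time \<delta> of the same
    node, so the piece is closed through that node.\<close>
  have "reach f L B \<delta> (z (v j)) (v i + k (v i))" using kz(3)[of "v i"] ij(3) by simp
  note reach_trans[OF reach_sym[OF kz(3)[of "v j"]] this]
  then obtain a' where a': "a' \<le> B * (\<delta> + \<delta>)" "tconn (\<delta> + \<delta>) (v j + k (v j)) (v i + k (v i)) a'"
    using reach_imp_tconn by blast
  have "tconn (\<delta> + \<delta>) (v j + k (v j) + - k (v j)) (v i + k (v i) + - k (v i)) a'"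
    by (intro tconn_translate a' int_vec_uminus kz(1))
  then have closing: "tconn (\<delta> + \<delta>) (v j) (v i) a'" by simp
  have forth: "tconn (real (j - i) * \<tau>) (v i) (v j) (\<Sum>l\<in>{i..<j}. b l)"
    by (rule conn_imp_tconn[OF conn_chain[of N \<tau> v b, OF v ij(1,2)]])
  show ?thesis
  proof (rule that[OF _ tconn_trans[OF forth closing]])
    have "1 * \<tau> \<le> real (j - i) * \<tau>" using ij(1) \<tau> by (intro mult_right_mono) auto
    then show "\<tau> \<le> real (j - i) * \<tau> + (\<delta> + \<delta>)" using \<delta> by simp
    have "(\<Sum>l\<in>{i..<j}. b l) \<le> mean_cost * (real (j - i) * \<tau>) + \<epsilon> / 2"
      using ediff e_diff[of i j] ij(1) by simp
    then show "(\<Sum>l\<in>{i..<j}. b l) + a' \<le> mean_cost * (real (j - i) * \<tau> + (\<delta> + \<delta>)) + \<epsilon>"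
      using a'(1) \<delta>B by (simp add: algebra_simps)
  qed
qed

text \<open>The loops of \<open>near_optimal_loop\<close> have varying base points, but one point
  must serve all \<epsilon> and \<tau>. At a limit of base points, local controllability moves a
  long, nearly optimal loop to the limit for an excess of at most
  \<open>\<epsilon> / 2\<close>.\<close>

lemma recurrent_point:
  obtains x where "\<And>\<epsilon> \<tau>. \<epsilon> > 0 \<Longrightarrow> \<exists>t a. t \<ge> \<tau> \<and> tconn t x x a \<and> a \<le> mean_cost * t + \<epsilon>"
proof -
  have "\<exists>x t a. x \<in> cbox 0 1 \<and> t \<ge> real (Suc n) \<and> tconn t x x a \<and> a \<le> mean_cost * t + 1 / real (Suc n)" for n
  proof -
    obtain t x a where 1: "t \<ge> real (Suc n)" "tconn t x x a" "a \<le> mean_cost * t + 1 / real (Suc n)"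
      using near_optimal_loop[of "1 / real (Suc n)" "real (Suc n)"] by auto
    obtain k where k: "int_vec k" "x + k \<in> cbox 0 1" by (rule unit_cell_representative)
    show ?thesis using 1 k tconn_translate[OF 1(2) k(1) k(1)] by blast
  qed
  then obtain x t a where xta: "\<And>n. x n \<in> cbox 0 1" "\<And>n. t n \<ge> real (Suc n)"
    "\<And>n. tconn (t n) (x n) (x n) (a n)" "\<And>n. a n \<le> mean_cost * t n + 1 / real (Suc n)" by metis
  have "seq_compact (cbox (0::real^'d) 1)" by (simp add: compact_imp_seq_compact)
  then obtain l r where r: "strict_mono r" "(x \<circ> r) \<longlonglongrightarrow> l"
    unfolding seq_compact_def using xta(1) by metis
  show ?thesis
  proof (rule that[of l])
    fix \<epsilon> \<tau> :: real assume \<epsilon>: "\<epsilon> > 0"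
    define \<delta> where "\<delta> = \<epsilon> / (4 * (B + \<bar>mean_cost\<bar> + 1))"
    have den: "B + \<bar>mean_cost\<bar> + 1 > 0" using B_nonneg by simp
    have \<delta>: "\<delta> > 0" using den \<epsilon> by (simp add: \<delta>_def)
    have "(B + \<bar>mean_cost\<bar> + 1) * \<delta> = \<epsilon> / 4" using den by (simp add: \<delta>_def field_simps)
    moreover have "(B - mean_cost) * \<delta> \<le> (B + \<bar>mean_cost\<bar> + 1) * \<delta>" using \<delta> by (intro mult_right_mono) auto
    ultimately have \<delta>B: "(B - mean_cost) * \<delta> \<le> \<epsilon> / 4" by simp
    obtain \<rho> where \<rho>: "\<rho> > 0" "\<And>y. y \<in> cball l \<rho> \<Longrightarrow> reach f L B \<delta> l y"
      using local_controllability[OF \<delta>] by blast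
    have "eventually (\<lambda>n. dist (x (r n)) l < \<rho>) sequentially" using r(2) \<rho>(1) by (auto simp: tendsto_iff)
    moreover obtain m :: nat where m: "real m > max \<tau> (2 / \<epsilon>)" using reals_Archimedean2 by blast
    ultimately have "eventually (\<lambda>n. dist (x (r n)) l < \<rho> \<and> n \<ge> m) sequentially"
      by (intro eventually_conj eventually_ge_at_top)
    then obtain n where n: "dist (x (r n)) l < \<rho>" "n \<ge> m"
      using eventually_happens[of _ sequentially] by auto
    have rn: "real (Suc (r n)) > max \<tau> (2 / \<epsilon>)" using m n(2) seq_suble[OF r(1), of n] by linarith
    have re: "reach f L B \<delta> l (x (r n))" using \<rho>(2) n(1) by (auto simp: dist_commute)
    obtain a1 where a1: "a1 \<le> B * \<delta>" "tconn \<delta> l (x (r n)) a1" using reach_imp_tconn[OF re] by blast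
    obtain a2 where a2: "a2 \<le> B * \<delta>" "tconn \<delta> (x (r n)) l a2" using reach_imp_tconn[OF reach_sym[OF re]] by blast
    have "tconn (\<delta> + (t (r n) + \<delta>)) l l (a1 + (a (r n) + a2))"
      by (intro tconn_trans[OF a1(2)] tconn_trans[OF xta(3)] a2(2))
    moreover have "\<delta> + (t (r n) + \<delta>) \<ge> \<tau>" using \<delta> xta(2)[of "r n"] rn by linarith
    moreover have "1 / real (Suc (r n)) \<le> \<epsilon> / 2"
    proof -
      have "2 / \<epsilon> < real (Suc (r n))" using rn by simp
      then show ?thesis using \<epsilon> by (simp add: field_simps)
    qed
    then have "a1 + (a (r n) + a2) \<le> mean_cost * (\<delta> + (t (r n) + \<delta>)) + \<epsilon>"
      using a1(1) a2(1) xta(4)[of "r n"] \<delta>B by (simp add: algebra_simps)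
    ultimately show "\<exists>t a. t \<ge> \<tau> \<and> tconn t l l a \<and> a \<le> mean_cost * t + \<epsilon>" by blast
  qed
qed

section \<open>Comparison with the critical value and the Peierls barrier\<close>

lemma actionA_tconn_le:
  assumes "tconn t x y a" shows "actionA f L t x y \<le> ereal a"
proof -
  obtain k \<gamma> u where k: "int_vec k" "admissible f t \<gamma> u" "\<gamma> 0 = x" "\<gamma> t = y + k"
    "has_bochner_integral (lebesgue_on {0..t}) (\<lambda>s. L (\<gamma> s) (u s)) a"
    using assms by (auto simp: tconn_def conn_def)
  have "action L t \<gamma> u = ereal a"
    using integrable.intros[OF k(5)] has_bochner_integral_integral_eq[OF k(5)] by (simp add: action_def)
  moreover have "torus_eq (\<gamma> t) y" using k by (simp add: torus_eq_def)
  ultimately show ?thesis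
    unfolding actionA_def using k by (intro INF_lower2[of "(\<gamma>, u)"]) auto
qed

lemma action_cases:
  assumes "admissible f t \<gamma> u" "t \<ge> 0"
  obtains "action L t \<gamma> u = \<infinity>" | a where "action L t \<gamma> u = ereal a" "conn f L t (\<gamma> 0) (\<gamma> t) a"
proof (cases "integrable (lebesgue_on {0..t}) (\<lambda>s. L (\<gamma> s) (u s))")
  case True
  then show ?thesis
    using that(2) assms has_bochner_integral_integrable[OF True] unfolding action_def conn_def by auto
next
  case False
  then show ?thesis using that(1) by (simp add: action_def)
qed

lemma actionA_loop_ge:
  assumes t: "t > 0" shows "ereal (mean_cost * t) \<le> actionA f L t x x"
  unfolding actionA_def
proof (rule INF_greatest, clarify)
  fix \<gamma> u assume ad: "admissible f t \<gamma> u" and x: "torus_eq (\<gamma> t) (\<gamma> 0)"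
  show "ereal (mean_cost * t) \<le> action L t \<gamma> u"
    using ad less_imp_le[OF t]
  proof (cases rule: action_cases)
    case (2 a)
    then have "tconn t (\<gamma> 0) (\<gamma> 0) a"
      using x by (auto simp: tconn_def torus_eq_def intro!: exI[of _ "\<gamma> t - \<gamma> 0"])
    then show ?thesis using 2 loop_cost t by simp
  qed simp
qed

text \<open>The value at 0 differs from \<open>mean_cost * T\<close> by a bounded amount: from below
  by \<open>conn_cost_lower\<close>, from above by travelling in time T0 to the start of a cheap
  curve of length \<open>T - T0\<close>. Dividing by T gives the limit.\<close>

lemma crit_value_eq: "crit_value f L = mean_cost"
proof -
  obtain C where C: "C \<ge> 0" "\<And>t x y a. conn f L t x y a \<Longrightarrow> mean_cost * t - C \<le> a"
    using conn_cost_lower by metis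
  obtain T0 C' where T0: "T0 \<ge> 0" "\<And>x y. \<exists>a\<le>C'. tconn T0 x y a" using uniform_tconn by metis
  define D where "D = C' - mean_cost * T0 + 1"
  let ?V = "\<lambda>T. valueV f L T 0"
  have lower: "ereal (mean_cost * T - C) \<le> ?V T" if T: "T > T0" for T
    unfolding valueV_def
  proof (rule INF_greatest, clarify)
    fix \<gamma> u assume ad: "admissible f T \<gamma> u"
    have "T \<ge> 0" using T T0 by simp
    from ad this show "ereal (mean_cost * T - C) \<le> action L T \<gamma> u"
    proof (cases rule: action_cases)
      case (2 a)
      then show ?thesis using C(2) by simp
    qed simp
  qed
  have upper: "?V T \<le> ereal (mean_cost * T + D)" if T: "T > T0" for T
  proof -
    obtain x y a where a: "conn f L (T - T0) x y a" "a \<le> mean_cost * (T - T0) + 1"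
      using cheap_curve[of "T - T0"] T by auto
    obtain b where b: "b \<le> C'" "tconn T0 0 x b" using T0(2) by blast
    have "tconn (T0 + (T - T0)) 0 y (b + a)" by (rule tconn_trans[OF b(2) conn_imp_tconn[OF a(1)]])
    then obtain z where "conn f L T 0 z (b + a)" by (auto simp: tconn_def)
    then obtain \<gamma> u where g: "admissible f T \<gamma> u" "\<gamma> 0 = 0"
      "has_bochner_integral (lebesgue_on {0..T}) (\<lambda>s. L (\<gamma> s) (u s)) (b + a)" by (auto simp: conn_def)
    have "action L T \<gamma> u = ereal (b + a)"
      using integrable.intros[OF g(3)] has_bochner_integral_integral_eq[OF g(3)] by (simp add: action_def)
    then have "?V T \<le> ereal (b + a)"
      unfolding valueV_def using g by (intro INF_lower2[of "(\<gamma>, u)"]) auto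
    also have "\<dots> \<le> ereal (mean_cost * T + D)" using a(2) b(1) by (simp add: D_def algebra_simps)
    finally show ?thesis .
  qed
  have bounds: "mean_cost - C / T \<le> real_of_ereal (?V T) / T" "real_of_ereal (?V T) / T \<le> mean_cost + D / T"
    if T: "T > T0" for T
  proof -
    obtain v where v: "?V T = ereal v" using lower[OF T] upper[OF T] by (cases "?V T") auto
    have "T > 0" using T T0 by simp
    then have "(mean_cost * T - C) / T \<le> v / T" "v / T \<le> (mean_cost * T + D) / T"
      using lower[OF T] upper[OF T] by (auto simp: v intro: divide_right_mono)
    then show "mean_cost - C / T \<le> real_of_ereal (?V T) / T" "real_of_ereal (?V T) / T \<le> mean_cost + D / T"
      using \<open>T > 0\<close> by (simp_all add: v diff_divide_distrib add_divide_distrib)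
  qed
  have lim: "((\<lambda>T. mean_cost + E / T) \<longlongrightarrow> mean_cost + 0) at_top" for E :: real
    by (intro tendsto_add tendsto_const tendsto_divide_0[OF tendsto_const] filterlim_at_top_imp_at_infinity filterlim_ident)
  have "((\<lambda>T. real_of_ereal (?V T) / T) \<longlongrightarrow> mean_cost) at_top"
  proof (rule tendsto_sandwich)
    show "eventually (\<lambda>T. mean_cost + - C / T \<le> real_of_ereal (?V T) / T) at_top"
      using eventually_gt_at_top[of T0] by eventually_elim (use bounds in simp)
    show "eventually (\<lambda>T. real_of_ereal (?V T) / T \<le> mean_cost + D / T) at_top"
      using eventually_gt_at_top[of T0] by eventually_elim (use bounds in simp)
  qed (use lim[of "- C"] lim[of D] in simp_all)
  then show ?thesis
    unfolding crit_value_def by (intro tendsto_Lim) auto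
qed

theorem aubry_set_nonempty: "aubry_set f L \<noteq> {}"
proof -
  obtain x where x: "\<And>\<epsilon> \<tau>. \<epsilon> > 0 \<Longrightarrow> \<exists>t a. t \<ge> \<tau> \<and> tconn t x x a \<and> a \<le> mean_cost * t + \<epsilon>"
    using recurrent_point by metis
  let ?h = "\<lambda>t. actionA f L t x x - ereal (mean_cost * t)"
  have "0 \<le> Liminf at_top ?h"
  proof (rule Liminf_bounded)
    show "eventually (\<lambda>t. 0 \<le> ?h t) at_top"
      using eventually_gt_at_top[of 0]
    proof eventually_elim
      case (elim t)
      then show ?case using actionA_loop_ge[OF elim, of x] by (cases "actionA f L t x x") auto
    qed
  qed
  moreover have "\<not> 0 < Liminf at_top ?h"
  proof
    assume "0 < Liminf at_top ?h"
    \<comment> \<open>A positive lower limit would keep the excess of all loops at x beyond some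
      length above a fixed e, against the choice of x.\<close>
    then obtain e where e: "0 < ereal e" "ereal e < Liminf at_top ?h" using ereal_dense2 by blast
    have "eventually (\<lambda>t. ereal e < ?h t) at_top" using less_LiminfD[OF e(2)] .
    then obtain \<tau> where \<tau>: "\<And>t. t \<ge> \<tau> \<Longrightarrow> ereal e < ?h t" unfolding eventually_at_top_linorder by blast
    obtain t a where ta: "t \<ge> \<tau>" "tconn t x x a" "a \<le> mean_cost * t + e" using x[of e \<tau>] e(1) by auto
    have "?h t \<le> ereal a - ereal (mean_cost * t)"
      by (intro ereal_minus_mono actionA_tconn_le ta(2)) simp
    also have "\<dots> \<le> ereal e" using ta(3) by simp
    finally show False using \<tau>[OF ta(1)] by simp
  qed
  ultimately have "peierls f L x x = 0"
    by (simp add: peierls_def crit_value_eq)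
  then show ?thesis by (auto simp: aubry_set_def)
qed

end

section \<open>From the standing assumptions to the locale\<close>

lemma assumption_L_continuous:
  assumes "assumption_L L" shows "continuous_on UNIV (\<lambda>(x, u). L x u)"
proof -
  have "Ck (Suc (Suc 0)) (\<lambda>(x, u). L x u)"
    using assms by (simp add: assumption_L_def numeral_2_eq_2 del: Ck.simps)
  then have "Ck 0 (\<lambda>(x, u). L x u)" by (blast intro: Ck_SucD)
  then show ?thesis by simp
qed

theorem mainTheorem4:
  fixes f :: "'m::finite \<Rightarrow> real^'d \<Rightarrow> real^'d"
    and L :: "real^'d \<Rightarrow> real^'m \<Rightarrow> real"
  assumes "CARD('m) \<le> CARD('d)"
    and "\<forall>i. smooth_field (f i) \<and> periodic_on_torus (f i)"
    and "hoermander f"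
    and "assumption_F f"
    and "assumption_L L"
    and "assumption_S f L"
  shows "aubry_set f L \<noteq> {}"
proof -
  note cont = assumption_L_continuous[OF assms(5)]
  have per: "periodic_on_torus L" using assms(5) by (simp add: assumption_L_def)
  obtain K where K: "\<And>x u. - K \<le> L x u"
  proof -
    obtain K1 K2 \<sigma> where "K1 > 0" "\<And>x u. L x u \<ge> K1 * norm u powr \<sigma> - K2"
      using assms(5) by (auto simp: assumption_L_def)
    then have "- K2 \<le> L x u" for x u
      by (smt (verit) mult_nonneg_nonneg powr_ge_zero)
    then show thesis by (rule that)
  qed
  \<comment> \<open>Compactness bounds L on the unit cell times the unit ball, and periodicity
    extends the bound to all x. The absolute value of B then supplies the nonnegative constant of
    the locale.\<close>
  have "bounded ((\<lambda>(x, u). L x u) ` (cbox 0 1 \<times> cball 0 1))"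
    by (intro compact_imp_bounded compact_continuous_image compact_Times compact_cbox compact_cball continuous_on_subset[OF cont]) simp
  then obtain B where B: "\<And>x u. x \<in> cbox 0 1 \<Longrightarrow> norm u \<le> 1 \<Longrightarrow> \<bar>L x u\<bar> \<le> B"
    unfolding bounded_iff by force
  have "lagrangian_system f L \<bar>B\<bar> K"
  proof
    show "tame_field (f i)" for i using assms(2) by (simp add: tame_field_def)
    show "continuous_on UNIV (\<lambda>x. L x w)" for w
      using continuous_on_compose2[OF cont, of UNIV "\<lambda>x. (x, w)"] by (simp add: continuous_on_Pair)
    show "L x u \<le> \<bar>B\<bar>" if "norm u \<le> 1" for x u
    proof -
      obtain k where k: "int_vec k" "x + k \<in> cbox 0 1" by (rule unit_cell_representative)
      then have "L x u = L (x + k) u" using per by (simp add: periodic_on_torus_def)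
      then show ?thesis using B[OF k(2) that] by simp
    qed
  qed (use assms(3) per K in auto)
  then show ?thesis by (rule lagrangian_system.aubry_set_nonempty)
qed

end
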